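(* Let $(X,T)$ be a dynamical system. If $(X,T)$ is mean equicontinuous, then every ergodic $T$-invariant measure on $(X,T)$ has discrete spectrum, and hence the topological entropy of $(X,T)$ is zero.
   Context: A dynamical system $(X,T)$ is a compact metric space $(X,d)$ together with a continuous map $T\colon X\to X$ (not assumed invertible or surjective). $(X,T)$ is mean equicontinuous if for every $\varepsilon>0$ there is $\delta>0$ such that for all $x,y\in X$ with $d(x,y)<\delta$, $\limsup_{n\to\infty}\frac1n\sum_{i=0}^{n-1}d(T^ix,T^iy)<\varepsilon$. Invariant measures are $T$-invariant regular Borel probability measures on $X$. For an invariant measure $\mu$, a complex number $\lambda$ is an eigenvalue of $(X,T,\mu)$ if there is a nonzero $f\in L^2(\mu)$ with $f(Tx)=\lambda f(x)$ for $\mu$-a.e. $x$; such $f$ is an eigenfunction. The measure $\mu$ (or $(X,T,\mu)$) has discrete spectrum if there is an orthonormal basis of $L^2(\mu)$ consisting of eigenfunctions of $(X,T,\mu)$. *)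

theory Defs
  imports "HOL-Probability.Probability"
begin

section \<open>Dynamical systems and mean equicontinuity\<close>

text \<open>
  The phase space is a compact subset \<open>X\<close> of a metric space type, with the induced metric;
  the values of \<open>T\<close> outside \<open>X\<close> are irrelevant.
\<close>

definition dynamical_system :: "'a::metric_space set \<Rightarrow> ('a \<Rightarrow> 'a) \<Rightarrow> bool" where
  "dynamical_system X T \<longleftrightarrow> compact X \<and> continuous_on X T \<and> T ` X \<subseteq> X"

definition mean_equicontinuous :: "'a::metric_space set \<Rightarrow> ('a \<Rightarrow> 'a) \<Rightarrow> bool" where
  "mean_equicontinuous X T \<longleftrightarrow>
    (\<forall>\<epsilon>>0. \<exists>\<delta>>0. \<forall>x\<in>X. \<forall>y\<in>X. dist x y < \<delta> \<longrightarrow>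
      limsup (\<lambda>n. ereal ((1 / real n) * (\<Sum>i<n. dist ((T ^^ i) x) ((T ^^ i) y)))) < ereal \<epsilon>)"

section \<open>Invariant and ergodic measures\<close>

definition regular_borel_prob :: "'a::metric_space set \<Rightarrow> 'a measure \<Rightarrow> bool" where
  "regular_borel_prob X \<mu> \<longleftrightarrow>
    prob_space \<mu> \<and> sets \<mu> = sets (restrict_space borel X) \<and>
    (\<forall>A\<in>sets \<mu>.
      emeasure \<mu> A = (SUP K\<in>{K. compact K \<and> K \<subseteq> A}. emeasure \<mu> K) \<and>
      emeasure \<mu> A = (INF U\<in>{U. openin (top_of_set X) U \<and> A \<subseteq> U}. emeasure \<mu> U))"

definition invariant_measure :: "'a::metric_space set \<Rightarrow> ('a \<Rightarrow> 'a) \<Rightarrow> 'a measure \<Rightarrow> bool" where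
  "invariant_measure X T \<mu> \<longleftrightarrow>
    regular_borel_prob X \<mu> \<and> T \<in> measurable \<mu> \<mu> \<and> distr \<mu> \<mu> T = \<mu>"

definition ergodic_measure :: "'a::metric_space set \<Rightarrow> ('a \<Rightarrow> 'a) \<Rightarrow> 'a measure \<Rightarrow> bool" where
  "ergodic_measure X T \<mu> \<longleftrightarrow>
    invariant_measure X T \<mu> \<and>
    (\<forall>A\<in>sets \<mu>. T -` A \<inter> space \<mu> = A \<longrightarrow> measure \<mu> A = 0 \<or> measure \<mu> A = 1)"

section \<open>Discrete spectrum\<close>

text \<open>
  Elements of the complex Hilbert space \<open>L\<^sup>2(\<mu>)\<close> are handled through representatives:
  square-integrable functions, with equality meaning equality almost everywhere.
\<close>

definition L2 :: "'a measure \<Rightarrow> ('a \<Rightarrow> complex) set" where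
  "L2 \<mu> = {f \<in> borel_measurable \<mu>. integrable \<mu> (\<lambda>x. (cmod (f x))\<^sup>2)}"

definition L2_inner :: "'a measure \<Rightarrow> ('a \<Rightarrow> complex) \<Rightarrow> ('a \<Rightarrow> complex) \<Rightarrow> complex" where
  "L2_inner \<mu> f g = (\<integral>x. f x * cnj (g x) \<partial>\<mu>)"

definition L2_norm :: "'a measure \<Rightarrow> ('a \<Rightarrow> complex) \<Rightarrow> real" where
  "L2_norm \<mu> f = sqrt (\<integral>x. (cmod (f x))\<^sup>2 \<partial>\<mu>)"

definition eigenfunction :: "('a \<Rightarrow> 'a) \<Rightarrow> 'a measure \<Rightarrow> complex \<Rightarrow> ('a \<Rightarrow> complex) \<Rightarrow> bool" where
  "eigenfunction T \<mu> \<zeta> f \<longleftrightarrow>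
    f \<in> L2 \<mu> \<and> \<not> (AE x in \<mu>. f x = 0) \<and> (AE x in \<mu>. f (T x) = \<zeta> * f x)"

text \<open>
  Distinct members of \<open>B\<close> are orthogonal unit vectors, so no class in \<open>L\<^sup>2(\<mu>)\<close> is represented
  twice. The last conjunct says that the linear span of \<open>B\<close> is dense.
\<close>

definition orthonormal_basis_L2 :: "'a measure \<Rightarrow> ('a \<Rightarrow> complex) set \<Rightarrow> bool" where
  "orthonormal_basis_L2 \<mu> B \<longleftrightarrow>
    B \<subseteq> L2 \<mu> \<and>
    (\<forall>f\<in>B. \<forall>g\<in>B. L2_inner \<mu> f g = (if f = g then 1 else 0)) \<and>
    (\<forall>f\<in>L2 \<mu>. \<forall>\<epsilon>>0. \<exists>F c. finite F \<and> F \<subseteq> B \<and>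
      L2_norm \<mu> (\<lambda>x. f x - (\<Sum>g\<in>F. c g * g x)) < \<epsilon>)"

definition discrete_spectrum :: "('a \<Rightarrow> 'a) \<Rightarrow> 'a measure \<Rightarrow> bool" where
  "discrete_spectrum T \<mu> \<longleftrightarrow>
    (\<exists>B. orthonormal_basis_L2 \<mu> B \<and> (\<forall>f\<in>B. \<exists>\<zeta>. eigenfunction T \<mu> \<zeta> f))"

section \<open>Topological entropy\<close>

text \<open>The definition of Adler, Konheim and McAndrew by open covers.\<close>

definition open_cover :: "'a::metric_space set \<Rightarrow> 'a set set \<Rightarrow> bool" where
  "open_cover X \<U> \<longleftrightarrow> (\<forall>U\<in>\<U>. openin (top_of_set X) U) \<and> \<Union>\<U> = X"

text \<open>
  The common refinement of the preimages of \<open>\<U>\<close> under \<open>T ^^ i\<close> for \<open>i < n\<close>.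
\<close>

definition iterated_join :: "'a set \<Rightarrow> ('a \<Rightarrow> 'a) \<Rightarrow> 'a set set \<Rightarrow> nat \<Rightarrow> 'a set set" where
  "iterated_join X T \<U> n =
    {X \<inter> (\<Inter>i<n. (T ^^ i) -` V i) | V. \<forall>i<n. V i \<in> \<U>}"

text \<open>For an open cover of a compact \<open>X\<close> a finite subcover exists, so the minimum is attained.\<close>

definition min_subcover_card :: "'a set \<Rightarrow> 'a set set \<Rightarrow> nat" where
  "min_subcover_card X \<C> = (LEAST k. \<exists>\<V>\<subseteq>\<C>. finite \<V> \<and> card \<V> = k \<and> X \<subseteq> \<Union>\<V>)"

text \<open>
  The limit exists by subadditivity, so the limit superior is the limit. For empty \<open>X\<close> the
  convention \<open>ln 0 = 0\<close> makes the entropy \<open>0\<close>.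
\<close>

definition cover_entropy :: "'a set \<Rightarrow> ('a \<Rightarrow> 'a) \<Rightarrow> 'a set set \<Rightarrow> ereal" where
  "cover_entropy X T \<U> =
    limsup (\<lambda>n. ereal (ln (real (min_subcover_card X (iterated_join X T \<U> n))) / real n))"

definition topological_entropy :: "'a::metric_space set \<Rightarrow> ('a \<Rightarrow> 'a) \<Rightarrow> ereal" where
  "topological_entropy X T = (SUP \<U>\<in>{\<U>. open_cover X \<U>}. cover_entropy X T \<U>)"

end

theory Submission
  imports Defs "HOL-Complex_Analysis.Great_Picard" "Jordan_Normal_Form.Spectral_Radius"
begin

text \<open>
  Let \<open>L x y\<close> be the limit superior of the averages of \<open>d (T\<^sup>i x) (T\<^sup>i y)\<close>. Mean equicontinuity says
  that this invariant pseudometric is continuous. Then \<open>{L \<le> \<epsilon>}\<close> is compact and invariant, and cutting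
  orbits into pieces makes the averages uniformly small there. Hence finitely many
  orbits approximate all others outside a small proportion of times, and counting the exceptional
  sets of times bounds the entropy, without the variational principle.

  For an ergodic \<open>\<mu>\<close> the invariant kernel \<open>max 0 (\<epsilon> - L x y)\<close> defines a compact self-adjoint operator
  on \<open>L\<^sup>2\<close> that commutes with the Koopman operator. Its nonzero eigenspaces are finite-dimensional
  and Koopman-invariant, so it vanishes on the orthogonal complement of the Koopman eigenfunctions and
  its range lies in their closed span. Normalized, it is
  close to the identity on Lipschitz functions as \<open>\<epsilon>\<close> tends to \<open>0\<close>, by the uniform estimate on \<open>{L \<le> \<epsilon>}\<close>.
\<close>

section \<open>The mean orbit pseudometric\<close>

text \<open>Mean equicontinuity bounds a limit superior, so every pair of points has its own waiting
  time, while both conclusions need one time that serves all pairs with small \<open>L\<close>.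
  \<open>T\<close> may fail to be invertible, so the Koopman operator is only an isometry. Its
  spectral theory is avoided: the eigenfunction that contradicts a nonzero operator on the
  complement comes from a finite matrix, the Koopman action on an eigenspace of the self-adjoint
  operator. Ergodicity acts in two places. It makes Koopman eigenspaces one-dimensional, so one unit
  vector per eigenvalue yields an orthonormal family; and it makes the integral of the kernel over
  its second variable almost everywhere equal to one positive number \<open>c\<close>, by which the
  operator is normalized. Nothing is proved about the size of \<open>c\<close> in terms of
  \<open>\<epsilon>\<close>; the approximation estimate is arranged so that \<open>c\<close>
  cancels.\<close>

definition orbit_dist :: "('a::metric_space \<Rightarrow> 'a) \<Rightarrow> nat \<Rightarrow> 'a \<Rightarrow> 'a \<Rightarrow> real" where
  "orbit_dist T n x y = (\<Sum>i<n. dist ((T ^^ i) x) ((T ^^ i) y))"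

text \<open>The real-valued form is harmless on \<open>X\<close>: there the averages lie between 0
  and the diameter, so the limit superior is finite and \<open>real_of_ereal\<close> never reaches
  its default value 0 for infinities.\<close>

definition mean_dist :: "('a::metric_space \<Rightarrow> 'a) \<Rightarrow> 'a \<Rightarrow> 'a \<Rightarrow> real" where
  "mean_dist T x y = real_of_ereal (limsup (\<lambda>n. ereal ((1 / real n) * orbit_dist T n x y)))"

lemma orbit_dist_nonneg: "0 \<le> orbit_dist T n x y"
  by (simp add: orbit_dist_def sum_nonneg)

lemma orbit_dist_commute: "orbit_dist T n x y = orbit_dist T n y x"
  by (simp add: orbit_dist_def dist_commute)

lemma orbit_dist_triangle: "orbit_dist T n x z \<le> orbit_dist T n x y + orbit_dist T n y z"
  unfolding orbit_dist_def sum.distrib[symmetric] by (intro sum_mono dist_triangle)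

text \<open>The cocycle identity is the reason for working with sums that are not divided by
  \<open>n\<close>: orbit segments can be cut and glued without changing weights.\<close>

lemma orbit_dist_add:
  "orbit_dist T (m + n) x y = orbit_dist T m x y + orbit_dist T n ((T ^^ m) x) ((T ^^ m) y)"
proof -
  have "orbit_dist T (m + n) x y = (\<Sum>i\<in>{0..<m + n}. dist ((T ^^ i) x) ((T ^^ i) y))"
    by (simp add: orbit_dist_def atLeast0LessThan)
  also have "\<dots> = (\<Sum>i\<in>{0..<m}. dist ((T ^^ i) x) ((T ^^ i) y)) + (\<Sum>i\<in>{m..<m + n}. dist ((T ^^ i) x) ((T ^^ i) y))"
    by (simp add: sum.atLeastLessThan_concat)
  also have "(\<Sum>i\<in>{m..<m + n}. dist ((T ^^ i) x) ((T ^^ i) y)) = (\<Sum>i\<in>{0..<n}. dist ((T ^^ (i + m)) x) ((T ^^ (i + m)) y))"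
    using sum.shift_bounds_nat_ivl[of "\<lambda>i. dist ((T ^^ i) x) ((T ^^ i) y)" 0 m n] by (simp add: add.commute)
  finally show ?thesis
    by (simp add: orbit_dist_def atLeast0LessThan funpow_add)
qed

section \<open>Invariance and continuity of the limit pseudometric on a compact system\<close>

locale mean_equicontinuous_system =
  fixes X :: "'a::metric_space set" and T :: "'a \<Rightarrow> 'a"
  assumes system: "dynamical_system X T" and mean_equi: "mean_equicontinuous X T"
begin

lemma compact_X: "compact X" and continuous_T: "continuous_on X T" and T_closed: "x \<in> X \<Longrightarrow> T x \<in> X"
  using system by (auto simp: dynamical_system_def)

lemma funpow_closed: "x \<in> X \<Longrightarrow> (T ^^ i) x \<in> X"
  by (induction i) (auto simp: T_closed)

lemma continuous_funpow: "continuous_on X (T ^^ i)"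
proof (induction i)
  case (Suc i)
  have "continuous_on X (T \<circ> (T ^^ i))"
    by (rule continuous_on_compose[OF Suc continuous_on_subset[OF continuous_T]]) (auto simp: funpow_closed)
  then show ?case by simp
qed (simp add: id_def)

lemma diameter_bound_ex: "\<exists>d>0. \<forall>x\<in>X. \<forall>y\<in>X. dist x y \<le> d"
proof -
  obtain e where "\<forall>x\<in>X. \<forall>y\<in>X. dist x y \<le> e"
    using compact_imp_bounded[OF compact_X] by (auto simp: bounded_two_points)
  then show ?thesis
    by (intro exI[of _ "\<bar>e\<bar> + 1"]) (fastforce simp: abs_if)
qed

definition diam_bound where "diam_bound = (SOME d. d > 0 \<and> (\<forall>x\<in>X. \<forall>y\<in>X. dist x y \<le> d))"

lemma diam_bound_pos: "diam_bound > 0" and dist_le_diam_bound: "x \<in> X \<Longrightarrow> y \<in> X \<Longrightarrow> dist x y \<le> diam_bound"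
  using someI_ex[OF diameter_bound_ex] unfolding diam_bound_def by blast+

lemma orbit_dist_le: "x \<in> X \<Longrightarrow> y \<in> X \<Longrightarrow> orbit_dist T n x y \<le> real n * diam_bound"
  unfolding orbit_dist_def using sum_bounded_above[of "{..<n}" _ diam_bound]
  by (simp add: dist_le_diam_bound funpow_closed)

abbreviation L where "L \<equiv> mean_dist T"

lemma limsup_eq_mean_dist:
  assumes "x \<in> X" "y \<in> X"
  shows "limsup (\<lambda>n. ereal ((1 / real n) * orbit_dist T n x y)) = ereal (L x y)"
proof -
  have "limsup (\<lambda>n. ereal ((1 / real n) * orbit_dist T n x y)) \<le> ereal diam_bound"
  proof (rule Limsup_bounded, rule eventually_sequentiallyI[of 1])
    fix n :: nat assume "1 \<le> n"
    then show "ereal ((1 / real n) * orbit_dist T n x y) \<le> ereal diam_bound"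
      using orbit_dist_le[OF assms, of n] by (simp add: field_simps)
  qed
  moreover have "ereal 0 \<le> limsup (\<lambda>n. ereal ((1 / real n) * orbit_dist T n x y))"
    by (rule le_Limsup) (auto simp: orbit_dist_nonneg)
  ultimately show ?thesis
    unfolding mean_dist_def
    by (cases "limsup (\<lambda>n. ereal ((1 / real n) * orbit_dist T n x y))") auto
qed

lemma mean_dist_nonneg: "x \<in> X \<Longrightarrow> y \<in> X \<Longrightarrow> 0 \<le> L x y"
proof -
  assume *: "x \<in> X" "y \<in> X"
  have "ereal 0 \<le> limsup (\<lambda>n. ereal ((1 / real n) * orbit_dist T n x y))"
    by (rule le_Limsup) (auto simp: orbit_dist_nonneg)
  then show ?thesis using limsup_eq_mean_dist[OF *] by simp
qed

text \<open>Only a strict bound on \<open>L\<close> passes to the averages, and in return an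
  eventual bound gives only a weak inequality for \<open>L\<close>. Hence the slack \<open>e\<close>
  in the arguments below.\<close>

lemma mean_dist_lessD:
  assumes "x \<in> X" "y \<in> X" "L x y < c"
  shows "\<forall>\<^sub>F n in sequentially. orbit_dist T n x y < c * real n"
proof -
  have "limsup (\<lambda>n. ereal ((1 / real n) * orbit_dist T n x y)) < ereal c"
    using limsup_eq_mean_dist[OF assms(1,2)] assms(3) by simp
  then have "\<forall>\<^sub>F n in sequentially. ereal ((1 / real n) * orbit_dist T n x y) < ereal c"
    by (rule Limsup_lessD)
  then show ?thesis
    using eventually_gt_at_top[of 0] by eventually_elim (simp add: field_simps)
qed

lemma mean_dist_leI:
  assumes "x \<in> X" "y \<in> X" and ev: "\<forall>\<^sub>F n in sequentially. orbit_dist T n x y \<le> c * real n"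
  shows "L x y \<le> c"
proof -
  have "limsup (\<lambda>n. ereal ((1 / real n) * orbit_dist T n x y)) \<le> ereal c"
    by (rule Limsup_bounded) (use ev eventually_gt_at_top[of 0] in eventually_elim, simp add: field_simps)
  then show ?thesis using limsup_eq_mean_dist[OF assms(1,2)] by simp
qed

lemma mean_dist_commute: "L x y = L y x"
  by (simp add: mean_dist_def orbit_dist_commute[of T _ x y])

lemma mean_dist_triangle:
  assumes "x \<in> X" "y \<in> X" "z \<in> X"
  shows "L x z \<le> L x y + L y z"
proof (rule field_le_epsilon)
  fix e :: real assume "e > 0"
  have "\<forall>\<^sub>F n in sequentially. orbit_dist T n x z \<le> (L x y + L y z + e) * real n"
  proof -
    have "\<forall>\<^sub>F n in sequentially. orbit_dist T n x y < (L x y + e / 2) * real n"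
      "\<forall>\<^sub>F n in sequentially. orbit_dist T n y z < (L y z + e / 2) * real n"
      using assms \<open>e > 0\<close> by (auto intro!: mean_dist_lessD)
    then show ?thesis
    proof eventually_elim
      case (elim n)
      have "(L x y + e / 2) * real n + (L y z + e / 2) * real n = (L x y + L y z + e) * real n"
        by (simp add: algebra_simps)
      then show ?case
        using orbit_dist_triangle[of T n x z y] elim by linarith
    qed
  qed
  then show "L x z \<le> L x y + L y z + e"
    using assms by (intro mean_dist_leI) auto
qed

text \<open>The segment of length \<open>n\<close> from \<open>T x\<close> is the tail of the
  segment of length \<open>n + 1\<close> from \<open>x\<close>, and dropping the first term can only
  decrease the sum.\<close>

lemma mean_dist_invariant_le:
  assumes "x \<in> X" "y \<in> X"
  shows "L (T x) (T y) \<le> L x y"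
proof (rule field_le_epsilon)
  fix e :: real assume "e > 0"
  have "\<forall>\<^sub>F n in sequentially. orbit_dist T n x y < (L x y + e / 2) * real n"
    using assms \<open>e > 0\<close> by (intro mean_dist_lessD) auto
  then have "\<forall>\<^sub>F n in sequentially. orbit_dist T (Suc n) x y < (L x y + e / 2) * real (Suc n)"
    by (subst eventually_sequentially_Suc)
  \<comment> \<open>The bound for \<open>n + 1\<close> terms contains one summand
    \<open>L x y + e / 2\<close> too many; from \<open>N\<close> on it is paid by half of the slack,
    \<open>real n * (e / 2)\<close>.\<close>
  moreover obtain N where N: "real N > (L x y + e / 2) / (e / 2)"
    using reals_Archimedean2 by blast
  have "\<forall>\<^sub>F n in sequentially. n \<ge> N" by (rule eventually_ge_at_top)
  ultimately have "\<forall>\<^sub>F n in sequentially. orbit_dist T n (T x) (T y) \<le> (L x y + e) * real n"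
  proof eventually_elim
    case (elim n)
    have "real n > (L x y + e / 2) / (e / 2)" using elim N by linarith
    then have "real n * (e / 2) > L x y + e / 2" using \<open>e > 0\<close> by (simp add: field_simps)
    moreover have "orbit_dist T n (T x) (T y) \<le> orbit_dist T (Suc n) x y"
      using orbit_dist_add[of T 1 n x y] orbit_dist_nonneg[of T 1 x y] by simp
    moreover have "(L x y + e / 2) * real (Suc n) = (L x y + e / 2) + (L x y + e) * real n - real n * (e / 2)"
      by (simp add: field_simps)
    ultimately show ?case using elim by linarith
  qed
  then show "L (T x) (T y) \<le> L x y + e"
    using assms by (intro mean_dist_leI) (auto simp: T_closed)
qed

text \<open>Conversely, putting the starting pair back in front costs at most
  \<open>diam_bound\<close>, which is negligible after division by \<open>n\<close>.\<close>

lemma mean_dist_invariant: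
  assumes "x \<in> X" "y \<in> X"
  shows "L (T x) (T y) = L x y"
proof (rule antisym[OF mean_dist_invariant_le[OF assms]], rule field_le_epsilon)
  fix e :: real assume "e > 0"
  have "\<forall>\<^sub>F n in sequentially. orbit_dist T n (T x) (T y) < (L (T x) (T y) + e / 2) * real n"
    using assms \<open>e > 0\<close> by (intro mean_dist_lessD) (auto simp: T_closed)
  moreover obtain N where N: "real N > diam_bound / (e / 2)"
    using reals_Archimedean2 by blast
  have "\<forall>\<^sub>F n in sequentially. n \<ge> N" by (rule eventually_ge_at_top)
  ultimately have "\<forall>\<^sub>F n in sequentially. orbit_dist T n x y \<le> (L (T x) (T y) + e) * real n"
  proof eventually_elim
    case (elim n)
    have "real n > diam_bound / (e / 2)" using elim N by linarith
    then have "real n * (e / 2) > diam_bound" using \<open>e > 0\<close> by (simp add: field_simps)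
    moreover have "orbit_dist T n x y \<le> orbit_dist T (1 + n) x y"
      using orbit_dist_add[of T n 1 x y] orbit_dist_nonneg[of T 1] by (simp add: add.commute)
    moreover have "orbit_dist T (1 + n) x y \<le> diam_bound + orbit_dist T n (T x) (T y)"
      using orbit_dist_add[of T 1 n x y] orbit_dist_le[OF assms, of 1] by simp
    ultimately show ?case using elim by (simp add: algebra_simps)
  qed
  then show "L x y \<le> L (T x) (T y) + e"
    using assms by (intro mean_dist_leI)
qed

lemma mean_dist_funpow: "x \<in> X \<Longrightarrow> y \<in> X \<Longrightarrow> L ((T ^^ i) x) ((T ^^ i) y) = L x y"
  by (induction i) (auto simp: mean_dist_invariant funpow_closed)

text \<open>This is mean equicontinuity itself, read as continuity of \<open>L\<close> at the
  diagonal. The triangle inequality spreads it to continuity everywhere.\<close>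

lemma mean_dist_small:
  assumes "\<epsilon> > 0"
  obtains \<delta> where "\<delta> > 0" "\<And>x y. x \<in> X \<Longrightarrow> y \<in> X \<Longrightarrow> dist x y < \<delta> \<Longrightarrow> L x y < \<epsilon>"
proof -
  obtain \<delta> where \<delta>: "\<delta> > 0" and lim: "\<forall>x\<in>X. \<forall>y\<in>X. dist x y < \<delta> \<longrightarrow>
      limsup (\<lambda>n. ereal ((1 / real n) * orbit_dist T n x y)) < ereal \<epsilon>"
    using mean_equi assms unfolding mean_equicontinuous_def orbit_dist_def by blast
  show thesis
  proof (rule that[OF \<delta>])
    fix x y assume "x \<in> X" "y \<in> X" "dist x y < \<delta>"
    then have "ereal (L x y) < ereal \<epsilon>" using lim limsup_eq_mean_dist[of x y] by metis
    then show "L x y < \<epsilon>" by simp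
  qed
qed

lemma mean_dist_diff_le:
  assumes "x \<in> X" "y \<in> X" "x' \<in> X" "y' \<in> X"
  shows "\<bar>L x y - L x' y'\<bar> \<le> L x x' + L y y'"
  using mean_dist_triangle[of x x' y] mean_dist_triangle[of x' y' y] mean_dist_triangle[of x' x y']
    mean_dist_triangle[of x y y'] mean_dist_commute[of y y'] mean_dist_commute[of x x'] assms
  by (auto simp: abs_le_iff)

lemma mean_dist_tendsto_0:
  assumes "\<And>n. u n \<in> X" "a \<in> X" "u \<longlonglongrightarrow> a"
  shows "(\<lambda>n. L (u n) a) \<longlonglongrightarrow> 0"
proof (rule LIMSEQ_I)
  fix e :: real assume "e > 0"
  then obtain \<delta> where \<delta>: "\<delta> > 0" "\<And>x y. x \<in> X \<Longrightarrow> y \<in> X \<Longrightarrow> dist x y < \<delta> \<Longrightarrow> L x y < e"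
    using mean_dist_small by blast
  from assms(3) \<delta>(1) obtain N where "\<forall>n\<ge>N. dist (u n) a < \<delta>"
    by (auto simp: LIMSEQ_def)
  then show "\<exists>N. \<forall>n\<ge>N. norm (L (u n) a - 0) < e"
    using \<delta>(2) assms mean_dist_nonneg by (intro exI[of _ N]) auto
qed

lemma continuous_orbit_dist:
  assumes "\<And>n. u n \<in> X" "a \<in> X" "u \<longlonglongrightarrow> a" "\<And>n. v n \<in> X" "b \<in> X" "v \<longlonglongrightarrow> b"
  shows "(\<lambda>n. orbit_dist T m (u n) (v n)) \<longlonglongrightarrow> orbit_dist T m a b"
proof -
  have "(\<lambda>n. (T ^^ i) (w n)) \<longlonglongrightarrow> (T ^^ i) c" if "\<And>n. w n \<in> X" "c \<in> X" "w \<longlonglongrightarrow> c" for i w c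
    using continuous_on_tendsto_compose[OF continuous_funpow that(3,2)] that(1) by simp
  then show ?thesis
    unfolding orbit_dist_def using assms by (intro tendsto_sum tendsto_dist) auto
qed

text \<open>Pointwise smallness of the limit superior becomes uniform on the closed invariant set
  of pairs with \<open>L x y \<le> \<epsilon>\<close>: by compactness every such pair has small mean distance at some time
  below a common bound, and an orbit segment is cut into pieces of such lengths.\<close>

lemma uniform_mean_dist:
  assumes "\<epsilon> > 0"
  obtains N where "\<And>x y n. x \<in> X \<Longrightarrow> y \<in> X \<Longrightarrow> L x y \<le> \<epsilon> \<Longrightarrow> N \<le> n \<Longrightarrow> orbit_dist T n x y \<le> 3 * \<epsilon> * real n"
proof -
  \<comment> \<open>Otherwise there are pairs \<open>p M\<close> that are bad at all times up to
    \<open>M\<close>. A limit pair still has \<open>L x y \<le> \<epsilon>\<close>, so it is good at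
    some fixed time \<open>n\<close>, yet badness at time \<open>n\<close> survives the limit
    because \<open>orbit_dist T n\<close> is continuous.\<close>
  have "\<exists>M. \<forall>x\<in>X. \<forall>y\<in>X. L x y \<le> \<epsilon> \<longrightarrow> (\<exists>n\<ge>1. n \<le> M \<and> orbit_dist T n x y < 2 * \<epsilon> * real n)"
  proof (rule ccontr)
    assume "\<not> ?thesis"
    then have "\<forall>M. \<exists>p. fst p \<in> X \<and> snd p \<in> X \<and> L (fst p) (snd p) \<le> \<epsilon> \<and>
        (\<forall>n. 1 \<le> n \<and> n \<le> M \<longrightarrow> orbit_dist T n (fst p) (snd p) \<ge> 2 * \<epsilon> * real n)"
      by (simp add: not_less) blast
    then obtain p where p: "\<And>M. fst (p M) \<in> X" "\<And>M. snd (p M) \<in> X" "\<And>M. L (fst (p M)) (snd (p M)) \<le> \<epsilon>"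
      "\<And>M n. 1 \<le> n \<Longrightarrow> n \<le> M \<Longrightarrow> orbit_dist T n (fst (p M)) (snd (p M)) \<ge> 2 * \<epsilon> * real n"
      by metis
    have "seq_compact (X \<times> X)"
      using compact_X by (simp add: compact_Times flip: compact_eq_seq_compact_metric)
    moreover have "\<forall>n. p n \<in> X \<times> X" using p(1,2) by (simp add: mem_Times_iff)
    ultimately obtain q r where q: "q \<in> X \<times> X" "strict_mono r" "(p \<circ> r) \<longlonglongrightarrow> q"
      unfolding seq_compact_def by metis
    define x y where "x = fst q" and "y = snd q"
    define u v where "u n = fst (p (r n))" and "v n = snd (p (r n))" for n
    have xy: "x \<in> X" "y \<in> X" using q(1) by (auto simp: x_def y_def)
    have u: "u \<longlonglongrightarrow> x" "\<And>n. u n \<in> X" and v: "v \<longlonglongrightarrow> y" "\<And>n. v n \<in> X"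
      using tendsto_fst[OF q(3)] tendsto_snd[OF q(3)] p(1,2)
      by (simp_all add: u_def[abs_def] v_def[abs_def] x_def y_def o_def)
    have "L x y \<le> \<epsilon>"
    proof (rule LIMSEQ_le_const)
      show "(\<lambda>n. \<epsilon> + (L (u n) x + L (v n) y)) \<longlonglongrightarrow> \<epsilon>"
        using tendsto_add[OF tendsto_const tendsto_add[OF mean_dist_tendsto_0[OF u(2) xy(1) u(1)] mean_dist_tendsto_0[OF v(2) xy(2) v(1)]], of \<epsilon>]
        by simp
      have "L x y \<le> \<epsilon> + (L (u n) x + L (v n) y)" for n
        using mean_dist_diff_le[OF u(2) v(2) xy, of n n] p(3)[of "r n"] by (simp add: u_def v_def abs_le_iff)
      then show "\<exists>N. \<forall>n\<ge>N. L x y \<le> \<epsilon> + (L (u n) x + L (v n) y)" by blast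
    qed
    then have "\<forall>\<^sub>F n in sequentially. orbit_dist T n x y < 2 * \<epsilon> * real n"
      using assms xy by (intro mean_dist_lessD) auto
    then obtain n where n: "n \<ge> 1" "orbit_dist T n x y < 2 * \<epsilon> * real n"
      unfolding eventually_sequentially by (meson max.cobounded1 max.cobounded2)
    have "2 * \<epsilon> * real n \<le> orbit_dist T n x y"
    proof (rule LIMSEQ_le_const)
      show "(\<lambda>k. orbit_dist T n (u k) (v k)) \<longlonglongrightarrow> orbit_dist T n x y"
        by (rule continuous_orbit_dist[OF u(2) xy(1) u(1) v(2) xy(2) v(1)])
      \<comment> \<open>Since \<open>r k \<ge> k\<close>, the pair with index \<open>r k\<close> is
        bad at time \<open>n\<close> as soon as \<open>k \<ge> n\<close>.\<close>
      show "\<exists>N. \<forall>k\<ge>N. 2 * \<epsilon> * real n \<le> orbit_dist T n (u k) (v k)"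
        using p(4)[OF n(1)] seq_suble[OF q(2)] unfolding u_def v_def by (meson order_trans)
    qed
    with n show False by simp
  qed
  then obtain M where M: "\<And>x y. x \<in> X \<Longrightarrow> y \<in> X \<Longrightarrow> L x y \<le> \<epsilon> \<Longrightarrow> \<exists>n\<ge>1. n \<le> M \<and> orbit_dist T n x y < 2 * \<epsilon> * real n"
    by blast
  \<comment> \<open>Good pieces of length between 1 and \<open>M\<close> are split off; the
    remaining pair again has \<open>L \<le> \<epsilon>\<close> by invariance. Only the last piece,
    of length at most \<open>M\<close>, is estimated by the diameter.\<close>
  have chunk: "orbit_dist T n x y \<le> 2 * \<epsilon> * real n + real M * diam_bound" if "x \<in> X" "y \<in> X" "L x y \<le> \<epsilon>" for x y n
    using that
  proof (induction n arbitrary: x y rule: less_induct)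
    case (less n)
    obtain k where k: "k \<ge> 1" "k \<le> M" "orbit_dist T k x y < 2 * \<epsilon> * real k"
      using M less.prems by blast
    show ?case
    proof (cases "n \<le> M")
      case True
      have "orbit_dist T n x y \<le> real n * diam_bound" by (rule orbit_dist_le[OF less.prems(1,2)])
      also have "\<dots> \<le> real M * diam_bound" using True diam_bound_pos by (intro mult_right_mono) auto
      also have "\<dots> \<le> 2 * \<epsilon> * real n + real M * diam_bound" using assms by simp
      finally show ?thesis .
    next
      case False
      have "orbit_dist T n x y = orbit_dist T k x y + orbit_dist T (n - k) ((T ^^ k) x) ((T ^^ k) y)"
        using orbit_dist_add[of T k "n - k" x y] False k by simp
      also have "orbit_dist T (n - k) ((T ^^ k) x) ((T ^^ k) y) \<le> 2 * \<epsilon> * real (n - k) + real M * diam_bound"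
        using False k less.prems by (intro less.IH) (auto simp: funpow_closed mean_dist_funpow)
      finally show ?thesis using k False by (simp add: of_nat_diff algebra_simps)
    qed
  qed
  \<comment> \<open>From \<open>N\<close> on the cost of the last piece is below
    \<open>\<epsilon> * real n\<close>, which turns the factor 2 into 3.\<close>
  obtain N where N: "real N > real M * diam_bound / \<epsilon>" using reals_Archimedean2 by blast
  show thesis
  proof (rule that)
    fix x y n assume *: "x \<in> X" "y \<in> X" "L x y \<le> \<epsilon>" "N \<le> n"
    have "real n > real M * diam_bound / \<epsilon>" using N *(4) by linarith
    then have "\<epsilon> * real n > real M * diam_bound" using assms by (simp add: field_simps)
    then show "orbit_dist T n x y \<le> 3 * \<epsilon> * real n"
      using chunk[OF *(1-3), of n] by simp
  qed
qed

end

section \<open>Topological entropy\<close>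

text \<open>The binomial theorem in subset form; it will sum a weight \<open>t\<close> per
  exceptional time over all sets of exceptional times.\<close>

lemma sum_power_card_Pow:
  fixes t :: "'b::comm_semiring_1"
  assumes "finite A"
  shows "(\<Sum>I\<in>Pow A. t ^ card I) = (1 + t) ^ card A"
  using assms
proof (induction A)
  case (insert a A)
  have "(\<Sum>I\<in>Pow (insert a A). t ^ card I) = (\<Sum>I\<in>Pow A. t ^ card I) + (\<Sum>I\<in>insert a ` Pow A. t ^ card I)"
    unfolding Pow_insert using insert by (intro sum.union_disjoint) auto
  also have "(\<Sum>I\<in>insert a ` Pow A. t ^ card I) = (\<Sum>I\<in>Pow A. t ^ card (insert a I))"
    using insert(2) by (subst sum.reindex) (auto simp: inj_on_def o_def)
  also have "\<dots> = (\<Sum>I\<in>Pow A. t * t ^ card I)"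
    using insert by (intro sum.cong refl) (auto simp: card_insert_if finite_subset)
  finally show ?case using insert by (simp add: sum_distrib_left[symmetric] algebra_simps)
qed simp

lemma min_subcover_card_le:
  assumes "\<V> \<subseteq> \<C>" "finite \<V>" "X \<subseteq> \<Union>\<V>"
  shows "min_subcover_card X \<C> \<le> card \<V>"
  unfolding min_subcover_card_def using assms by (intro Least_le) blast

context mean_equicontinuous_system
begin

lemma finite_net:
  assumes "\<delta> > 0"
  obtains C where "C \<subseteq> X" "finite C" "X \<subseteq> (\<Union>c\<in>C. ball c \<delta>)"
  using compactE_image[OF compact_X, of X "\<lambda>c. ball c \<delta>"] assms
  by (metis UN_I centre_in_ball open_ball subsetI)

text \<open>A point \<open>y\<close> is encoded by a reference point \<open>c\<close>, the set
  \<open>I\<close> of times at which its orbit is far from that of \<open>c\<close>, and one member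
  of the finite subcover for each time in \<open>I\<close>. At all other times the orbit of
  \<open>c\<close> dictates the cover element, since a whole \<open>e\<close>-ball fits into it. The
  right-hand side counts the codes.\<close>

lemma iterated_join_subcover_bound:
  fixes \<U> \<V> :: "'a set set"
  assumes \<V>: "\<V> \<subseteq> \<U>" "finite \<V>" "X \<subseteq> \<Union>\<V>" and C: "finite C" "C \<subseteq> X"
    and leb: "\<And>x. x \<in> X \<Longrightarrow> \<exists>U\<in>\<U>. ball x e \<inter> X \<subseteq> U"
    and near: "\<And>y. y \<in> X \<Longrightarrow> \<exists>c\<in>C. card {i. i < n \<and> e \<le> dist ((T ^^ i) c) ((T ^^ i) y)} \<le> k"
  shows "min_subcover_card X (iterated_join X T \<U> n) \<le>
    card C * (\<Sum>I\<in>{I. I \<subseteq> {..<n} \<and> card I \<le> k}. card \<V> ^ card I)"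
proof -
  define J where "J = {I. I \<subseteq> {..<n} \<and> card I \<le> k}"
  have fin_J: "finite J" unfolding J_def by (rule finite_subset[of _ "Pow {..<n}"]) auto
  have fin: "finite I" if "I \<in> J" for I using that finite_subset[of I "{..<n}"] by (auto simp: J_def)
  define P where "P = C \<times> (SIGMA I:J. PiE I (\<lambda>_. \<V>))"
  obtain W where W: "\<And>x. x \<in> X \<Longrightarrow> W x \<in> \<U>" "\<And>x. x \<in> X \<Longrightarrow> ball x e \<inter> X \<subseteq> W x"
    using leb by metis
  \<comment> \<open>The decoding: free choice \<open>w\<close> at exceptional times, the element
    around the reference orbit elsewhere.\<close>
  define V where "V p i = (case p of (c, I, w) \<Rightarrow> if i \<in> I then w i else W ((T ^^ i) c))" for p :: "'a \<times> nat set \<times> (nat \<Rightarrow> 'a set)" and i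
  define S where "S = (\<lambda>p. X \<inter> (\<Inter>i<n. (T ^^ i) -` V p i)) ` P"
  have fin_P: "finite P" unfolding P_def using fin_J fin C(1) \<V>(2)
    by (intro finite_cartesian_product finite_SigmaI finite_PiE) auto
  have "V p i \<in> \<U>" if "p \<in> P" "i < n" for p i
  proof -
    obtain c I w where p: "p = (c, I, w)" "c \<in> C" "w \<in> PiE I (\<lambda>_. \<V>)"
      using \<open>p \<in> P\<close> unfolding P_def by auto
    then show ?thesis
      using \<V>(1) C(2) W(1)[OF funpow_closed, of c i] by (auto simp: V_def dest: PiE_mem)
  qed
  then have sub: "S \<subseteq> iterated_join X T \<U> n"
    unfolding S_def iterated_join_def by blast
  have cover: "X \<subseteq> \<Union>S"
  proof
    fix y assume y: "y \<in> X"
    then obtain c where c: "c \<in> C" "card {i. i < n \<and> e \<le> dist ((T ^^ i) c) ((T ^^ i) y)} \<le> k"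
      using near by blast
    define I where "I = {i. i < n \<and> e \<le> dist ((T ^^ i) c) ((T ^^ i) y)}"
    have I: "I \<in> J" using c by (auto simp: J_def I_def)
    have "\<forall>i. \<exists>U\<in>\<V>. (T ^^ i) y \<in> U" using \<V>(3) funpow_closed[OF y] by blast
    then obtain w where w: "\<And>i. w i \<in> \<V>" "\<And>i. (T ^^ i) y \<in> w i" by metis
    \<comment> \<open>Restriction makes the choice function extensional, as membership in
      \<open>PiE\<close> demands; only so is the set of codes finite.\<close>
    define p where "p = (c, I, restrict w I)"
    have "p \<in> P" using c I w by (auto simp: p_def P_def)
    moreover have "y \<in> (T ^^ i) -` V p i" if "i < n" for i
    proof (cases "i \<in> I")
      case True then show ?thesis using w by (simp add: V_def p_def)
    next
      case False
      then have "(T ^^ i) y \<in> ball ((T ^^ i) c) e \<inter> X" using that funpow_closed[OF y] by (auto simp: I_def)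
      moreover have "(T ^^ i) c \<in> X" using c(1) C(2) funpow_closed by blast
      ultimately have "(T ^^ i) y \<in> W ((T ^^ i) c)" using W(2) by blast
      then show ?thesis using False by (simp add: V_def p_def)
    qed
    ultimately show "y \<in> \<Union>S" using y unfolding S_def by blast
  qed
  have "min_subcover_card X (iterated_join X T \<U> n) \<le> card S"
    using fin_P by (intro min_subcover_card_le[OF sub _ cover]) (simp add: S_def)
  also have "\<dots> \<le> card P" unfolding S_def using fin_P by (rule card_image_le)
  also have "\<dots> = card C * (\<Sum>I\<in>J. card \<V> ^ card I)"
    unfolding P_def using fin_J fin \<V>(2)
    by (simp add: card_cartesian_product card_SigmaI card_PiE finite_PiE)
  finally show ?thesis by (simp add: J_def)
qed

text \<open>With \<open>m = r * t\<close> each code set of size at most \<open>k\<close> contributes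
  \<open>m ^ card I \<le> r ^ k * t ^ card I\<close>. The first factor grows at rate at most
  \<open>\<alpha> * ln r \<le> t\<close>, and the weights \<open>t ^ card I\<close> sum to
  \<open>(1 + t) ^ n\<close>, of rate at most \<open>t\<close>; together this is
  \<open>2 * t\<close>.\<close>

lemma cover_entropy_le:
  assumes cover: "open_cover X \<U>" and ne: "X \<noteq> {}" and t: "0 < t" "t \<le> 1"
  shows "cover_entropy X T \<U> \<le> ereal (2 * t)"
proof -
  have "\<forall>U\<in>\<U>. \<exists>G. open G \<and> U = X \<inter> G" using cover by (auto simp: open_cover_def openin_open)
  then obtain G where G: "\<And>U. U \<in> \<U> \<Longrightarrow> open (G U)" "\<And>U. U \<in> \<U> \<Longrightarrow> U = X \<inter> G U" by metis
  have XG: "X \<subseteq> \<Union>(G ` \<U>)" using cover G(2) unfolding open_cover_def by blast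
  \<comment> \<open>\<open>e\<close> is a Lebesgue number of the cover.\<close>
  obtain e where e: "e > 0" "\<And>x. x \<in> X \<Longrightarrow> \<exists>A\<in>G ` \<U>. ball x e \<subseteq> A"
    using Heine_Borel_lemma[OF compact_X XG] G(1) by blast
  have leb: "\<exists>U\<in>\<U>. ball x e \<inter> X \<subseteq> U" if "x \<in> X" for x
    using e(2)[OF that] G(2) by blast
  obtain \<V> where \<V>: "\<V> \<subseteq> \<U>" "finite \<V>" "X \<subseteq> \<Union>(G ` \<V>)"
    using compactE_image[OF compact_X, of \<U> G] G(1) XG by metis
  have \<V>': "X \<subseteq> \<Union>\<V>" using \<V> G(2) by blast
  define m where "m = card \<V>"
  have m: "m \<ge> 1" using \<V>(2) \<V>' ne by (simp add: m_def Suc_le_eq card_gt_0_iff) auto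
  define r where "r = real m / t"
  have r: "r \<ge> 1" using m t by (simp add: r_def field_simps)
  \<comment> \<open>The permitted proportion of exceptional times. The summand 1 keeps the
    denominator positive when \<open>r = 1\<close>.\<close>
  define \<alpha> where "\<alpha> = t / (1 + ln r)"
  have \<alpha>: "\<alpha> > 0" "\<alpha> * ln r \<le> t" using r t by (auto simp: \<alpha>_def field_simps add_pos_nonneg)
  \<comment> \<open>The uniform estimate loses a factor 3, so this level gives orbit sums of at most
    \<open>\<alpha> * e * n\<close>. By Markov's inequality at most \<open>\<alpha> * n\<close>
    times then have distance \<open>e\<close> or more.\<close>
  have ae: "\<alpha> * e / 3 > 0" using \<alpha> e by simp
  obtain \<delta> where \<delta>: "\<delta> > 0" "\<And>x y. x \<in> X \<Longrightarrow> y \<in> X \<Longrightarrow> dist x y < \<delta> \<Longrightarrow> L x y < \<alpha> * e / 3"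
    using mean_dist_small[OF ae] by blast
  obtain N where N: "\<And>x y n. x \<in> X \<Longrightarrow> y \<in> X \<Longrightarrow> L x y \<le> \<alpha> * e / 3 \<Longrightarrow> N \<le> n \<Longrightarrow>
      orbit_dist T n x y \<le> 3 * (\<alpha> * e / 3) * real n"
    using uniform_mean_dist[OF ae] by blast
  obtain C where C: "C \<subseteq> X" "finite C" "X \<subseteq> (\<Union>c\<in>C. ball c \<delta>)"
    using finite_net[OF \<delta>(1)] by blast
  define q where "q = card C"
  have q: "q \<ge> 1" using C ne by (simp add: q_def Suc_le_eq card_gt_0_iff) auto
  have near: "\<exists>c\<in>C. card {i. i < n \<and> e \<le> dist ((T ^^ i) c) ((T ^^ i) y)} \<le> nat \<lfloor>\<alpha> * real n\<rfloor>"
    if y: "y \<in> X" and n: "n \<ge> N" for y n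
  proof -
    obtain c where c: "c \<in> C" "dist c y < \<delta>" using C(3) y by auto
    define I where "I = {i. i < n \<and> e \<le> dist ((T ^^ i) c) ((T ^^ i) y)}"
    have "e * real (card I) = (\<Sum>i\<in>I. e)" by simp
    also have "\<dots> \<le> (\<Sum>i\<in>I. dist ((T ^^ i) c) ((T ^^ i) y))" by (intro sum_mono) (simp add: I_def)
    also have "\<dots> \<le> orbit_dist T n c y" unfolding orbit_dist_def by (intro sum_mono2) (auto simp: I_def)
    also have "\<dots> \<le> 3 * (\<alpha> * e / 3) * real n"
      using c C(1) y n \<delta>(2)[of c y] by (intro N) auto
    finally have "real (card I) \<le> \<alpha> * real n" using e(1) by (simp add: field_simps)
    then have "card I \<le> nat \<lfloor>\<alpha> * real n\<rfloor>" by (simp add: le_nat_floor)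
    then show ?thesis using c(1) by (auto simp: I_def)
  qed
  have bound: "ln (real (min_subcover_card X (iterated_join X T \<U> n))) / real n \<le> ln q / n + (t + t)"
    if n: "n \<ge> N" "n \<ge> 1" for n
  proof -
    define M where "M = min_subcover_card X (iterated_join X T \<U> n)"
    define k where "k = nat \<lfloor>\<alpha> * real n\<rfloor>"
    have k: "real k \<le> \<alpha> * real n" using \<alpha>(1) by (simp add: k_def)
    have "M \<le> q * (\<Sum>I\<in>{I. I \<subseteq> {..<n} \<and> card I \<le> k}. m ^ card I)"
      unfolding M_def q_def m_def k_def
      by (rule iterated_join_subcover_bound[OF \<V>(1,2) \<V>' C(2,1) leb near[OF _ n(1)]])
    then have "real M \<le> real (q * (\<Sum>I\<in>{I. I \<subseteq> {..<n} \<and> card I \<le> k}. m ^ card I))"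
      by (simp only: of_nat_le_iff)
    also have "\<dots> = real q * (\<Sum>I\<in>{I. I \<subseteq> {..<n} \<and> card I \<le> k}. r ^ card I * t ^ card I)"
      using t by (simp add: power_mult_distrib[symmetric] r_def)
    also have "\<dots> \<le> real q * (\<Sum>I\<in>{I. I \<subseteq> {..<n} \<and> card I \<le> k}. r ^ k * t ^ card I)"
      using r t by (intro mult_left_mono sum_mono mult_right_mono power_increasing) auto
    also have "\<dots> \<le> real q * (\<Sum>I\<in>Pow {..<n}. r ^ k * t ^ card I)"
      using r t by (intro mult_left_mono sum_mono2) auto
    also have "\<dots> = real q * (r ^ k * (1 + t) ^ n)"
      by (simp add: sum_distrib_left[symmetric] sum_power_card_Pow)
    finally have M: "real M \<le> real q * (r ^ k * (1 + t) ^ n)" .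
    \<comment> \<open>Being at least 1 makes the logarithm of the bound nonnegative, which also
      settles \<open>M = 0\<close>, where \<open>ln 0 = 0\<close>.\<close>
    have pos: "1 \<le> real q * (r ^ k * (1 + t) ^ n)"
      using q r t by (intro mult_ge1_I one_le_power) auto
    have "ln (real M) \<le> ln (real q * (r ^ k * (1 + t) ^ n))"
      using M pos by (cases "M = 0") auto
    also have "\<dots> = ln q + (real k * ln r + real n * ln (1 + t))"
      using q r t by (simp add: ln_mult ln_realpow)
    also have "\<dots> \<le> ln q + ((\<alpha> * real n) * ln r + real n * t)"
      using k r t by (intro add_left_mono add_mono mult_right_mono mult_left_mono) (auto simp: ln_add_one_self_le_self)
    also have "\<dots> \<le> ln q + real n * (t + t)"
      using mult_left_mono[OF \<alpha>(2), of "real n"] by (simp add: algebra_simps)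
    finally show ?thesis using n by (simp add: M_def field_simps)
  qed
  have "(\<lambda>n. ereal (ln q / real n + (t + t))) \<longlonglongrightarrow> ereal (0 + (t + t))"
    by (intro tendsto_intros lim_const_over_n)
  then have "limsup (\<lambda>n. ereal (ln q / real n + (t + t))) = ereal (2 * t)"
    by (simp add: lim_imp_Limsup)
  moreover have "cover_entropy X T \<U> \<le> limsup (\<lambda>n. ereal (ln q / real n + (t + t)))"
    unfolding cover_entropy_def
    by (rule Limsup_mono, rule eventually_sequentiallyI[of "max N 1"]) (use bound in auto)
  ultimately show ?thesis by simp
qed

lemma cover_entropy_nonneg: "0 \<le> cover_entropy X T \<U>"
proof -
  have "0 \<le> ln (real k)" for k :: nat by (cases "k = 0") auto
  then have "ereal 0 \<le> cover_entropy X T \<U>"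
    unfolding cover_entropy_def by (intro le_Limsup) (auto intro!: always_eventually divide_nonneg_nonneg)
  then show ?thesis by (simp add: zero_ereal_def)
qed

theorem topological_entropy_eq_0: "topological_entropy X T = 0"
proof (rule antisym)
  have "cover_entropy X T \<U> \<le> 0" if \<U>: "open_cover X \<U>" for \<U>
  proof (cases "X = {}")
    case True
    \<comment> \<open>For empty \<open>X\<close> the empty family already covers, and the convention
      \<open>ln 0 = 0\<close> gives entropy 0.\<close>
    have "min_subcover_card X \<C> = 0" for \<C>
      using min_subcover_card_le[of "{}" \<C> X] True by simp
    then show ?thesis by (simp add: cover_entropy_def Limsup_const zero_ereal_def)
  next
    case False
    show ?thesis
    proof (rule ereal_le_epsilon2)
      fix e :: real assume "e > 0"
      then have "cover_entropy X T \<U> \<le> ereal (2 * min 1 (e / 2))"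
        by (intro cover_entropy_le[OF \<U> False]) auto
      also have "\<dots> \<le> 0 + ereal e" by simp
      finally show "cover_entropy X T \<U> \<le> 0 + ereal e" .
    qed
  qed
  then show "topological_entropy X T \<le> 0"
    unfolding topological_entropy_def by (intro SUP_least) auto
  \<comment> \<open>The supremum needs one member for its lower bound; any cover serves, since all
    cover entropies are nonnegative.\<close>
  have "open_cover X {X}" by (simp add: open_cover_def)
  then show "0 \<le> topological_entropy X T"
    unfolding topological_entropy_def using cover_entropy_nonneg by (intro SUP_upper2[of "{X}"]) auto
qed

end

section \<open>Square-integrable functions\<close>

lemma borel_measurable_cnj [measurable (raw)]:
  assumes "f \<in> borel_measurable M"
  shows "(\<lambda>x. cnj (f x)) \<in> borel_measurable M"
  by (rule borel_measurable_continuous_on[OF _ assms]) (intro continuous_intros)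

lemma L2_measurable: "f \<in> L2 M \<Longrightarrow> f \<in> borel_measurable M"
  and L2_integrable: "f \<in> L2 M \<Longrightarrow> integrable M (\<lambda>x. (cmod (f x))\<^sup>2)"
  by (auto simp: L2_def)

lemma L2I: "f \<in> borel_measurable M \<Longrightarrow> integrable M (\<lambda>x. (cmod (f x))\<^sup>2) \<Longrightarrow> f \<in> L2 M"
  by (simp add: L2_def)

lemma L2_integrable_mult:
  assumes "f \<in> L2 M" "g \<in> L2 M"
  shows "integrable M (\<lambda>x. f x * cnj (g x))"
proof (rule Bochner_Integration.integrable_bound)
  show "integrable M (\<lambda>x. (cmod (f x))\<^sup>2 + (cmod (g x))\<^sup>2)"
    using assms by (intro Bochner_Integration.integrable_add L2_integrable)
  show "(\<lambda>x. f x * cnj (g x)) \<in> borel_measurable M"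
    using assms[THEN L2_measurable] by measurable
  have "cmod a * cmod b \<le> (cmod a)\<^sup>2 + (cmod b)\<^sup>2" for a b
    using sum_squares_bound[of "cmod a" "cmod b"] mult_nonneg_nonneg[of "cmod a" "cmod b"]
    by (simp del: mult_nonneg_nonneg)
  then show "AE x in M. norm (f x * cnj (g x)) \<le> norm ((cmod (f x))\<^sup>2 + (cmod (g x))\<^sup>2)"
    by (simp add: norm_mult)
qed

lemma L2_scale: "f \<in> L2 M \<Longrightarrow> (\<lambda>x. a * f x) \<in> L2 M"
  unfolding L2_def by (auto simp: norm_mult power_mult_distrib)

lemma L2_add:
  assumes "f \<in> L2 M" "g \<in> L2 M"
  shows "(\<lambda>x. f x + g x) \<in> L2 M"
proof (rule L2I)
  note [measurable] = assms[THEN L2_measurable]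
  show "(\<lambda>x. f x + g x) \<in> borel_measurable M" by measurable
  have *: "(cmod (a + b))\<^sup>2 \<le> 2 * (cmod a)\<^sup>2 + 2 * (cmod b)\<^sup>2" for a b
  proof -
    have "(cmod (a + b))\<^sup>2 \<le> (cmod a + cmod b)\<^sup>2" by (intro power_mono norm_triangle_ineq) simp
    also have "\<dots> \<le> 2 * (cmod a)\<^sup>2 + 2 * (cmod b)\<^sup>2"
      using sum_squares_bound[of "cmod a" "cmod b"] by (simp add: power2_sum)
    finally show ?thesis .
  qed
  show "integrable M (\<lambda>x. (cmod (f x + g x))\<^sup>2)"
  proof (rule Bochner_Integration.integrable_bound)
    show "integrable M (\<lambda>x. 2 * (cmod (f x))\<^sup>2 + 2 * (cmod (g x))\<^sup>2)"
      using assms[THEN L2_integrable] by (intro Bochner_Integration.integrable_add) auto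
  qed (auto simp: *)
qed

lemma L2_diff: "f \<in> L2 M \<Longrightarrow> g \<in> L2 M \<Longrightarrow> (\<lambda>x. f x - g x) \<in> L2 M"
  using L2_add[of f M "\<lambda>x. (-1) * g x"] L2_scale[of g M "-1"] by simp

lemma L2_zero: "(\<lambda>x. 0) \<in> L2 M"
  by (simp add: L2_def)

lemma L2_sum: "(\<And>i. i \<in> I \<Longrightarrow> f i \<in> L2 M) \<Longrightarrow> (\<lambda>x. \<Sum>i\<in>I. f i x) \<in> L2 M"
  by (induction I rule: infinite_finite_induct) (auto intro: L2_zero L2_add)

lemma L2_inner_add_left:
  assumes "f \<in> L2 M" "g \<in> L2 M" "h \<in> L2 M"
  shows "L2_inner M (\<lambda>x. f x + g x) h = L2_inner M f h + L2_inner M g h"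
  unfolding L2_inner_def using L2_integrable_mult[OF assms(1,3)] L2_integrable_mult[OF assms(2,3)]
  by (simp add: distrib_right)

lemma L2_inner_diff_left:
  assumes "f \<in> L2 M" "g \<in> L2 M" "h \<in> L2 M"
  shows "L2_inner M (\<lambda>x. f x - g x) h = L2_inner M f h - L2_inner M g h"
  unfolding L2_inner_def using L2_integrable_mult[OF assms(1,3)] L2_integrable_mult[OF assms(2,3)]
  by (simp add: left_diff_distrib)

lemma L2_inner_scale_left: "L2_inner M (\<lambda>x. a * f x) h = a * L2_inner M f h"
  unfolding L2_inner_def by (simp add: mult.assoc)

lemma L2_inner_commute: "L2_inner M f g = cnj (L2_inner M g f)"
  unfolding L2_inner_def using Bochner_Integration.integral_cnj[of M "\<lambda>x. g x * cnj (f x)"]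
  by (simp add: mult.commute)

lemma L2_inner_scale_right: "L2_inner M f (\<lambda>x. a * h x) = cnj a * L2_inner M f h"
  by (simp add: L2_inner_commute[of M f] L2_inner_scale_left)

lemma L2_inner_sum_left:
  assumes "\<And>i. i \<in> I \<Longrightarrow> f i \<in> L2 M" "h \<in> L2 M"
  shows "L2_inner M (\<lambda>x. \<Sum>i\<in>I. f i x) h = (\<Sum>i\<in>I. L2_inner M (f i) h)"
  unfolding L2_inner_def sum_distrib_right
  using assms by (intro Bochner_Integration.integral_sum L2_integrable_mult)

lemma L2_inner_cong_AE:
  assumes "f \<in> borel_measurable M" "f' \<in> borel_measurable M"
    "g \<in> borel_measurable M" "g' \<in> borel_measurable M"
    "AE x in M. f x = f' x" "AE x in M. g x = g' x"
  shows "L2_inner M f g = L2_inner M f' g'"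
  unfolding L2_inner_def
proof (rule integral_cong_AE)
  note [measurable] = assms(1-4)
  show "(\<lambda>x. f x * cnj (g x)) \<in> borel_measurable M" "(\<lambda>x. f' x * cnj (g' x)) \<in> borel_measurable M"
    by measurable
  show "AE x in M. f x * cnj (g x) = f' x * cnj (g' x)"
    using assms(5,6) by eventually_elim simp
qed

lemma L2_norm_cong_AE:
  assumes "f \<in> borel_measurable M" "f' \<in> borel_measurable M" "AE x in M. f x = f' x"
  shows "L2_norm M f = L2_norm M f'"
  unfolding L2_norm_def
proof (rule arg_cong[of _ _ sqrt], rule integral_cong_AE)
  note [measurable] = assms(1,2)
  show "(\<lambda>x. (cmod (f x))\<^sup>2) \<in> borel_measurable M" "(\<lambda>x. (cmod (f' x))\<^sup>2) \<in> borel_measurable M"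
    by measurable
  show "AE x in M. (cmod (f x))\<^sup>2 = (cmod (f' x))\<^sup>2"
    using assms(3) by eventually_elim simp
qed

lemma L2_norm_nonneg: "0 \<le> L2_norm M f"
  by (simp add: L2_norm_def)

lemma L2_norm_power2: "(L2_norm M f)\<^sup>2 = (\<integral>x. (cmod (f x))\<^sup>2 \<partial>M)"
  by (simp add: L2_norm_def)

lemma L2_inner_self: "L2_inner M f f = complex_of_real ((L2_norm M f)\<^sup>2)"
  unfolding L2_norm_power2 L2_inner_def
  by (simp add: complex_norm_square[symmetric] del: of_real_power)

lemma L2_norm_scale: "L2_norm M (\<lambda>x. a * f x) = cmod a * L2_norm M f"
  unfolding L2_norm_def by (simp add: norm_mult power_mult_distrib real_sqrt_mult)

lemma L2_norm_minus_commute: "L2_norm M (\<lambda>x. f x - g x) = L2_norm M (\<lambda>x. g x - f x)"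
  unfolding L2_norm_def by (simp add: norm_minus_commute)

lemma L2_norm_eq_0_iff:
  assumes "f \<in> L2 M"
  shows "L2_norm M f = 0 \<longleftrightarrow> (AE x in M. f x = 0)"
  unfolding L2_norm_def using integral_nonneg_eq_0_iff_AE[OF L2_integrable[OF assms]] by simp

lemma L2_inner_diff_right:
  assumes "f \<in> L2 M" "g \<in> L2 M" "h \<in> L2 M"
  shows "L2_inner M h (\<lambda>x. f x - g x) = L2_inner M h f - L2_inner M h g"
  using assms by (simp add: L2_inner_commute[of M h] L2_inner_diff_left)

lemma L2_norm_diff_power2:
  assumes "f \<in> L2 M" "g \<in> L2 M"
  shows "(L2_norm M (\<lambda>x. f x - g x))\<^sup>2 = (L2_norm M f)\<^sup>2 + (L2_norm M g)\<^sup>2 - 2 * Re (L2_inner M f g)"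
proof -
  have "complex_of_real ((L2_norm M (\<lambda>x. f x - g x))\<^sup>2) =
      complex_of_real ((L2_norm M f)\<^sup>2) + complex_of_real ((L2_norm M g)\<^sup>2) - (L2_inner M f g + cnj (L2_inner M f g))"
    using assms by (simp add: L2_inner_self[symmetric] L2_inner_diff_left L2_inner_diff_right L2_diff
        L2_inner_commute[of M g f] del: of_real_power)
  also have "\<dots> = complex_of_real ((L2_norm M f)\<^sup>2 + (L2_norm M g)\<^sup>2 - 2 * Re (L2_inner M f g))"
    by (simp add: complex_add_cnj)
  finally show ?thesis by (simp only: of_real_eq_iff)
qed

text \<open>With \<open>G\<close> the squared norm of \<open>g\<close> and \<open>p\<close> the
  inner product, the squared norm of \<open>G * f - p * g\<close> equals \<open>G\<close> times the
  difference \<open>G * (L2_norm M f)\<^sup>2 - (cmod p)\<^sup>2\<close>. Scaling by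
  \<open>G\<close> avoids a division; \<open>g = 0\<close> almost everywhere is treated
  apart.\<close>

lemma L2_Cauchy_Schwarz:
  assumes "f \<in> L2 M" "g \<in> L2 M"
  shows "cmod (L2_inner M f g) \<le> L2_norm M f * L2_norm M g"
proof (cases "L2_norm M g = 0")
  case True
  then have "AE x in M. g x = 0" using assms L2_norm_eq_0_iff by blast
  then have "L2_inner M f g = L2_inner M f (\<lambda>x. 0)"
    using assms by (intro L2_inner_cong_AE) (auto simp: L2_measurable)
  then show ?thesis using True by (simp add: L2_inner_def)
next
  case False
  define G where "G = (L2_norm M g)\<^sup>2"
  define p where "p = L2_inner M f g"
  have G: "G > 0" using False by (simp add: G_def)
  have "0 \<le> (L2_norm M (\<lambda>x. complex_of_real G * f x - p * g x))\<^sup>2" by simp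
  also have "\<dots> = G\<^sup>2 * (L2_norm M f)\<^sup>2 + (cmod p)\<^sup>2 * G - 2 * (G * (cmod p)\<^sup>2)"
    using assms G
    by (subst L2_norm_diff_power2)
      (simp_all add: L2_scale L2_norm_scale L2_inner_scale_left L2_inner_scale_right power_mult_distrib
        G_def[symmetric] p_def[symmetric] mult.commute[of "cnj p" p] complex_mult_cnj cmod_power2)
  finally have "G * (cmod p)\<^sup>2 \<le> G * (G * (L2_norm M f)\<^sup>2)" by (simp add: power2_eq_square algebra_simps)
  then have "(cmod p)\<^sup>2 \<le> (L2_norm M f * L2_norm M g)\<^sup>2"
    using G by (simp add: G_def power_mult_distrib mult.commute)
  then show ?thesis
    unfolding p_def by (rule power2_le_imp_le) (simp add: L2_norm_nonneg)
qed

lemma L2_norm_triangle_diff: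
  assumes "f \<in> L2 M" "g \<in> L2 M"
  shows "L2_norm M (\<lambda>x. f x - g x) \<le> L2_norm M f + L2_norm M g"
proof (rule power2_le_imp_le)
  have "- Re (L2_inner M f g) \<le> L2_norm M f * L2_norm M g"
    using L2_Cauchy_Schwarz[OF assms] abs_Re_le_cmod[of "L2_inner M f g"] by linarith
  then show "(L2_norm M (\<lambda>x. f x - g x))\<^sup>2 \<le> (L2_norm M f + L2_norm M g)\<^sup>2"
    using L2_norm_diff_power2[OF assms] by (simp add: power2_sum)
qed (simp add: L2_norm_nonneg)

lemma L2_norm_triangle:
  assumes "f \<in> L2 M" "g \<in> L2 M"
  shows "L2_norm M (\<lambda>x. f x + g x) \<le> L2_norm M f + L2_norm M g"
  using L2_norm_triangle_diff[OF assms(1) L2_scale[OF assms(2), of "-1"]] L2_norm_scale[of M "-1" g] by simp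

lemma L2_norm_triangle3:
  assumes "f \<in> L2 M" "g \<in> L2 M" "h \<in> L2 M"
  shows "L2_norm M (\<lambda>x. f x - h x) \<le> L2_norm M (\<lambda>x. f x - g x) + L2_norm M (\<lambda>x. g x - h x)"
  using L2_norm_triangle[OF L2_diff[OF assms(1,2)] L2_diff[OF assms(2,3)]] by simp

lemma L2_norm_le_diff:
  assumes "f \<in> L2 M" "g \<in> L2 M"
  shows "L2_norm M f \<le> L2_norm M (\<lambda>x. f x - g x) + L2_norm M g"
  using L2_norm_triangle[OF L2_diff[OF assms] assms(2)] by simp

lemma L2_inner_orthonormal_sum:
  assumes "finite F" "\<And>i. i \<in> F \<Longrightarrow> b i \<in> L2 M"
    and on: "\<And>i j. i \<in> F \<Longrightarrow> j \<in> F \<Longrightarrow> L2_inner M (b i) (b j) = (if i = j then 1 else 0)"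
    and "j \<in> F"
  shows "L2_inner M (\<lambda>x. \<Sum>i\<in>F. a i * b i x) (b j) = a j"
proof -
  have "L2_inner M (\<lambda>x. \<Sum>i\<in>F. a i * b i x) (b j) = (\<Sum>i\<in>F. a i * (if i = j then 1 else 0))"
    using assms by (subst L2_inner_sum_left) (auto simp: L2_scale L2_inner_scale_left intro!: sum.cong)
  also have "\<dots> = a j" using assms by (simp add: if_distrib[of "\<lambda>x. a _ * x"] sum.delta' cong: if_cong)
  finally show ?thesis .
qed

text \<open>Pythagoras for the orthogonal projection. The family is indexed so that it serves both
  sequences and sets of functions, the latter with \<open>b\<close> the identity.\<close>

lemma L2_norm_minus_projection:
  assumes "finite F" "\<And>i. i \<in> F \<Longrightarrow> b i \<in> L2 M" "f \<in> L2 M"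
    and on: "\<And>i j. i \<in> F \<Longrightarrow> j \<in> F \<Longrightarrow> L2_inner M (b i) (b j) = (if i = j then 1 else 0)"
  shows "(L2_norm M (\<lambda>x. f x - (\<Sum>i\<in>F. L2_inner M f (b i) * b i x)))\<^sup>2 =
    (L2_norm M f)\<^sup>2 - (\<Sum>i\<in>F. (cmod (L2_inner M f (b i)))\<^sup>2)"
proof -
  define a where "a i = L2_inner M f (b i)" for i
  define g where "g x = (\<Sum>i\<in>F. a i * b i x)" for x
  have g: "g \<in> L2 M" unfolding g_def[abs_def] using assms by (intro L2_sum L2_scale)
  have gb: "L2_inner M g (b j) = a j" if "j \<in> F" for j
    unfolding g_def[abs_def] using L2_inner_orthonormal_sum[OF assms(1,2) on that] by simp
  have inner_g: "L2_inner M g h = (\<Sum>i\<in>F. a i * cnj (L2_inner M h (b i)))" if "h \<in> L2 M" for h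
    unfolding g_def[abs_def] using assms that
    by (subst L2_inner_sum_left) (auto simp: L2_scale L2_inner_scale_left L2_inner_commute[of M "b _" h])
  have S: "(\<Sum>i\<in>F. a i * cnj (a i)) = complex_of_real (\<Sum>i\<in>F. (cmod (a i))\<^sup>2)"
    by (simp add: complex_norm_square[symmetric])
  have "L2_inner M g f = complex_of_real (\<Sum>i\<in>F. (cmod (a i))\<^sup>2)"
    using inner_g[OF assms(3)] S by (simp add: a_def)
  then have 1: "Re (L2_inner M f g) = (\<Sum>i\<in>F. (cmod (a i))\<^sup>2)"
    by (subst L2_inner_commute) simp
  have "complex_of_real ((L2_norm M g)\<^sup>2) = complex_of_real (\<Sum>i\<in>F. (cmod (a i))\<^sup>2)"
    using inner_g[OF g] S gb by (simp add: L2_inner_self[symmetric] del: of_real_power)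
  then have 2: "(L2_norm M g)\<^sup>2 = (\<Sum>i\<in>F. (cmod (a i))\<^sup>2)" by (simp only: of_real_eq_iff)
  show ?thesis using L2_norm_diff_power2[OF assms(3) g] 1 2 by (simp add: g_def a_def)
qed

lemma L2_norm_minus_projection_le:
  assumes "finite F" "\<And>i. i \<in> F \<Longrightarrow> b i \<in> L2 M" "f \<in> L2 M"
    and on: "\<And>i j. i \<in> F \<Longrightarrow> j \<in> F \<Longrightarrow> L2_inner M (b i) (b j) = (if i = j then 1 else 0)"
  shows "L2_norm M (\<lambda>x. f x - (\<Sum>i\<in>F. L2_inner M f (b i) * b i x)) \<le> L2_norm M f"
  using L2_norm_minus_projection[OF assms]
  by (intro power2_le_imp_le[OF _ L2_norm_nonneg]) (simp add: sum_nonneg)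

lemma L2_Bessel:
  assumes "finite F" "\<And>i. i \<in> F \<Longrightarrow> b i \<in> L2 M" "f \<in> L2 M"
    and on: "\<And>i j. i \<in> F \<Longrightarrow> j \<in> F \<Longrightarrow> L2_inner M (b i) (b j) = (if i = j then 1 else 0)"
  shows "(\<Sum>i\<in>F. (cmod (L2_inner M f (b i)))\<^sup>2) \<le> (L2_norm M f)\<^sup>2"
proof -
  have "0 \<le> (L2_norm M f)\<^sup>2 - (\<Sum>i\<in>F. (cmod (L2_inner M f (b i)))\<^sup>2)"
    by (simp only: L2_norm_minus_projection[OF assms, symmetric] zero_le_power2)
  then show ?thesis by simp
qed

section \<open>Closed linear spans in the space of square-integrable functions\<close>

definition L2_span_closure :: "'a measure \<Rightarrow> ('a \<Rightarrow> complex) set \<Rightarrow> ('a \<Rightarrow> complex) set" where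
  "L2_span_closure M B = {f \<in> L2 M. \<forall>\<epsilon>>0. \<exists>F c. finite F \<and> F \<subseteq> B \<and>
      L2_norm M (\<lambda>x. f x - (\<Sum>g\<in>F. c g * g x)) < \<epsilon>}"

text \<open>Closedness of the closure. Later reductions all go through it: it suffices to
  approximate by members of the closure instead of by linear combinations.\<close>

lemma L2_span_closure_limit:
  assumes B: "B \<subseteq> L2 M" and f: "f \<in> L2 M"
    and approx: "\<And>\<epsilon>. \<epsilon> > 0 \<Longrightarrow> \<exists>g\<in>L2_span_closure M B. L2_norm M (\<lambda>x. f x - g x) < \<epsilon>"
  shows "f \<in> L2_span_closure M B"
  unfolding L2_span_closure_def
proof (safe intro!: f)
  fix \<epsilon> :: real assume "\<epsilon> > 0"
  then obtain g where g: "g \<in> L2_span_closure M B" "L2_norm M (\<lambda>x. f x - g x) < \<epsilon> / 2"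
    using approx[of "\<epsilon> / 2"] by auto
  then obtain F c where F: "finite F" "F \<subseteq> B" "L2_norm M (\<lambda>x. g x - (\<Sum>h\<in>F. c h * h x)) < \<epsilon> / 2"
    unfolding L2_span_closure_def using \<open>\<epsilon> > 0\<close> by (auto dest: spec[of _ "\<epsilon> / 2"])
  have "(\<lambda>x. \<Sum>h\<in>F. c h * h x) \<in> L2 M" using F B by (intro L2_sum L2_scale) auto
  then have "L2_norm M (\<lambda>x. f x - (\<Sum>h\<in>F. c h * h x)) < \<epsilon>"
    using L2_norm_triangle3[of f M g "\<lambda>x. \<Sum>h\<in>F. c h * h x"] f g F unfolding L2_span_closure_def by auto
  with F show "\<exists>F c. finite F \<and> F \<subseteq> B \<and> L2_norm M (\<lambda>x. f x - (\<Sum>g\<in>F. c g * g x)) < \<epsilon>" by blast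
qed

lemma L2_span_closure_lincomb:
  assumes B: "B \<subseteq> L2 M" and F: "finite F" "F \<subseteq> B"
  shows "(\<lambda>x. \<Sum>g\<in>F. c g * g x) \<in> L2_span_closure M B"
proof -
  have "L2_norm M (\<lambda>x. 0) = 0" by (simp add: L2_norm_def)
  moreover have "(\<lambda>x. \<Sum>g\<in>F. c g * g x) \<in> L2 M" using F B by (intro L2_sum L2_scale) auto
  ultimately show ?thesis unfolding L2_span_closure_def using F
    by (auto intro!: exI[of _ F] exI[of _ c])
qed

lemma L2_span_closure_add:
  assumes B: "B \<subseteq> L2 M" and f: "f \<in> L2_span_closure M B" and g: "g \<in> L2_span_closure M B"
  shows "(\<lambda>x. f x + g x) \<in> L2_span_closure M B"
proof (rule L2_span_closure_limit[OF B])
  have fg: "f \<in> L2 M" "g \<in> L2 M" using f g by (auto simp: L2_span_closure_def)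
  then show "(\<lambda>x. f x + g x) \<in> L2 M" by (rule L2_add)
  fix \<epsilon> :: real assume "\<epsilon> > 0"
  then have "\<epsilon> / 2 > 0" by simp
  then obtain F c G d where F: "finite F" "F \<subseteq> B" "L2_norm M (\<lambda>x. f x - (\<Sum>h\<in>F. c h * h x)) < \<epsilon> / 2"
    and G: "finite G" "G \<subseteq> B" "L2_norm M (\<lambda>x. g x - (\<Sum>h\<in>G. d h * h x)) < \<epsilon> / 2"
    using f g unfolding L2_span_closure_def by blast
  \<comment> \<open>The two finite sets may overlap; on the common part the coefficients add
    up.\<close>
  define k where "k h = (if h \<in> F then c h else 0) + (if h \<in> G then d h else 0)" for h
  have "(\<Sum>h\<in>F \<union> G. k h * h x) = (\<Sum>h\<in>F. c h * h x) + (\<Sum>h\<in>G. d h * h x)" for x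
  proof -
    have "(\<Sum>h\<in>F \<union> G. k h * h x) =
        (\<Sum>h\<in>F \<union> G. (if h \<in> F then c h else 0) * h x) + (\<Sum>h\<in>F \<union> G. (if h \<in> G then d h else 0) * h x)"
      by (simp add: k_def sum.distrib distrib_right)
    also have "(\<Sum>h\<in>F \<union> G. (if h \<in> F then c h else 0) * h x) = (\<Sum>h\<in>F. c h * h x)"
      using F(1) G(1) by (intro sum.mono_neutral_cong_right) auto
    also have "(\<Sum>h\<in>F \<union> G. (if h \<in> G then d h else 0) * h x) = (\<Sum>h\<in>G. d h * h x)"
      using F(1) G(1) by (intro sum.mono_neutral_cong_right) auto
    finally show ?thesis .
  qed
  then have "L2_norm M (\<lambda>x. (f x + g x) - (\<Sum>h\<in>F \<union> G. k h * h x)) =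
      L2_norm M (\<lambda>x. (f x - (\<Sum>h\<in>F. c h * h x)) + (g x - (\<Sum>h\<in>G. d h * h x)))"
    by (simp add: algebra_simps)
  also have "\<dots> \<le> L2_norm M (\<lambda>x. f x - (\<Sum>h\<in>F. c h * h x)) + L2_norm M (\<lambda>x. g x - (\<Sum>h\<in>G. d h * h x))"
    using F G B fg by (intro L2_norm_triangle L2_diff L2_sum L2_scale) auto
  finally have "L2_norm M (\<lambda>x. (f x + g x) - (\<Sum>h\<in>F \<union> G. k h * h x)) < \<epsilon>" using F G by simp
  moreover have "(\<lambda>x. \<Sum>h\<in>F \<union> G. k h * h x) \<in> L2_span_closure M B"
    using F G by (intro L2_span_closure_lincomb B) auto
  ultimately show "\<exists>h\<in>L2_span_closure M B. L2_norm M (\<lambda>x. f x + g x - h x) < \<epsilon>" by (rule bexI)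
qed

lemma L2_span_closure_scale:
  assumes B: "B \<subseteq> L2 M" and f: "f \<in> L2_span_closure M B"
  shows "(\<lambda>x. a * f x) \<in> L2_span_closure M B"
proof (rule L2_span_closure_limit[OF B])
  have f2: "f \<in> L2 M" using f by (auto simp: L2_span_closure_def)
  then show "(\<lambda>x. a * f x) \<in> L2 M" by (rule L2_scale)
  fix \<epsilon> :: real assume "\<epsilon> > 0"
  \<comment> \<open>Adding 1 covers the scalar \<open>a = 0\<close>.\<close>
  then have "\<epsilon> / (cmod a + 1) > 0" by (simp add: add_nonneg_pos)
  then obtain F c where F: "finite F" "F \<subseteq> B" "L2_norm M (\<lambda>x. f x - (\<Sum>h\<in>F. c h * h x)) < \<epsilon> / (cmod a + 1)"
    using f unfolding L2_span_closure_def by blast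
  have "L2_norm M (\<lambda>x. a * f x - (\<Sum>h\<in>F. (a * c h) * h x)) = L2_norm M (\<lambda>x. a * (f x - (\<Sum>h\<in>F. c h * h x)))"
    by (simp add: algebra_simps sum_distrib_left)
  also have "\<dots> = cmod a * L2_norm M (\<lambda>x. f x - (\<Sum>h\<in>F. c h * h x))" by (rule L2_norm_scale)
  also have "\<dots> \<le> (cmod a + 1) * L2_norm M (\<lambda>x. f x - (\<Sum>h\<in>F. c h * h x))"
    by (intro mult_right_mono) (auto simp: L2_norm_nonneg)
  also have "\<dots> < (cmod a + 1) * (\<epsilon> / (cmod a + 1))"
    by (intro mult_strict_left_mono F(3)) (simp add: add_nonneg_pos)
  also have "\<dots> = \<epsilon>" by (simp add: add_nonneg_eq_0_iff)
  finally have "L2_norm M (\<lambda>x. a * f x - (\<Sum>h\<in>F. (a * c h) * h x)) < \<epsilon>" .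
  then show "\<exists>h\<in>L2_span_closure M B. L2_norm M (\<lambda>x. a * f x - h x) < \<epsilon>"
    using L2_span_closure_lincomb[OF B F(1,2), of "\<lambda>h. a * c h"] by (rule bexI)
qed

lemma L2_span_closure_cong_AE:
  assumes B: "B \<subseteq> L2 M" and f: "f \<in> L2_span_closure M B" and "g \<in> L2 M" "AE x in M. f x = g x"
  shows "g \<in> L2_span_closure M B"
proof (rule L2_span_closure_limit[OF B assms(3)])
  fix \<epsilon> :: real assume "\<epsilon> > 0"
  have f2: "f \<in> L2 M" using f by (auto simp: L2_span_closure_def)
  have "L2_norm M (\<lambda>x. g x - f x) = 0"
    using assms(4) by (subst L2_norm_eq_0_iff[OF L2_diff[OF assms(3) f2]]) (auto elim: eventually_mono)
  then show "\<exists>h\<in>L2_span_closure M B. L2_norm M (\<lambda>x. g x - h x) < \<epsilon>" using f \<open>\<epsilon> > 0\<close> by (intro bexI[of _ f]) simp_all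
qed

section \<open>Bounded functions and dominated convergence in mean square\<close>

context finite_measure
begin

lemma L2_bounded:
  assumes "f \<in> borel_measurable M" "AE x in M. cmod (f x) \<le> C"
  shows "f \<in> L2 M"
proof (rule L2I[OF assms(1)], rule integrable_const_bound)
  note [measurable] = assms(1)
  show "(\<lambda>x. (cmod (f x))\<^sup>2) \<in> borel_measurable M" by measurable
  show "AE x in M. norm ((cmod (f x))\<^sup>2) \<le> C\<^sup>2"
    using assms(2) by eventually_elim (simp add: power_mono)
qed

lemma L2_dominated_convergence:
  assumes meas: "\<And>n. f n \<in> borel_measurable M"
    and g: "g \<in> borel_measurable M" and w: "integrable M (\<lambda>x. (w x)\<^sup>2)" "w \<in> borel_measurable M"
    and bd: "\<And>n. AE x in M. cmod (f n x) \<le> w x"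
    and lim: "AE x in M. (\<lambda>n. f n x) \<longlonglongrightarrow> g x"
  shows "g \<in> L2 M" "(\<lambda>n. L2_norm M (\<lambda>x. f n x - g x)) \<longlonglongrightarrow> 0"
proof -
  note [measurable] = meas g w(2)
  have bd': "AE x in M. \<forall>n. cmod (f n x) \<le> w x" using bd by (simp add: AE_all_countable)
  have gw: "AE x in M. cmod (g x) \<le> w x"
    using bd' lim
  proof eventually_elim
    case (elim x)
    show ?case
      by (rule LIMSEQ_le_const2[OF tendsto_norm[OF elim(2)]]) (use elim(1) in auto)
  qed
  show "g \<in> L2 M"
  proof (rule L2I[OF g], rule Bochner_Integration.integrable_bound[OF w(1)])
    show "AE x in M. norm ((cmod (g x))\<^sup>2) \<le> norm ((w x)\<^sup>2)"
      using gw by eventually_elim (simp add: power_mono)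
  qed measurable
  have "(\<lambda>n. \<integral>x. (cmod (f n x - g x))\<^sup>2 \<partial>M) \<longlonglongrightarrow> (\<integral>x. 0 \<partial>M)"
  \<comment> \<open>Both \<open>f n\<close> and the limit \<open>g\<close> are dominated by
    \<open>w\<close>, so their difference is at most \<open>2 * w\<close>; squaring gives the
    4.\<close>
  proof (rule integral_dominated_convergence[where w = "\<lambda>x. 4 * (w x)\<^sup>2"])
    show "AE x in M. (\<lambda>n. (cmod (f n x - g x))\<^sup>2) \<longlonglongrightarrow> 0"
      using lim
    proof eventually_elim
      case (elim x)
      then have "(\<lambda>n. f n x - g x) \<longlonglongrightarrow> 0" by (simp add: LIM_zero)
      then show ?case by (intro tendsto_null_power tendsto_norm_zero) auto
    qed
    show "AE x in M. norm ((cmod (f n x - g x))\<^sup>2) \<le> 4 * (w x)\<^sup>2" for n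
      using bd[of n] gw
    proof eventually_elim
      case (elim x)
      have "cmod (f n x - g x) \<le> 2 * w x" using norm_triangle_ineq4[of "f n x" "g x"] elim by linarith
      then have "(cmod (f n x - g x))\<^sup>2 \<le> (2 * w x)\<^sup>2" by (intro power_mono) auto
      then show ?case by (simp add: power_mult_distrib)
    qed
  qed (use w in auto)
  then have "(\<lambda>n. sqrt (\<integral>x. (cmod (f n x - g x))\<^sup>2 \<partial>M)) \<longlonglongrightarrow> sqrt 0"
    by (intro tendsto_real_sqrt) simp
  then show "(\<lambda>n. L2_norm M (\<lambda>x. f n x - g x)) \<longlonglongrightarrow> 0"
    by (simp add: L2_norm_def)
qed

end

context prob_space
begin

text \<open>Cauchy-Schwarz against the constant 1, whose norm is 1 because the total mass is
  1.\<close>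

lemma L2_integrable_1:
  assumes "f \<in> L2 M"
  shows "integrable M f" "(\<integral>x. cmod (f x) \<partial>M) \<le> L2_norm M f"
proof -
  have one: "(\<lambda>x. 1) \<in> L2 M" by (intro L2_bounded[of _ 1]) auto
  show int: "integrable M f" using L2_integrable_mult[OF assms one] by simp
  have abs: "(\<lambda>x. complex_of_real (cmod (f x))) \<in> L2 M"
    using assms unfolding L2_def by auto
  have "L2_inner M (\<lambda>x. complex_of_real (cmod (f x))) (\<lambda>x. 1) = complex_of_real (\<integral>x. cmod (f x) \<partial>M)"
    unfolding L2_inner_def by simp
  then have "(\<integral>x. cmod (f x) \<partial>M) \<le> L2_norm M (\<lambda>x. complex_of_real (cmod (f x))) * L2_norm M (\<lambda>x. 1)"
    using L2_Cauchy_Schwarz[OF abs one] by simp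
  then show "(\<integral>x. cmod (f x) \<partial>M) \<le> L2_norm M f" by (simp add: L2_norm_def prob_space)
qed

lemma L2_norm_le_bound:
  assumes "f \<in> borel_measurable M" "AE x in M. cmod (f x) \<le> C" "C \<ge> 0"
  shows "L2_norm M f \<le> C"
proof -
  have "(\<integral>x. (cmod (f x))\<^sup>2 \<partial>M) \<le> (\<integral>x. C\<^sup>2 \<partial>M)"
    using L2_integrable[OF L2_bounded[OF assms(1,2)]] assms(2)
    by (intro integral_mono_AE) (auto elim!: eventually_mono simp: power_mono)
  then have "(L2_norm M f)\<^sup>2 \<le> C\<^sup>2" by (simp add: L2_norm_power2 prob_space)
  then show ?thesis using assms(3) by (rule power2_le_imp_le)
qed

end

section \<open>Ergodic Koopman operators\<close>

text \<open>A complex matrix of positive size has nonempty spectrum. The version with sums over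
  indices is what the Koopman action on a finite-dimensional eigenspace calls for.\<close>

lemma complex_square_system_eigenvector:
  fixes m :: "nat \<Rightarrow> nat \<Rightarrow> complex"
  assumes "d > 0"
  obtains \<zeta> v where "\<exists>i<d. v i \<noteq> 0" "\<And>i. i < d \<Longrightarrow> (\<Sum>j<d. m i j * v j) = \<zeta> * v i"
proof -
  define A where "A = Matrix.mat d d (\<lambda>(i, j). m i j)"
  have A: "A \<in> carrier_mat d d" by (simp add: A_def)
  obtain \<zeta> u where u: "eigenvector A u \<zeta>"
    using spectrum_non_empty[OF A assms] by (auto simp: spectrum_def eigenvalue_def)
  have dim: "dim_vec u = d" and u0: "u \<noteq> 0\<^sub>v d" and eq: "A *\<^sub>v u = \<zeta> \<cdot>\<^sub>v u"
    using u A by (auto simp: eigenvector_def)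
  show thesis
  proof (rule that[of "\<lambda>i. vec_index u i" \<zeta>])
    show "\<exists>i<d. vec_index u i \<noteq> 0" using u0 dim by (auto simp: vec_eq_iff)
    fix i assume i: "i < d"
    have "(\<Sum>j<d. m i j * vec_index u j) = vec_index (A *\<^sub>v u) i"
      using i dim by (simp add: A_def scalar_prod_def lessThan_atLeast0)
    then show "(\<Sum>j<d. m i j * vec_index u j) = \<zeta> * vec_index u i" using i dim eq by simp
  qed
qed

locale ergodic_system = prob_space M for M :: "'a measure" +
  fixes T :: "'a \<Rightarrow> 'a"
  assumes T_measurable [measurable]: "T \<in> measurable M M" and distr_T: "distr M M T = M"
    and ergodic: "A \<in> sets M \<Longrightarrow> T -` A \<inter> space M = A \<Longrightarrow> prob A = 0 \<or> prob A = 1"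
begin

lemma AE_T:
  assumes "AE x in M. P x"
  shows "AE x in M. P (T x)"
  using AE_distrD[OF T_measurable] assms distr_T by metis

lemma AE_funpow_T:
  assumes "AE x in M. P x"
  shows "AE x in M. P ((T ^^ n) x)"
proof (induction n)
  case (Suc n)
  from AE_T[OF this] show ?case by (simp add: funpow_swap1)
qed (simp add: assms)

lemma T_space: "x \<in> space M \<Longrightarrow> T x \<in> space M"
  using measurable_space[OF T_measurable] by blast

lemma integral_T:
  fixes f :: "'a \<Rightarrow> 'b::{banach,second_countable_topology}"
  assumes "f \<in> borel_measurable M"
  shows "(\<integral>x. f (T x) \<partial>M) = (\<integral>x. f x \<partial>M)"
  using integral_distr[OF T_measurable assms] distr_T by simp

lemma integrable_T:
  fixes f :: "'a \<Rightarrow> 'b::{banach,second_countable_topology}"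
  assumes "integrable M f"
  shows "integrable M (\<lambda>x. f (T x))"
  using integrable_distr[OF T_measurable, of f] distr_T assms by simp

lemma L2_T: "f \<in> L2 M \<Longrightarrow> (\<lambda>x. f (T x)) \<in> L2 M"
  unfolding L2_def using integrable_T[of "\<lambda>x. (cmod (f x))\<^sup>2"] by auto

lemma L2_inner_T:
  assumes "f \<in> L2 M" "g \<in> L2 M"
  shows "L2_inner M (\<lambda>x. f (T x)) (\<lambda>x. g (T x)) = L2_inner M f g"
  unfolding L2_inner_def
  using integral_T[OF borel_measurable_integrable[OF L2_integrable_mult[OF assms]]] by simp

lemma L2_norm_T:
  assumes "f \<in> L2 M"
  shows "L2_norm M (\<lambda>x. f (T x)) = L2_norm M f"
  unfolding L2_norm_def using integral_T[OF borel_measurable_integrable[OF L2_integrable[OF assms]]] by simp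

text \<open>The limit superior along the orbit turns a function invariant almost everywhere into
  a strictly invariant one, to which the hypothesis on strictly invariant sets applies.\<close>

lemma invariant_AE_const_real:
  fixes h :: "'a \<Rightarrow> real"
  assumes [measurable]: "h \<in> borel_measurable M" and inv: "AE x in M. h (T x) = h x"
  obtains c where "AE x in M. h x = c"
proof -
  define H where "H x = limsup (\<lambda>n. ereal (h ((T ^^ n) x)))" for x
  have [measurable]: "(T ^^ n) \<in> measurable M M" for n by (rule measurable_compose_n[OF T_measurable])
  have [measurable]: "H \<in> borel_measurable M" unfolding H_def by measurable
  have H_T: "H (T x) = H x" for x
  proof -
    have "H (T x) = limsup (\<lambda>n. ereal (h ((T ^^ Suc n) x)))" unfolding H_def by (simp add: funpow_swap1)
    then show ?thesis unfolding H_def using limsup_shift[of "\<lambda>n. ereal (h ((T ^^ n) x))"] by simp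
  qed
  have "AE x in M. \<forall>n. h (T ((T ^^ n) x)) = h ((T ^^ n) x)"
    unfolding AE_all_countable using AE_funpow_T[OF inv] by blast
  then have AE_H: "AE x in M. H x = ereal (h x)"
  proof eventually_elim
    case (elim x)
    have "h ((T ^^ n) x) = h x" for n by (induction n) (auto simp: elim)
    then show ?case by (simp add: H_def Limsup_const)
  qed
  \<comment> \<open>The distribution function of \<open>H\<close>. By ergodicity it takes only the
    values 0 and 1, so it jumps once, at the constant value of \<open>H\<close>.\<close>
  define p where "p q = prob {x \<in> space M. H x < ereal q}" for q
  have p01: "p q = 0 \<or> p q = 1" for q
    unfolding p_def by (rule ergodic) (auto simp: H_T T_space)
  have p0: "AE x in M. \<not> H x < ereal q" if "p q = 0" for q
  proof -
    have "{x \<in> space M. H x < ereal q} \<in> null_sets M"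
      using that by (auto simp: p_def null_sets_def emeasure_eq_measure)
    from AE_not_in[OF this] show ?thesis by (auto intro: AE_mp)
  qed
  have p1: "AE x in M. H x < ereal q" if "p q = 1" for q
    using that prob_eq_1[of "{x \<in> space M. H x < ereal q}"] by (auto simp: p_def)
  have p_mono: "p q \<le> p q'" if "q \<le> q'" for q q'
    unfolding p_def using that by (intro finite_measure_mono) (auto elim: less_le_trans)
  \<comment> \<open>\<open>H\<close> agrees almost everywhere with the real function
    \<open>h\<close>, so it is neither almost surely infinite nor, in the next step, almost surely
    minus infinity; the jump point is therefore real.\<close>
  have "\<exists>q. p q = 1"
  proof (rule ccontr)
    assume "\<nexists>q. p q = 1"
    then have "\<forall>n::nat. AE x in M. \<not> H x < ereal (real n)" using p01 p0 by blast
    then have "AE x in M. \<forall>n::nat. \<not> H x < ereal (real n)" by (simp add: AE_all_countable)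
    with AE_H have "AE x in M. False"
    proof eventually_elim
      case (elim x)
      then show ?case using reals_Archimedean2[of "h x"] by auto
    qed
    then show False by simp
  qed
  then obtain b where b: "p b = 1" by blast
  have "\<exists>q. p q = 0"
  proof (rule ccontr)
    assume "\<nexists>q. p q = 0"
    then have "\<forall>n::nat. AE x in M. H x < ereal (- real n)" using p01 p1 by blast
    then have "AE x in M. \<forall>n::nat. H x < ereal (- real n)" by (simp add: AE_all_countable)
    with AE_H have "AE x in M. False"
    proof eventually_elim
      case (elim x)
      obtain n where "real n > - h x" using reals_Archimedean2 by blast
      moreover have "h x < - real n" using elim by simp
      ultimately show ?case by simp
    qed
    then show False by simp
  qed
  then obtain a where a: "p a = 0" by blast
  define c where "c = Sup {q. p q = 0}"
  have "q \<le> b" if "p q = 0" for q using p_mono[of b q] that b by (cases "q \<le> b") auto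
  then have bdd: "bdd_above {q. p q = 0}" by (intro bdd_aboveI[of _ b]) simp
  have low: "p q = 0" if q: "q < c" for q
  proof -
    obtain q' where "p q' = 0" "q < q'" using less_cSup_iff[of "{q. p q = 0}" q] bdd a q by (auto simp: c_def)
    then show ?thesis using p_mono[of q q'] p01[of q] by auto
  qed
  have high: "p q = 1" if "q > c" for q
    using cSup_upper[of q "{q. p q = 0}"] bdd that p01[of q] by (auto simp: c_def)
  \<comment> \<open>Countably many thresholds on both sides of \<open>c\<close> suffice, so the null
    sets can be united.\<close>
  have "AE x in M. \<forall>n::nat. \<not> H x < ereal (c - 1 / Suc n) \<and> H x < ereal (c + 1 / Suc n)"
    unfolding AE_all_countable AE_conj_iff using p0[OF low] p1[OF high] by simp
  with AE_H have "AE x in M. h x = c"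
  proof eventually_elim
    case (elim x)
    have "\<bar>h x - c\<bar> \<le> 1 / Suc n" for n
    proof -
      have "\<not> h x < c - 1 / Suc n" "h x < c + 1 / Suc n" using elim by auto
      then show ?thesis by linarith
    qed
    then have "\<bar>h x - c\<bar> \<le> 0"
      by (intro LIMSEQ_le_const[OF LIMSEQ_inverse_real_of_nat]) (auto simp: inverse_eq_divide)
    then show ?case by simp
  qed
  then show thesis by (rule that)
qed

lemma invariant_AE_const:
  fixes h :: "'a \<Rightarrow> complex"
  assumes [measurable]: "h \<in> borel_measurable M" and inv: "AE x in M. h (T x) = h x"
  obtains c where "AE x in M. h x = c"
proof -
  obtain a where a: "AE x in M. Re (h x) = a"
    by (rule invariant_AE_const_real[of "\<lambda>x. Re (h x)"]) (use inv in \<open>auto elim: eventually_mono\<close>)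
  obtain b where b: "AE x in M. Im (h x) = b"
    by (rule invariant_AE_const_real[of "\<lambda>x. Im (h x)"]) (use inv in \<open>auto elim: eventually_mono\<close>)
  have "AE x in M. h x = Complex a b" using a b by eventually_elim (simp add: complex_eq_iff)
  then show thesis by (rule that)
qed

section \<open>Eigenvalues and eigenspaces of an ergodic Koopman operator\<close>

lemma eigenvalue_cmod:
  assumes "f \<in> L2 M" "L2_norm M f \<noteq> 0" "AE x in M. f (T x) = \<zeta> * f x"
  shows "cmod \<zeta> = 1"
proof -
  have "L2_norm M f = L2_norm M (\<lambda>x. \<zeta> * f x)"
    using L2_norm_T[OF assms(1)] L2_norm_cong_AE[OF _ _ assms(3)] L2_T[OF assms(1)] L2_scale[OF assms(1)]
    by (simp add: L2_measurable)
  then show ?thesis using assms(2) by (simp add: L2_norm_scale)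
qed

text \<open>As the eigenvalue has modulus 1, \<open>g * cnj b\<close> and \<open>b * cnj b\<close>
  are invariant, hence constants \<open>q\<close> and \<open>r\<close>. The norm of \<open>b\<close>
  forces \<open>r = 1\<close>, and multiplying the first identity by \<open>b\<close> isolates
  \<open>g\<close>.\<close>

lemma eigenspace_one_dim:
  assumes b: "b \<in> L2 M" "L2_norm M b = 1" "AE x in M. b (T x) = \<zeta> * b x"
    and g: "g \<in> L2 M" "AE x in M. g (T x) = \<zeta> * g x"
  obtains c where "AE x in M. g x = c * b x"
proof -
  note [measurable] = L2_measurable[OF b(1)] L2_measurable[OF g(1)]
  have \<zeta>: "\<zeta> * cnj \<zeta> = 1"
    using eigenvalue_cmod[OF b(1) _ b(3)] b(2) by (simp flip: complex_norm_square)
  have "AE x in M. g (T x) * cnj (b (T x)) = g x * cnj (b x)"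
    using b(3) g(2)
  proof eventually_elim
    case (elim x)
    then have "g (T x) * cnj (b (T x)) = (\<zeta> * cnj \<zeta>) * (g x * cnj (b x))" by (simp add: algebra_simps)
    then show ?case by (simp add: \<zeta>)
  qed
  then obtain q where q: "AE x in M. g x * cnj (b x) = q"
    by (rule invariant_AE_const[of "\<lambda>x. g x * cnj (b x)", rotated]) measurable
  have "AE x in M. b (T x) * cnj (b (T x)) = b x * cnj (b x)"
    using b(3)
  proof eventually_elim
    case (elim x)
    then have "b (T x) * cnj (b (T x)) = (\<zeta> * cnj \<zeta>) * (b x * cnj (b x))" by (simp add: algebra_simps)
    then show ?case by (simp add: \<zeta>)
  qed
  then obtain r where r: "AE x in M. b x * cnj (b x) = r"
    by (rule invariant_AE_const[of "\<lambda>x. b x * cnj (b x)", rotated]) measurable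
  have "L2_inner M b b = (\<integral>x. r \<partial>M)"
    unfolding L2_inner_def by (rule integral_cong_AE) (use r in auto)
  then have "r = 1" using L2_inner_self[of M b] b(2) by (simp add: prob_space)
  have "AE x in M. g x = q * b x"
    using q r
  proof eventually_elim
    case (elim x)
    have "g x = g x * (b x * cnj (b x))" using elim(2) \<open>r = 1\<close> by simp
    also have "\<dots> = q * b x" using elim(1) by (simp add: mult_ac)
    finally show ?case .
  qed
  then show thesis by (rule that)
qed

text \<open>The Koopman operator preserves inner products, so the inner product is multiplied by
  \<open>\<zeta> * cnj \<xi>\<close> without changing. Since \<open>\<xi>\<close> has modulus 1,
  this factor is 1 only if the eigenvalues agree.\<close>

lemma eigenfunctions_orthogonal:
  assumes f: "f \<in> L2 M" "AE x in M. f (T x) = \<zeta> * f x"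
    and g: "g \<in> L2 M" "AE x in M. g (T x) = \<xi> * g x" and "L2_norm M g \<noteq> 0" "\<zeta> \<noteq> \<xi>"
  shows "L2_inner M f g = 0"
proof -
  have \<xi>: "\<xi> * cnj \<xi> = 1"
    using eigenvalue_cmod[OF g(1) assms(5) g(2)] by (simp flip: complex_norm_square)
  have "L2_inner M f g = L2_inner M (\<lambda>x. f (T x)) (\<lambda>x. g (T x))"
    by (rule L2_inner_T[OF f(1) g(1), symmetric])
  also have "\<dots> = L2_inner M (\<lambda>x. \<zeta> * f x) (\<lambda>x. \<xi> * g x)"
    using f g by (intro L2_inner_cong_AE L2_measurable L2_T L2_scale) auto
  also have "\<dots> = \<zeta> * cnj \<xi> * L2_inner M f g"
    by (simp add: L2_inner_scale_left L2_inner_scale_right)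
  finally have "\<xi> * L2_inner M f g = \<zeta> * (\<xi> * cnj \<xi>) * L2_inner M f g" by (simp add: mult_ac)
  then show ?thesis using assms(6) \<xi> by simp
qed

end

section \<open>Invariant kernel operators\<close>

text \<open>Bound and invariance are required at every point of the space, not only almost
  everywhere. So \<open>Op f\<close> is a function bounded at each point, and it can be evaluated on
  a countable dense set.\<close>

locale invariant_kernel = ergodic_system M T for M :: "'a measure" and T :: "'a \<Rightarrow> 'a" +
  fixes k :: "'a \<Rightarrow> 'a \<Rightarrow> real" and K :: real
  assumes k_measurable: "case_prod k \<in> borel_measurable (M \<Otimes>\<^sub>M M)"
    and k_bound: "x \<in> space M \<Longrightarrow> y \<in> space M \<Longrightarrow> \<bar>k x y\<bar> \<le> K"
    and k_commute: "k x y = k y x"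
    and k_invariant: "x \<in> space M \<Longrightarrow> y \<in> space M \<Longrightarrow> k (T x) (T y) = k x y"
begin

definition Op :: "('a \<Rightarrow> complex) \<Rightarrow> 'a \<Rightarrow> complex" where
  "Op f x = (\<integral>y. complex_of_real (k x y) * f y \<partial>M)"

lemma K_nonneg: "0 \<le> K"
proof -
  obtain x where "x \<in> space M" using not_empty by blast
  then show ?thesis using k_bound[of x x] by linarith
qed

lemma k_measurable' [measurable]: "x \<in> space M \<Longrightarrow> k x \<in> borel_measurable M"
  using measurable_compose[OF measurable_Pair1' k_measurable, of x] by (simp add: o_def)

lemma kernel_section_L2:
  assumes "x \<in> space M"
  shows "(\<lambda>y. complex_of_real (k x y)) \<in> L2 M"
  using assms k_bound by (intro L2_bounded[of _ K] AE_I2) auto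

text \<open>The kernel is real, so no conjugation appears. Linearity and the pointwise bounds of
  \<open>Op\<close> become facts about inner products with a fixed section.\<close>

lemma Op_eq_inner: "Op f x = L2_inner M f (\<lambda>y. complex_of_real (k x y))"
  by (simp add: Op_def L2_inner_def mult.commute)

lemma norm_kernel_section_le:
  assumes "x \<in> space M"
  shows "L2_norm M (\<lambda>y. complex_of_real (k x y)) \<le> K"
  using assms k_bound K_nonneg by (intro L2_norm_le_bound AE_I2) auto

lemma cmod_Op_le:
  assumes "f \<in> L2 M" "x \<in> space M"
  shows "cmod (Op f x) \<le> K * L2_norm M f"
proof -
  have "cmod (Op f x) \<le> L2_norm M f * L2_norm M (\<lambda>y. complex_of_real (k x y))"
    unfolding Op_eq_inner by (rule L2_Cauchy_Schwarz[OF assms(1) kernel_section_L2[OF assms(2)]])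
  also have "\<dots> \<le> L2_norm M f * K"
    by (intro mult_left_mono norm_kernel_section_le assms L2_norm_nonneg)
  finally show ?thesis by (simp add: mult.commute)
qed

lemma Op_measurable:
  assumes "f \<in> borel_measurable M"
  shows "Op f \<in> borel_measurable M"
proof -
  note [measurable] = k_measurable assms
  have "(\<lambda>p. complex_of_real (case_prod k p) * f (snd p)) \<in> borel_measurable (M \<Otimes>\<^sub>M M)" by measurable
  then have "(\<lambda>(x, y). complex_of_real (k x y) * f y) \<in> borel_measurable (M \<Otimes>\<^sub>M M)"
    by (simp add: case_prod_unfold)
  then show ?thesis unfolding Op_def[abs_def] by (rule borel_measurable_lebesgue_integral)
qed

lemma Op_L2:
  assumes "f \<in> L2 M"
  shows "Op f \<in> L2 M"
  using cmod_Op_le[OF assms] Op_measurable[OF L2_measurable[OF assms]]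
  by (intro L2_bounded[of _ "K * L2_norm M f"] AE_I2) auto

lemma norm_Op_le:
  assumes "f \<in> L2 M"
  shows "L2_norm M (Op f) \<le> K * L2_norm M f"
  using cmod_Op_le[OF assms] Op_measurable[OF L2_measurable[OF assms]] K_nonneg
  by (intro L2_norm_le_bound AE_I2) (auto simp: L2_norm_nonneg)

lemma Op_add: "f \<in> L2 M \<Longrightarrow> g \<in> L2 M \<Longrightarrow> x \<in> space M \<Longrightarrow> Op (\<lambda>x. f x + g x) x = Op f x + Op g x"
  unfolding Op_eq_inner by (intro L2_inner_add_left kernel_section_L2)

lemma Op_diff: "f \<in> L2 M \<Longrightarrow> g \<in> L2 M \<Longrightarrow> x \<in> space M \<Longrightarrow> Op (\<lambda>x. f x - g x) x = Op f x - Op g x"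
  unfolding Op_eq_inner by (intro L2_inner_diff_left kernel_section_L2)

lemma Op_scale: "Op (\<lambda>x. a * f x) x = a * Op f x"
  unfolding Op_eq_inner by (rule L2_inner_scale_left)

lemma Op_lincomb:
  assumes "\<And>i. i \<in> I \<Longrightarrow> f i \<in> L2 M" "x \<in> space M"
  shows "Op (\<lambda>x. \<Sum>i\<in>I. a i * f i x) x = (\<Sum>i\<in>I. a i * Op (f i) x)"
  unfolding Op_eq_inner using assms
  by (subst L2_inner_sum_left) (auto simp: L2_inner_scale_left intro: L2_scale kernel_section_L2)

lemma Op_cong_AE:
  assumes "f \<in> L2 M" "g \<in> L2 M" "AE x in M. f x = g x" "x \<in> space M"
  shows "Op f x = Op g x"
  unfolding Op_eq_inner using assms kernel_section_L2[OF assms(4)]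
  by (intro L2_inner_cong_AE) (auto simp: L2_measurable)

lemma norm_Op_diff_le:
  assumes "f \<in> L2 M" "g \<in> L2 M"
  shows "L2_norm M (\<lambda>x. Op f x - Op g x) \<le> K * L2_norm M (\<lambda>x. f x - g x)"
proof -
  have "L2_norm M (\<lambda>x. Op f x - Op g x) = L2_norm M (Op (\<lambda>x. f x - g x))"
    using assms by (intro L2_norm_cong_AE L2_measurable L2_diff Op_L2 AE_I2) (auto simp: Op_diff)
  then show ?thesis using norm_Op_le[OF L2_diff[OF assms]] by simp
qed

text \<open>Invariance of the measure replaces \<open>y\<close> by \<open>T y\<close> in
  \<open>Op f (T x)\<close>, and invariance of the kernel then removes \<open>T\<close> from both of
  its arguments. No inverse of \<open>T\<close> is involved.\<close>

lemma Op_T: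
  assumes "f \<in> L2 M" "x \<in> space M"
  shows "Op (\<lambda>x. f (T x)) x = Op f (T x)"
proof -
  have "Op f (T x) = (\<integral>y. complex_of_real (k (T x) (T y)) * f (T y) \<partial>M)"
    unfolding Op_def using assms T_space L2_measurable[OF assms(1)]
    by (subst integral_T[where f = "\<lambda>y. complex_of_real (k (T x) y) * f y"]) auto
  also have "\<dots> = Op (\<lambda>x. f (T x)) x"
    unfolding Op_def using assms by (intro Bochner_Integration.integral_cong) (auto simp: k_invariant)
  finally show ?thesis by simp
qed

text \<open>Fubini and the symmetry of the real kernel. Integrability on the product comes from the
  bound \<open>K * cmod (f y) * cmod (g x)\<close>, as square-integrable functions are integrable on
  a probability space.\<close>

lemma Op_self_adjoint:
  assumes "f \<in> L2 M" "g \<in> L2 M"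
  shows "L2_inner M (Op f) g = L2_inner M f (Op g)"
proof -
  interpret P: pair_sigma_finite M M ..
  note [measurable] = k_measurable L2_measurable[OF assms(1)] L2_measurable[OF assms(2)]
  define H where "H x y = complex_of_real (k x y) * f y * cnj (g x)" for x y
  have meas: "case_prod H \<in> borel_measurable (M \<Otimes>\<^sub>M M)"
  proof -
    have "(\<lambda>p. complex_of_real (case_prod k p) * f (snd p) * cnj (g (fst p))) \<in> borel_measurable (M \<Otimes>\<^sub>M M)"
      by measurable
    then show ?thesis by (simp add: H_def case_prod_unfold)
  qed
  have int1: "integrable M (\<lambda>y. complex_of_real (k x y) * f y)" if "x \<in> space M" for x
    using L2_integrable_mult[OF assms(1) kernel_section_L2[OF that]] by (simp add: mult.commute)
  have intf: "integrable M (\<lambda>y. cmod (f y))" and intg: "integrable M (\<lambda>y. cmod (g y))"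
    using L2_integrable_1(1)[OF assms(1)] L2_integrable_1(1)[OF assms(2)] by auto
  have int: "integrable (M \<Otimes>\<^sub>M M) (case_prod H)"
  proof (rule P.Fubini_integrable[OF meas])
    have bd: "(\<integral>y. cmod (H x y) \<partial>M) \<le> (K * (\<integral>y. cmod (f y) \<partial>M)) * cmod (g x)" if x: "x \<in> space M" for x
    proof -
      have "(\<integral>y. cmod (H x y) \<partial>M) \<le> (\<integral>y. (K * cmod (f y)) * cmod (g x) \<partial>M)"
      proof (rule integral_mono')
        show "integrable M (\<lambda>y. (K * cmod (f y)) * cmod (g x))" using intf by auto
        show "cmod (H x y) \<le> (K * cmod (f y)) * cmod (g x)" if "y \<in> space M" for y
          unfolding H_def norm_mult using k_bound[OF x that] by (auto intro!: mult_right_mono)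
        show "0 \<le> (K * cmod (f y)) * cmod (g x)" for y using K_nonneg by simp
      qed
      then show ?thesis by simp
    qed
    show "integrable M (\<lambda>x. \<integral>y. norm (case_prod H (x, y)) \<partial>M)"
    proof (rule Bochner_Integration.integrable_bound)
      show "integrable M (\<lambda>x. (K * (\<integral>y. cmod (f y) \<partial>M)) * cmod (g x))" using intg by auto
      have "(\<lambda>(x, y). norm (H x y)) \<in> borel_measurable (M \<Otimes>\<^sub>M M)"
        using measurable_compose[OF meas borel_measurable_norm] by (simp add: case_prod_unfold)
      from borel_measurable_lebesgue_integral[OF this]
      show "(\<lambda>x. \<integral>y. norm (case_prod H (x, y)) \<partial>M) \<in> borel_measurable M" by simp
      show "AE x in M. norm (\<integral>y. norm (case_prod H (x, y)) \<partial>M) \<le> norm ((K * (\<integral>y. cmod (f y) \<partial>M)) * cmod (g x))"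
        using bd by (intro AE_I2) (simp add: order.trans[OF bd abs_ge_self])
    qed
    show "AE x in M. integrable M (\<lambda>y. case_prod H (x, y))"
      using int1 by (intro AE_I2) (simp add: H_def)
  qed
  have "L2_inner M (Op f) g = (\<integral>x. \<integral>y. H x y \<partial>M \<partial>M)"
    unfolding L2_inner_def Op_def H_def by simp
  also have "\<dots> = (\<integral>y. \<integral>x. H x y \<partial>M \<partial>M)"
    using P.Fubini_integral[OF int] by simp
  also have "\<dots> = (\<integral>y. f y * cnj (Op g y) \<partial>M)"
  proof (rule Bochner_Integration.integral_cong[OF refl])
    fix y assume "y \<in> space M"
    have "(\<integral>x. H x y \<partial>M) = (\<integral>x. f y * cnj (complex_of_real (k y x) * g x) \<partial>M)"
      by (intro Bochner_Integration.integral_cong refl) (simp add: H_def k_commute[of y])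
    also have "\<dots> = f y * cnj (Op g y)"
      unfolding Op_def by (subst Bochner_Integration.integral_cnj[symmetric]) simp
    finally show "(\<integral>x. H x y \<partial>M) = f y * cnj (Op g y)" .
  qed
  finally show ?thesis by (simp add: L2_inner_def)
qed

end

text \<open>Compactness is demanded in the form that an Arzela-Ascoli argument delivers, pointwise
  convergence of a subsequence. The uniform bound \<open>K * R\<close> turns it into convergence in
  norm by dominated convergence.\<close>

locale compact_invariant_kernel = invariant_kernel +
  assumes pointwise_compact: "(\<And>n. f n \<in> L2 M) \<Longrightarrow> (\<And>n. L2_norm M (f n) \<le> R) \<Longrightarrow>
    \<exists>r. strict_mono (r :: nat \<Rightarrow> nat) \<and> (\<forall>x\<in>space M. convergent (\<lambda>n. Op (f (r n)) x))"
begin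

lemma Op_compact:
  assumes f: "\<And>n. f n \<in> L2 M" and R: "\<And>n. L2_norm M (f n) \<le> R"
  obtains r h where "strict_mono (r :: nat \<Rightarrow> nat)" "h \<in> L2 M" "(\<lambda>n. L2_norm M (\<lambda>x. Op (f (r n)) x - h x)) \<longlonglongrightarrow> 0"
proof -
  obtain r :: "nat \<Rightarrow> nat" where r: "strict_mono r" "\<And>x. x \<in> space M \<Longrightarrow> convergent (\<lambda>n. Op (f (r n)) x)"
    using pointwise_compact[of f R] f R by blast
  define h where "h x = lim (\<lambda>n. Op (f (r n)) x)" for x
  have lim: "(\<lambda>n. Op (f (r n)) x) \<longlonglongrightarrow> h x" if "x \<in> space M" for x
    using r(2)[OF that] by (simp add: h_def convergent_LIMSEQ_iff)
  have meas: "Op (f (r n)) \<in> borel_measurable M" for n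
    using Op_measurable[OF L2_measurable[OF f]] .
  have h: "h \<in> borel_measurable M"
    by (rule borel_measurable_LIMSEQ_metric[OF meas lim])
  have bd: "AE x in M. cmod (Op (f (r n)) x) \<le> K * R" for n
    using cmod_Op_le[OF f] mult_left_mono[OF R K_nonneg] by (intro AE_I2) (meson order_trans)
  have lim_AE: "AE x in M. (\<lambda>n. Op (f (r n)) x) \<longlonglongrightarrow> h x" using lim by (rule AE_I2)
  show thesis
    by (rule that[OF r(1)]; rule L2_dominated_convergence[where w = "\<lambda>x. K * R", OF meas h _ _ bd lim_AE]) auto
qed

text \<open>The last conjunct is closedness. Applied to constant sequences it also makes the set
  stable under changes on null sets, as befits a set of representatives.\<close>

definition invariant_subspace :: "('a \<Rightarrow> complex) set \<Rightarrow> bool" where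
  "invariant_subspace V \<longleftrightarrow> V \<subseteq> L2 M \<and> (\<lambda>x. 0) \<in> V \<and>
    (\<forall>f\<in>V. \<forall>g\<in>V. (\<lambda>x. f x + g x) \<in> V) \<and> (\<forall>f\<in>V. \<forall>a. (\<lambda>x. a * f x) \<in> V) \<and>
    (\<forall>f\<in>V. Op f \<in> V) \<and> (\<forall>f\<in>V. (\<lambda>x. f (T x)) \<in> V) \<and>
    (\<forall>f h. (\<forall>n::nat. f n \<in> V) \<and> h \<in> L2 M \<and> (\<lambda>n. L2_norm M (\<lambda>x. f n x - h x)) \<longlonglongrightarrow> 0 \<longrightarrow> h \<in> V)"

lemma
  assumes "invariant_subspace V"
  shows subspace_L2: "f \<in> V \<Longrightarrow> f \<in> L2 M" and subspace_zero: "(\<lambda>x. 0) \<in> V"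
    and subspace_add: "f \<in> V \<Longrightarrow> g \<in> V \<Longrightarrow> (\<lambda>x. f x + g x) \<in> V"
    and subspace_scale: "f \<in> V \<Longrightarrow> (\<lambda>x. a * f x) \<in> V"
    and subspace_Op: "f \<in> V \<Longrightarrow> Op f \<in> V"
    and subspace_T: "f \<in> V \<Longrightarrow> (\<lambda>x. f (T x)) \<in> V"
    and subspace_limit: "(\<And>n::nat. F n \<in> V) \<Longrightarrow> h \<in> L2 M \<Longrightarrow> (\<lambda>n. L2_norm M (\<lambda>x. F n x - h x)) \<longlonglongrightarrow> 0 \<Longrightarrow> h \<in> V"
  using assms unfolding invariant_subspace_def by blast+

lemma subspace_sum:
  assumes "invariant_subspace V" "\<And>i. i \<in> I \<Longrightarrow> f i \<in> V"
  shows "(\<lambda>x. \<Sum>i\<in>I. f i x) \<in> V"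
  using assms(2)
  by (induction I rule: infinite_finite_induct)
    (auto intro: subspace_zero[OF assms(1)] subspace_add[OF assms(1)])

text \<open>A maximizing sequence for the operator norm of \<open>Op\<close> on \<open>V\<close> yields an eigenvector of the
  square of \<open>Op\<close> for the eigenvalue \<open>m\<^sup>2\<close>, hence one of \<open>Op\<close> for \<open>m\<close> or \<open>-m\<close>.\<close>

lemma Op_eigenvector:
  assumes V: "invariant_subspace V" and v: "v \<in> V" "L2_norm M (Op v) \<noteq> 0"
  obtains h \<kappa> where "h \<in> V" "L2_norm M h \<noteq> 0" "(\<kappa>::real) \<noteq> 0" "AE x in M. Op h x = complex_of_real \<kappa> * h x"
proof -
  note V_L2 = subspace_L2[OF V]
  define S where "S = {L2_norm M (Op f) | f. f \<in> V \<and> L2_norm M f \<le> 1}"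
  define m where "m = Sup S"
  have "L2_norm M (Op f) \<le> K" if "f \<in> V" "L2_norm M f \<le> 1" for f
    using norm_Op_le[OF V_L2[OF that(1)]] mult_left_mono[OF that(2) K_nonneg] by simp
  then have bdd: "bdd_above S" unfolding S_def by (intro bdd_aboveI[of _ K]) auto
  have ne: "S \<noteq> {}" unfolding S_def using subspace_zero[OF V] by (auto simp: L2_norm_def intro!: exI[of _ "\<lambda>x. 0"])
  have le_m: "L2_norm M (Op f) \<le> m * L2_norm M f" if f: "f \<in> V" for f
  proof (cases "L2_norm M f = 0")
    case True
    then show ?thesis using norm_Op_le[OF V_L2[OF f]] by simp
  next
    case False
    define a where "a = complex_of_real (1 / L2_norm M f)"
    have a: "cmod a = 1 / L2_norm M f" by (simp add: a_def norm_divide L2_norm_nonneg)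
    have "Op (\<lambda>x. a * f x) = (\<lambda>x. a * Op f x)" by (simp add: Op_scale[abs_def])
    then have "L2_norm M (Op f) / L2_norm M f = L2_norm M (Op (\<lambda>x. a * f x))"
      by (simp add: L2_norm_scale a)
    also have "\<dots> \<le> m" unfolding m_def
      using subspace_scale[OF V f, of a] False a by (intro cSup_upper bdd) (auto simp: S_def L2_norm_scale)
    finally show ?thesis using False L2_norm_nonneg[of M f] by (simp add: field_simps)
  qed
  have m: "m > 0"
  proof (rule ccontr)
    assume "\<not> m > 0"
    then have "m * L2_norm M v \<le> 0" using L2_norm_nonneg[of M v] by (intro mult_nonpos_nonneg) auto
    then show False using le_m[OF v(1)] v(2) L2_norm_nonneg[of M "Op v"] by linarith
  qed
  have "\<exists>f\<in>V. L2_norm M f \<le> 1 \<and> m - 1 / Suc n < L2_norm M (Op f)" for n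
  proof -
    have "m - 1 / Suc n < Sup S" unfolding m_def[symmetric] by simp
    then obtain s where "s \<in> S" "m - 1 / Suc n < s" using less_cSup_iff[OF ne bdd] by blast
    then show ?thesis by (auto simp: S_def)
  qed
  then obtain f where f: "\<And>n. f n \<in> V" "\<And>n. L2_norm M (f n) \<le> 1" "\<And>n. m - 1 / Suc n < L2_norm M (Op (f n))"
    by metis
  define g where "g n = Op (f n)" for n
  have g: "g n \<in> V" for n unfolding g_def by (rule subspace_Op[OF V f(1)])
  have g_le: "L2_norm M (g n) \<le> m" for n
    using le_m[OF f(1)[of n]] mult_left_mono[OF f(2)[of n] less_imp_le[OF m]] by (simp add: g_def)
  have g_lim: "(\<lambda>n. L2_norm M (g n)) \<longlonglongrightarrow> m"
  proof (rule tendsto_sandwich)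
    show "(\<lambda>n. m - 1 / Suc n) \<longlonglongrightarrow> m"
      using tendsto_diff[OF tendsto_const LIMSEQ_inverse_real_of_nat, of m] by (simp add: inverse_eq_divide)
    show "\<forall>\<^sub>F n in sequentially. m - 1 / Suc n \<le> L2_norm M (g n)"
      using f(3) unfolding g_def by (intro always_eventually allI less_imp_le)
  qed (use g_le in auto)
  define m2 where "m2 = complex_of_real (m\<^sup>2)"
  have m2: "cmod m2 = m\<^sup>2" by (simp add: m2_def norm_power)
  define E where "E n = L2_norm M (\<lambda>x. Op (g n) x - m2 * f n x)" for n
  \<comment> \<open>Expanding the square, the three terms are at most
    \<open>m\<^sup>2 * (L2_norm M (g n))\<^sup>2\<close>, \<open>m\<^sup>2 * m\<^sup>2\<close> and
    exactly \<open>- 2 * m\<^sup>2 * (L2_norm M (g n))\<^sup>2\<close>, the last by self-adjointness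
    with \<open>g n = Op (f n)\<close>.\<close>
  have E_le: "(E n)\<^sup>2 \<le> m\<^sup>2 * m\<^sup>2 - m\<^sup>2 * (L2_norm M (g n))\<^sup>2" for n
  proof -
    have "L2_norm M (Op (g n)) \<le> m * L2_norm M (g n)" by (rule le_m[OF g])
    then have 1: "(L2_norm M (Op (g n)))\<^sup>2 \<le> m\<^sup>2 * (L2_norm M (g n))\<^sup>2"
      using L2_norm_nonneg by (metis power_mono power_mult_distrib)
    have "L2_inner M (Op (g n)) (\<lambda>x. m2 * f n x) = m2 * L2_inner M (g n) (g n)"
      by (simp add: L2_inner_scale_right Op_self_adjoint V_L2[OF g] V_L2[OF f(1)] m2_def g_def[symmetric])
    then have 2: "Re (L2_inner M (Op (g n)) (\<lambda>x. m2 * f n x)) = m\<^sup>2 * (L2_norm M (g n))\<^sup>2"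
      by (simp add: L2_inner_self m2_def del: of_real_power)
    have "(m\<^sup>2 * L2_norm M (f n))\<^sup>2 \<le> (m\<^sup>2 * 1)\<^sup>2"
      using f(2)[of n] by (intro power_mono mult_left_mono) (auto simp: L2_norm_nonneg)
    then have 3: "(L2_norm M (\<lambda>x. m2 * f n x))\<^sup>2 \<le> m\<^sup>2 * m\<^sup>2"
      by (simp add: L2_norm_scale m2 power2_eq_square)
    show ?thesis unfolding E_def
      using L2_norm_diff_power2[OF V_L2[OF subspace_Op[OF V g]] V_L2[OF subspace_scale[OF V f(1)]], of n m2 n] 1 2 3 by simp
  qed
  have "(\<lambda>n. (E n)\<^sup>2) \<longlonglongrightarrow> 0"
  proof (rule tendsto_sandwich[of "\<lambda>_. 0"])
    have "(\<lambda>n. m\<^sup>2 * m\<^sup>2 - m\<^sup>2 * (L2_norm M (g n))\<^sup>2) \<longlonglongrightarrow> m\<^sup>2 * m\<^sup>2 - m\<^sup>2 * m\<^sup>2"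
      by (intro tendsto_intros g_lim)
    then show "(\<lambda>n. m\<^sup>2 * m\<^sup>2 - m\<^sup>2 * (L2_norm M (g n))\<^sup>2) \<longlonglongrightarrow> 0" by simp
  qed (use E_le in auto)
  then have "(\<lambda>n. sqrt ((E n)\<^sup>2)) \<longlonglongrightarrow> sqrt 0" by (rule tendsto_real_sqrt)
  moreover have "0 \<le> E n" for n by (simp add: E_def L2_norm_nonneg)
  ultimately have E_lim: "E \<longlonglongrightarrow> 0" by simp
  obtain r h where r: "strict_mono (r :: nat \<Rightarrow> nat)" and h: "h \<in> L2 M"
    and lim: "(\<lambda>n. L2_norm M (\<lambda>x. Op (f (r n)) x - h x)) \<longlonglongrightarrow> 0"
    using Op_compact[of f 1] V_L2[OF f(1)] f(2) by blast
  have lim': "(\<lambda>n. L2_norm M (\<lambda>x. g (r n) x - h x)) \<longlonglongrightarrow> 0" using lim by (simp add: g_def)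
  have hV: "h \<in> V" by (rule subspace_limit[OF V g h lim'])
  \<comment> \<open>The norms of \<open>g n\<close> tend to \<open>m > 0\<close>, so the limit
    \<open>h\<close> cannot vanish.\<close>
  have "m \<le> 0 + L2_norm M h"
  proof (rule LIMSEQ_le)
    show "(\<lambda>n. L2_norm M (g (r n))) \<longlonglongrightarrow> m" using LIMSEQ_subseq_LIMSEQ[OF g_lim r] by (simp add: o_def)
    show "(\<lambda>n. L2_norm M (\<lambda>x. g (r n) x - h x) + L2_norm M h) \<longlonglongrightarrow> 0 + L2_norm M h"
      by (intro tendsto_intros lim')
    show "\<exists>N. \<forall>n\<ge>N. L2_norm M (g (r n)) \<le> L2_norm M (\<lambda>x. g (r n) x - h x) + L2_norm M h"
      using L2_norm_le_diff[OF V_L2[OF g] h] by blast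
  qed
  then have h_pos: "L2_norm M h > 0" using m by simp
  have OO: "Op (Op h) \<in> L2 M" by (intro Op_L2 h)
  have "L2_norm M (\<lambda>x. Op (Op h) x - m2 * h x) \<le> 0"
  proof (rule LIMSEQ_le_const)
    have "(\<lambda>n. K * (K * L2_norm M (\<lambda>x. g (r n) x - h x)) + K * E (r n) + m\<^sup>2 * L2_norm M (\<lambda>x. g (r n) x - h x))
        \<longlonglongrightarrow> K * (K * 0) + K * 0 + m\<^sup>2 * 0"
      by (intro tendsto_intros lim') (use LIMSEQ_subseq_LIMSEQ[OF E_lim r] in \<open>simp add: o_def\<close>)
    then show "(\<lambda>n. K * (K * L2_norm M (\<lambda>x. g (r n) x - h x)) + K * E (r n) + m\<^sup>2 * L2_norm M (\<lambda>x. g (r n) x - h x))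
        \<longlonglongrightarrow> 0" by simp
    \<comment> \<open>\<open>h\<close> is exchanged for \<open>g n\<close> on both sides. In the
      middle, \<open>Op (Op (g n)) - m2 * g n\<close> is \<open>Op\<close> applied to
      \<open>Op (g n) - m2 * f n\<close>, whose norm is \<open>E n\<close>.\<close>
    have "L2_norm M (\<lambda>x. Op (Op h) x - m2 * h x) \<le>
        K * (K * L2_norm M (\<lambda>x. g n x - h x)) + K * E n + m\<^sup>2 * L2_norm M (\<lambda>x. g n x - h x)" for n
    proof -
      have gn: "g n \<in> L2 M" and fn: "f n \<in> L2 M" using V_L2 g f(1) by auto
      have "L2_norm M (\<lambda>x. Op (Op h) x - m2 * h x) \<le>
        L2_norm M (\<lambda>x. Op (Op h) x - Op (Op (g n)) x) + L2_norm M (\<lambda>x. Op (Op (g n)) x - m2 * h x)"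
        by (intro L2_norm_triangle3 OO Op_L2 L2_scale h gn)
      also have "L2_norm M (\<lambda>x. Op (Op (g n)) x - m2 * h x) \<le>
        L2_norm M (\<lambda>x. Op (Op (g n)) x - m2 * g n x) + L2_norm M (\<lambda>x. m2 * g n x - m2 * h x)"
        by (intro L2_norm_triangle3 OO Op_L2 L2_scale h gn)
      also have "L2_norm M (\<lambda>x. m2 * g n x - m2 * h x) = m\<^sup>2 * L2_norm M (\<lambda>x. g n x - h x)"
        using L2_norm_scale[of M m2 "\<lambda>x. g n x - h x"] by (simp add: m2 right_diff_distrib)
      also have "L2_norm M (\<lambda>x. Op (Op (g n)) x - m2 * g n x) \<le> K * E n"
        unfolding E_def using norm_Op_diff_le[OF Op_L2[OF gn] L2_scale[OF fn], of m2] by (simp add: Op_scale g_def)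
      also have "L2_norm M (\<lambda>x. Op (Op h) x - Op (Op (g n)) x) \<le> K * L2_norm M (\<lambda>x. Op h x - Op (g n) x)"
        by (intro norm_Op_diff_le Op_L2 h gn)
      also have "K * L2_norm M (\<lambda>x. Op h x - Op (g n) x) \<le> K * (K * L2_norm M (\<lambda>x. g n x - h x))"
        using norm_Op_diff_le[OF h gn] by (intro mult_left_mono K_nonneg) (simp add: L2_norm_minus_commute[of M h])
      finally show ?thesis by simp
    qed
    then show "\<exists>N. \<forall>n\<ge>N. L2_norm M (\<lambda>x. Op (Op h) x - m2 * h x) \<le>
        K * (K * L2_norm M (\<lambda>x. g (r n) x - h x)) + K * E (r n) + m\<^sup>2 * L2_norm M (\<lambda>x. g (r n) x - h x)" by blast
  qed
  then have "L2_norm M (\<lambda>x. Op (Op h) x - m2 * h x) = 0" using L2_norm_nonneg order.antisym by blast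
  then have OOh: "AE x in M. Op (Op h) x = m2 * h x"
    using L2_norm_eq_0_iff[OF L2_diff[OF OO L2_scale[OF h]]] by simp
  \<comment> \<open>The factorization of \<open>Op\<^sup>2 - m\<^sup>2\<close> into
    \<open>(Op - m) (Op + m)\<close>: either \<open>h'\<close> is an eigenvector for
    \<open>m\<close>, or it vanishes and \<open>h\<close> is one for \<open>- m\<close>.\<close>
  define h' where "h' x = Op h x + complex_of_real m * h x" for x
  have h'V: "h' \<in> V" unfolding h'_def[abs_def] by (intro subspace_add[OF V] subspace_Op[OF V] subspace_scale[OF V] hV)
  have "AE x in M. Op h' x = complex_of_real m * h' x"
    using OOh AE_space
  proof eventually_elim
    case (elim x)
    have "Op h' x = Op (Op h) x + complex_of_real m * Op h x"
      unfolding h'_def[abs_def] using elim(2) by (simp add: Op_add Op_L2 h L2_scale Op_scale)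
    then show ?case using elim(1) by (simp add: h'_def m2_def power2_eq_square algebra_simps)
  qed
  show thesis
  proof (cases "L2_norm M h' = 0")
    case False
    with h'V show thesis using that[of h' m] m \<open>AE x in M. Op h' x = complex_of_real m * h' x\<close> by simp
  next
    case True
    then have "AE x in M. h' x = 0" using L2_norm_eq_0_iff[OF V_L2[OF h'V]] by simp
    then have "AE x in M. Op h x = complex_of_real (- m) * h x"
      by eventually_elim (simp add: h'_def eq_neg_iff_add_eq_0)
    then show thesis using that[of h "- m"] hV h_pos m by simp
  qed
qed

text \<open>A Hilbert-Schmidt bound. For fixed \<open>x\<close> the numbers
  \<open>\<kappa> * e i x\<close> are, up to conjugation, the Fourier coefficients of the section
  \<open>k x\<close>, so Bessel bounds the sum of their squares by \<open>K\<^sup>2\<close>;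
  integration over \<open>x\<close> counts the \<open>e i\<close>.\<close>

lemma Op_eigenspace_dim_le:
  fixes e :: "nat \<Rightarrow> 'a \<Rightarrow> complex"
  assumes e: "\<And>i. i < d \<Longrightarrow> e i \<in> L2 M" "\<And>i. i < d \<Longrightarrow> AE x in M. Op (e i) x = complex_of_real \<kappa> * e i x"
    and on: "\<And>i j. i < d \<Longrightarrow> j < d \<Longrightarrow> L2_inner M (e i) (e j) = (if i = j then 1 else 0)"
  shows "\<kappa>\<^sup>2 * real d \<le> K\<^sup>2"
proof -
  have "AE x in M. \<forall>i\<in>{..<d}. Op (e i) x = complex_of_real \<kappa> * e i x"
    using e(2) by (intro AE_finite_allI) auto
  then have "AE x in M. (\<Sum>i<d. \<kappa>\<^sup>2 * (cmod (e i x))\<^sup>2) \<le> K\<^sup>2"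
    using AE_space
  proof eventually_elim
    case (elim x)
    let ?k = "\<lambda>y. complex_of_real (k x y)"
    have "(\<Sum>i<d. \<kappa>\<^sup>2 * (cmod (e i x))\<^sup>2) = (\<Sum>i<d. (cmod (Op (e i) x))\<^sup>2)"
      using elim(1) by (intro sum.cong) (auto simp: norm_mult power_mult_distrib)
    also have "\<dots> = (\<Sum>i<d. (cmod (L2_inner M ?k (e i)))\<^sup>2)"
      unfolding Op_eq_inner by (subst L2_inner_commute) simp
    also have "\<dots> \<le> (L2_norm M ?k)\<^sup>2"
      using e(1) on kernel_section_L2[OF elim(2)] by (intro L2_Bessel) auto
    also have "\<dots> \<le> K\<^sup>2" by (intro power_mono norm_kernel_section_le elim L2_norm_nonneg)
    finally show ?case .
  qed
  then have "(\<integral>x. (\<Sum>i<d. \<kappa>\<^sup>2 * (cmod (e i x))\<^sup>2) \<partial>M) \<le> (\<integral>x. K\<^sup>2 \<partial>M)"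
    using L2_integrable[OF e(1)] by (intro integral_mono_AE) auto
  also have "(\<integral>x. (\<Sum>i<d. \<kappa>\<^sup>2 * (cmod (e i x))\<^sup>2) \<partial>M) = (\<Sum>i<d. \<kappa>\<^sup>2 * (L2_norm M (e i))\<^sup>2)"
    using L2_integrable[OF e(1)] by (subst Bochner_Integration.integral_sum) (auto simp: L2_norm_power2)
  also have "\<dots> = (\<Sum>i<d. \<kappa>\<^sup>2)"
  proof (intro sum.cong refl)
    fix i assume "i \<in> {..<d}"
    then have "complex_of_real ((L2_norm M (e i))\<^sup>2) = 1" using on[of i i] by (simp add: L2_inner_self[symmetric] del: of_real_power)
    then show "\<kappa>\<^sup>2 * (L2_norm M (e i))\<^sup>2 = \<kappa>\<^sup>2" by (simp only: of_real_eq_1_iff)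
  qed
  finally show ?thesis by (simp add: prob_space mult.commute)
qed

text \<open>Inside \<open>V\<close> an eigenspace of \<open>Op\<close> is finite-dimensional, and
  the Koopman operator maps it into itself because it commutes with \<open>Op\<close>. There it is a
  complex matrix, and an eigenvector of the matrix is an eigenfunction.\<close>

lemma eigenfunction_in_subspace:
  assumes V: "invariant_subspace V" and v: "v \<in> V" "L2_norm M (Op v) \<noteq> 0"
  obtains g \<zeta> where "g \<in> V" "eigenfunction T M \<zeta> g"
proof -
  note V_L2 = subspace_L2[OF V]
  obtain h \<kappa> where h: "h \<in> V" "L2_norm M h \<noteq> 0" and \<kappa>: "\<kappa> \<noteq> 0"
    and h_eig: "AE x in M. Op h x = complex_of_real \<kappa> * h x"
    using Op_eigenvector[OF V v] by blast
  define E where "E = {g \<in> V. AE x in M. Op g x = complex_of_real \<kappa> * g x}"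
  have E_L2: "g \<in> L2 M" if "g \<in> E" for g using that V_L2 by (auto simp: E_def)
  have E_lincomb: "(\<lambda>x. \<Sum>i\<in>I. a i * f i x) \<in> E" if f: "\<And>i. i \<in> I \<Longrightarrow> f i \<in> E" and I: "finite I" for I :: "nat set" and a f
    unfolding E_def
  proof safe
    show "(\<lambda>x. \<Sum>i\<in>I. a i * f i x) \<in> V"
      using f by (intro subspace_sum[OF V] subspace_scale[OF V]) (auto simp: E_def)
    have "AE x in M. \<forall>i\<in>I. Op (f i) x = complex_of_real \<kappa> * f i x"
      using f I by (intro AE_finite_allI) (auto simp: E_def)
    then show "AE x in M. Op (\<lambda>x. \<Sum>i\<in>I. a i * f i x) x = complex_of_real \<kappa> * (\<Sum>i\<in>I. a i * f i x)"
      using AE_space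
    proof eventually_elim
      case (elim x)
      have "Op (\<lambda>x. \<Sum>i\<in>I. a i * f i x) x = (\<Sum>i\<in>I. a i * Op (f i) x)"
        using f E_L2 elim(2) by (intro Op_lincomb) auto
      also have "\<dots> = (\<Sum>i\<in>I. complex_of_real \<kappa> * (a i * f i x))"
        using elim(1) by (intro sum.cong) auto
      finally show ?case by (simp add: sum_distrib_left)
    qed
  qed
  have E_scale: "(\<lambda>x. a * f x) \<in> E" if "f \<in> E" for f a
    using E_lincomb[of "{0}" "\<lambda>_. f" "\<lambda>_. a"] that by simp
  have E_diff: "(\<lambda>x. f x - g x) \<in> E" if "f \<in> E" "g \<in> E" for f g
    using E_lincomb[of "{0, 1}" "\<lambda>i. if i = 0 then f else g" "\<lambda>i. if i = 0 then 1 else -1"] that by simp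
  have E_T: "(\<lambda>x. f (T x)) \<in> E" if "f \<in> E" for f
    unfolding E_def
  proof safe
    show "(\<lambda>x. f (T x)) \<in> V" using that subspace_T[OF V] by (auto simp: E_def)
    have "AE x in M. Op f (T x) = complex_of_real \<kappa> * f (T x)" using that by (intro AE_T) (auto simp: E_def)
    then show "AE x in M. Op (\<lambda>x. f (T x)) x = complex_of_real \<kappa> * f (T x)"
      using AE_space by eventually_elim (simp add: Op_T E_L2[OF that])
  qed
  \<comment> \<open>\<open>Q d\<close> is monitored instead of a dimension: a largest orthonormal
    family in \<open>E\<close> serves as its basis.\<close>
  define Q where "Q d \<longleftrightarrow> (\<exists>e. (\<forall>i<d. e i \<in> E) \<and>
    (\<forall>i<d. \<forall>j<d. L2_inner M (e i) (e j) = (if i = j then 1 else 0)))" for d :: nat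
  have bound: "d \<le> nat \<lceil>K\<^sup>2 / \<kappa>\<^sup>2\<rceil>" if "Q d" for d
  proof -
    obtain e where "\<forall>i<d. e i \<in> E" "\<forall>i<d. \<forall>j<d. L2_inner M (e i) (e j) = (if i = j then 1 else 0)"
      using \<open>Q d\<close> by (auto simp: Q_def)
    then have "\<kappa>\<^sup>2 * real d \<le> K\<^sup>2" by (intro Op_eigenspace_dim_le[of d e]) (auto simp: E_def E_L2 intro: V_L2)
    then have "real d \<le> K\<^sup>2 / \<kappa>\<^sup>2" using \<kappa> by (simp add: field_simps)
    then show ?thesis by linarith
  qed
  have "Q 0" by (simp add: Q_def)
  then obtain d where Q: "Q d" and max: "\<And>d'. Q d' \<Longrightarrow> d' \<le> d"
    using Nat.ex_has_greatest_nat[of Q 0 "nat \<lceil>K\<^sup>2 / \<kappa>\<^sup>2\<rceil>"] bound by blast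
  obtain e where e: "\<And>i. i < d \<Longrightarrow> e i \<in> E"
    and on: "\<And>i j. i < d \<Longrightarrow> j < d \<Longrightarrow> L2_inner M (e i) (e j) = (if i = j then 1 else 0)"
    using Q unfolding Q_def by blast
  \<comment> \<open>If the remainder after projection were nonzero, it could be normalized and
    appended, against maximality of \<open>d\<close>.\<close>
  have expand: "AE x in M. g x = (\<Sum>i<d. L2_inner M g (e i) * e i x)" if g: "g \<in> E" for g
  proof -
    define s where "s x = (\<Sum>i<d. L2_inner M g (e i) * e i x)" for x
    define r where "r x = g x - s x" for x
    have sE: "s \<in> E" unfolding s_def[abs_def] using e by (intro E_lincomb) auto
    have rE: "r \<in> E" unfolding r_def[abs_def] by (rule E_diff[OF g sE])
    have r_orth: "L2_inner M r (e j) = 0" if "j < d" for j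
    proof -
      have "L2_inner M s (e j) = L2_inner M g (e j)"
        unfolding s_def[abs_def] using e E_L2 on that by (intro L2_inner_orthonormal_sum) auto
      then show ?thesis unfolding r_def[abs_def]
        using E_L2[OF g] E_L2[OF sE] E_L2[OF e[OF that]] by (simp add: L2_inner_diff_left)
    qed
    have "L2_norm M r = 0"
    proof (rule ccontr)
      assume nz: "L2_norm M r \<noteq> 0"
      define a where "a = complex_of_real (1 / L2_norm M r)"
      define u where "u x = a * r x" for x
      define e' where "e' = e(d := u)"
      have uE: "u \<in> E" unfolding u_def[abs_def] by (rule E_scale[OF rE])
      have uu: "L2_inner M u u = 1"
      proof -
        have "cmod a * L2_norm M r = 1" using nz by (simp add: a_def norm_divide L2_norm_nonneg)
        then have "L2_norm M u = 1" unfolding u_def[abs_def] L2_norm_scale .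
        then show ?thesis by (simp add: L2_inner_self)
      qed
      have ue: "L2_inner M u (e j) = 0" if "j < d" for j
        using r_orth[OF that] by (simp add: u_def[abs_def] L2_inner_scale_left)
      have eu: "L2_inner M (e j) u = 0" if "j < d" for j
        using ue[OF that] by (subst L2_inner_commute) simp
      have "\<forall>i<Suc d. e' i \<in> E" using e uE by (auto simp: e'_def less_Suc_eq)
      moreover have "\<forall>i<Suc d. \<forall>j<Suc d. L2_inner M (e' i) (e' j) = (if i = j then 1 else 0)"
        using on uu ue eu by (auto simp: e'_def less_Suc_eq)
      ultimately have "Q (Suc d)" unfolding Q_def by blast
      then show False using max by fastforce
    qed
    then have "AE x in M. r x = 0" using L2_norm_eq_0_iff[OF E_L2[OF rE]] by simp
    then show ?thesis by eventually_elim (simp add: r_def s_def)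
  qed
  have hE: "h \<in> E" using h h_eig by (simp add: E_def)
  have "d > 0"
  proof (rule ccontr)
    assume "\<not> d > 0"
    then have "AE x in M. h x = 0" using expand[OF hE] by simp
    then show False using h L2_norm_eq_0_iff[OF E_L2[OF hE]] by simp
  qed
  \<comment> \<open>Column \<open>j\<close> holds the coordinates of the Koopman image of
    \<open>e j\<close>.\<close>
  define m where "m i j = L2_inner M (\<lambda>x. e j (T x)) (e i)" for i j
  obtain \<zeta> v where v: "\<exists>i<d. v i \<noteq> 0" and eig: "\<And>i. i < d \<Longrightarrow> (\<Sum>j<d. m i j * v j) = \<zeta> * v i"
    by (rule complex_square_system_eigenvector[OF \<open>d > 0\<close>, of m]) (rule that)
  define g where "g x = (\<Sum>j<d. v j * e j x)" for x
  have gE: "g \<in> E" unfolding g_def[abs_def] using e by (intro E_lincomb) auto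
  have "AE x in M. \<forall>j\<in>{..<d}. e j (T x) = (\<Sum>i<d. m i j * e i x)"
  proof (rule AE_finite_allI)
    fix j assume "j \<in> {..<d}"
    then show "AE x in M. e j (T x) = (\<Sum>i<d. m i j * e i x)"
      unfolding m_def by (intro expand[OF E_T[OF e]]) simp
  qed simp
  then have "AE x in M. g (T x) = \<zeta> * g x"
  proof eventually_elim
    case (elim x)
    have "g (T x) = (\<Sum>j<d. \<Sum>i<d. v j * (m i j * e i x))"
      unfolding g_def using elim by (simp add: sum_distrib_left)
    also have "\<dots> = (\<Sum>i<d. \<Sum>j<d. v j * (m i j * e i x))" by (rule sum.swap)
    also have "\<dots> = (\<Sum>i<d. (\<Sum>j<d. m i j * v j) * e i x)"
      by (simp add: sum_distrib_right sum_distrib_left mult_ac)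
    also have "\<dots> = \<zeta> * g x" using eig by (simp add: g_def sum_distrib_left mult_ac)
    finally show ?case .
  qed
  moreover have "\<not> (AE x in M. g x = 0)"
  proof
    assume "AE x in M. g x = 0"
    obtain i where i: "i < d" "v i \<noteq> 0" using v by blast
    have "v i = L2_inner M g (e i)"
      unfolding g_def[abs_def] using e E_L2 on i by (intro L2_inner_orthonormal_sum[symmetric]) auto
    also have "\<dots> = L2_inner M (\<lambda>x. 0) (e i)"
      using \<open>AE x in M. g x = 0\<close> E_L2[OF gE] E_L2[OF e[OF i(1)]] by (intro L2_inner_cong_AE) (auto simp: L2_measurable)
    finally show False using i by (simp add: L2_inner_def)
  qed
  ultimately have "eigenfunction T M \<zeta> g" using E_L2[OF gE] by (simp add: eigenfunction_def)
  then show thesis using that gE by (auto simp: E_def)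
qed

end

section \<open>The eigenfunction basis\<close>

context ergodic_system
begin

text \<open>One arbitrary unit vector per eigenvalue is enough because eigenspaces are
  one-dimensional. For other numbers the choice is meaningless, and \<open>eigen_basis\<close>
  excludes them.\<close>

definition eigenvector_of :: "complex \<Rightarrow> 'a \<Rightarrow> complex" where
  "eigenvector_of \<zeta> = (SOME g. eigenfunction T M \<zeta> g \<and> L2_norm M g = 1)"

definition eigen_basis :: "('a \<Rightarrow> complex) set" where
  "eigen_basis = eigenvector_of ` {\<zeta>. \<exists>g. eigenfunction T M \<zeta> g}"

lemma eigenvector_of:
  assumes "eigenfunction T M \<zeta> g"
  shows "eigenfunction T M \<zeta> (eigenvector_of \<zeta>)" "L2_norm M (eigenvector_of \<zeta>) = 1"
proof -
  have g: "g \<in> L2 M" "\<not> (AE x in M. g x = 0)" "AE x in M. g (T x) = \<zeta> * g x"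
    using assms by (auto simp: eigenfunction_def)
  have nz: "L2_norm M g \<noteq> 0" using g L2_norm_eq_0_iff by blast
  define a where "a = complex_of_real (1 / L2_norm M g)"
  have a: "a \<noteq> 0" "cmod a * L2_norm M g = 1" using nz by (auto simp: a_def norm_divide L2_norm_nonneg)
  have "eigenfunction T M \<zeta> (\<lambda>x. a * g x)"
    unfolding eigenfunction_def
  proof (intro conjI)
    show "AE x in M. a * g (T x) = \<zeta> * (a * g x)" using g(3) by eventually_elim simp
  qed (use g a L2_scale in auto)
  moreover have "L2_norm M (\<lambda>x. a * g x) = 1" using a(2) by (simp only: L2_norm_scale)
  ultimately have "\<exists>g. eigenfunction T M \<zeta> g \<and> L2_norm M g = 1" by blast
  from someI_ex[OF this]
  show "eigenfunction T M \<zeta> (eigenvector_of \<zeta>)" "L2_norm M (eigenvector_of \<zeta>) = 1"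
    unfolding eigenvector_of_def by auto
qed

lemma eigen_basisE:
  assumes "b \<in> eigen_basis"
  obtains \<zeta> where "b = eigenvector_of \<zeta>" "eigenfunction T M \<zeta> b" "b \<in> L2 M" "L2_norm M b = 1"
    "AE x in M. b (T x) = \<zeta> * b x"
proof -
  obtain \<zeta> g where b: "b = eigenvector_of \<zeta>" "eigenfunction T M \<zeta> g"
    using assms by (auto simp: eigen_basis_def)
  then show thesis using that[OF b(1)] eigenvector_of[OF b(2)] by (auto simp: eigenfunction_def)
qed

lemma eigen_basis_L2: "eigen_basis \<subseteq> L2 M"
  by (auto elim: eigen_basisE)

lemma eigen_basis_norm: "b \<in> eigen_basis \<Longrightarrow> L2_norm M b = 1"
  by (auto elim: eigen_basisE)

lemma eigen_basis_orthonormal: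
  assumes "b \<in> eigen_basis" "b' \<in> eigen_basis"
  shows "L2_inner M b b' = (if b = b' then 1 else 0)"
proof -
  obtain \<zeta> where \<zeta>: "b = eigenvector_of \<zeta>" "b \<in> L2 M" "L2_norm M b = 1" "AE x in M. b (T x) = \<zeta> * b x"
    using eigen_basisE[OF assms(1)] by blast
  obtain \<xi> where \<xi>: "b' = eigenvector_of \<xi>" "b' \<in> L2 M" "L2_norm M b' = 1" "AE x in M. b' (T x) = \<xi> * b' x"
    using eigen_basisE[OF assms(2)] by blast
  show ?thesis
  proof (cases "b = b'")
    case True
    then show ?thesis using \<zeta>(3) by (simp add: L2_inner_self)
  next
    case False
    then have "\<zeta> \<noteq> \<xi>" using \<zeta>(1) \<xi>(1) by auto
    then show ?thesis using False eigenfunctions_orthogonal[OF \<zeta>(2,4) \<xi>(2,4)] \<xi>(3) by simp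
  qed
qed

text \<open>\<open>g\<close> is a nonzero multiple of the chosen vector for its own eigenvalue. This
  rules out eigenfunctions in the orthogonal complement.\<close>

lemma eigenfunction_not_orthogonal:
  assumes g: "eigenfunction T M \<zeta> g"
  shows "\<exists>b\<in>eigen_basis. L2_inner M g b \<noteq> 0"
proof (rule bexI)
  define b where "b = eigenvector_of \<zeta>"
  have b: "b \<in> L2 M" "AE x in M. b (T x) = \<zeta> * b x" "L2_norm M b = 1"
    using eigenvector_of[OF g] by (auto simp: b_def eigenfunction_def)
  have g': "g \<in> L2 M" "AE x in M. g (T x) = \<zeta> * g x" "\<not> (AE x in M. g x = 0)"
    using g by (auto simp: eigenfunction_def)
  obtain c where c: "AE x in M. g x = c * b x"
    using eigenspace_one_dim[OF b(1,3,2) g'(1,2)] by blast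
  have "L2_inner M g b = L2_inner M (\<lambda>x. c * b x) b"
    using c g' b by (intro L2_inner_cong_AE) (auto simp: L2_measurable L2_scale)
  also have "\<dots> = c" using b(3) by (simp add: L2_inner_scale_left L2_inner_self)
  finally have "L2_inner M g b = c" .
  moreover have "c \<noteq> 0" using c g'(3) by auto
  ultimately show "L2_inner M g (eigenvector_of \<zeta>) \<noteq> 0" by (simp add: b_def)
  show "eigenvector_of \<zeta> \<in> eigen_basis" using g by (auto simp: eigen_basis_def)
qed

end

section \<open>Vanishing on the orthogonal complement, and the range of the operator\<close>

context compact_invariant_kernel
begin

text \<open>\<open>Op\<close> commutes with the Koopman operator, so \<open>Op b\<close> stays in
  the one-dimensional eigenspace spanned by \<open>b\<close>.\<close>

lemma Op_eigen_basis:
  assumes "b \<in> eigen_basis"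
  obtains c where "AE x in M. Op b x = c * b x"
proof -
  obtain \<zeta> where b: "b \<in> L2 M" "L2_norm M b = 1" "AE x in M. b (T x) = \<zeta> * b x"
    using eigen_basisE[OF assms] by blast
  have "AE x in M. Op b (T x) = \<zeta> * Op b x"
    using AE_space
  proof eventually_elim
    case (elim x)
    have "Op b (T x) = Op (\<lambda>x. \<zeta> * b x) x"
      unfolding Op_T[OF b(1) elim, symmetric] by (intro Op_cong_AE L2_T L2_scale b elim)
    then show ?case by (simp add: Op_scale)
  qed
  then show thesis using eigenspace_one_dim[OF b Op_L2[OF b(1)]] that by blast
qed

text \<open>For \<open>Op\<close> the operator is moved onto \<open>b\<close>, which it only scales.
  For Koopman an adjoint is bypassed: up to a factor of modulus 1, \<open>b\<close> may be replaced
  by its own Koopman image, and then isometry removes \<open>T\<close> from both sides.\<close>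

lemma orthogonal_complement_invariant:
  "invariant_subspace {f \<in> L2 M. \<forall>b\<in>eigen_basis. L2_inner M f b = 0}"
  unfolding invariant_subspace_def
proof (intro conjI ballI allI impI; (elim CollectE conjE)?; (intro CollectI conjI ballI)?)
  show "{f \<in> L2 M. \<forall>b\<in>eigen_basis. L2_inner M f b = 0} \<subseteq> L2 M" by auto
  show "(\<lambda>x. 0) \<in> L2 M" by (rule L2_zero)
  show "L2_inner M (\<lambda>x. 0) b = 0" for b by (simp add: L2_inner_def)
next
  fix f g b assume f: "f \<in> L2 M" "\<forall>b\<in>eigen_basis. L2_inner M f b = 0"
  {
    assume g: "g \<in> L2 M" "\<forall>b\<in>eigen_basis. L2_inner M g b = 0"
    show "(\<lambda>x. f x + g x) \<in> L2 M" by (intro L2_add f g)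
    assume "b \<in> eigen_basis"
    then show "L2_inner M (\<lambda>x. f x + g x) b = 0" using f g eigen_basis_L2 by (subst L2_inner_add_left) auto
  }
  show "(\<lambda>x. a * f x) \<in> L2 M" for a by (intro L2_scale f)
  show "Op f \<in> L2 M" by (intro Op_L2 f)
  show "(\<lambda>x. f (T x)) \<in> L2 M" by (intro L2_T f)
  assume b: "b \<in> eigen_basis"
  then show "L2_inner M (\<lambda>x. a * f x) b = 0" for a using f by (simp add: L2_inner_scale_left)
  obtain \<zeta> where \<zeta>: "b \<in> L2 M" "L2_norm M b = 1" "AE x in M. b (T x) = \<zeta> * b x"
    using eigen_basisE[OF b] by blast
  obtain c where c: "AE x in M. Op b x = c * b x" using Op_eigen_basis[OF b] by blast
  have "L2_inner M (Op f) b = L2_inner M f (Op b)" by (rule Op_self_adjoint[OF f(1) \<zeta>(1)])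
  also have "\<dots> = L2_inner M f (\<lambda>x. c * b x)"
    using c f \<zeta> by (intro L2_inner_cong_AE L2_measurable Op_L2 L2_scale) auto
  also have "\<dots> = 0" using f b by (simp add: L2_inner_scale_right)
  finally show "L2_inner M (Op f) b = 0" .
  have "cnj \<zeta> * \<zeta> = 1"
    using eigenvalue_cmod[OF \<zeta>(1) _ \<zeta>(3)] \<zeta>(2) by (simp add: mult.commute[of "cnj \<zeta>"] flip: complex_norm_square)
  then have "\<zeta> \<noteq> 0" by auto
  have "cnj \<zeta> * L2_inner M (\<lambda>x. f (T x)) b = L2_inner M (\<lambda>x. f (T x)) (\<lambda>x. \<zeta> * b x)"
    by (simp add: L2_inner_scale_right)
  also have "\<dots> = L2_inner M (\<lambda>x. f (T x)) (\<lambda>x. b (T x))"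
    using f \<zeta> by (intro L2_inner_cong_AE L2_measurable L2_T L2_scale) auto
  also have "\<dots> = 0" using L2_inner_T[OF f(1) \<zeta>(1)] f b by simp
  finally show "L2_inner M (\<lambda>x. f (T x)) b = 0" using \<open>\<zeta> \<noteq> 0\<close> by simp
next
  fix f :: "nat \<Rightarrow> 'a \<Rightarrow> complex" and h
  assume f: "\<forall>n. f n \<in> {f \<in> L2 M. \<forall>b\<in>eigen_basis. L2_inner M f b = 0}" and h: "h \<in> L2 M"
    and lim: "(\<lambda>n. L2_norm M (\<lambda>x. f n x - h x)) \<longlonglongrightarrow> 0"
  show "h \<in> L2 M" by (rule h)
  fix b assume b: "b \<in> eigen_basis"
  have b2: "b \<in> L2 M" using b eigen_basis_L2 by blast
  have "cmod (L2_inner M h b) \<le> 0"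
  proof (rule LIMSEQ_le_const[OF lim], intro exI allI impI)
    fix n
    have fn: "f n \<in> L2 M" "L2_inner M (f n) b = 0" using f b by auto
    have "cmod (L2_inner M h b) = cmod (L2_inner M (\<lambda>x. f n x - h x) b)"
      using fn h b2 by (simp add: L2_inner_diff_left)
    also have "\<dots> \<le> L2_norm M (\<lambda>x. f n x - h x)"
      using L2_Cauchy_Schwarz[OF L2_diff[OF fn(1) h] b2] eigen_basis_norm[OF b] by simp
    finally show "cmod (L2_inner M h b) \<le> L2_norm M (\<lambda>x. f n x - h x)" .
  qed
  then show "L2_inner M h b = 0" by simp
qed

lemma Op_orthogonal_complement:
  assumes "v \<in> L2 M" "\<And>b. b \<in> eigen_basis \<Longrightarrow> L2_inner M v b = 0"
  shows "L2_norm M (Op v) = 0"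
proof (rule ccontr)
  assume *: "L2_norm M (Op v) \<noteq> 0"
  have v: "v \<in> {f \<in> L2 M. \<forall>b\<in>eigen_basis. L2_inner M f b = 0}" using assms by auto
  obtain g \<zeta> where "g \<in> {f \<in> L2 M. \<forall>b\<in>eigen_basis. L2_inner M f b = 0}" "eigenfunction T M \<zeta> g"
    using eigenfunction_in_subspace[OF orthogonal_complement_invariant v *] by blast
  then show False using eigenfunction_not_orthogonal by blast
qed

text \<open>Completeness of \<open>L\<^sup>2\<close> is not needed for the projection onto the closed span: the remainders
  of finite partial sums that nearly exhaust the Fourier coefficients of \<open>f\<close> converge along a
  subsequence after \<open>Op\<close> has been applied.\<close>

lemma Op_in_span_closure:
  assumes f: "f \<in> L2 M"
  shows "Op f \<in> L2_span_closure M eigen_basis"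
proof -
  note B = eigen_basis_L2
  define q where "q F = (\<Sum>b\<in>F. (cmod (L2_inner M f b))\<^sup>2)" for F
  define S where "S = {q F | F. finite F \<and> F \<subseteq> eigen_basis}"
  have q_le: "q F \<le> (L2_norm M f)\<^sup>2" if "finite F" "F \<subseteq> eigen_basis" for F
    unfolding q_def using that B f eigen_basis_orthonormal by (intro L2_Bessel[where b = "\<lambda>b. b"]) blast+
  have bdd: "bdd_above S" by (rule bdd_aboveI[of _ "(L2_norm M f)\<^sup>2"]) (auto simp: S_def q_le)
  have ne: "S \<noteq> {}" by (auto simp: S_def)
  have "\<exists>F. finite F \<and> F \<subseteq> eigen_basis \<and> Sup S - 1 / Suc n < q F" for n
  proof -
    have "Sup S - 1 / Suc n < Sup S" by simp
    then obtain s where "s \<in> S" "Sup S - 1 / Suc n < s" using less_cSup_iff[OF ne bdd] by blast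
    then show ?thesis by (auto simp: S_def)
  qed
  then obtain F where F: "\<And>n. finite (F n)" "\<And>n. F n \<subseteq> eigen_basis" "\<And>n. Sup S - 1 / Suc n < q (F n)"
    by metis
  have F_L2: "b \<in> L2 M" if "b \<in> F n" for b n using F(2) B that by blast
  define P where "P n x = (\<Sum>b\<in>F n. L2_inner M f b * b x)" for n x
  define g where "g n x = f x - P n x" for n x
  have P: "P n \<in> L2 M" for n unfolding P_def[abs_def] using F F_L2 by (intro L2_sum L2_scale) auto
  have g: "g n \<in> L2 M" for n unfolding g_def[abs_def] by (intro L2_diff f P)
  have g_norm: "L2_norm M (g n) \<le> L2_norm M f" for n
    unfolding g_def[abs_def] P_def
    using F F_L2 f eigen_basis_orthonormal by (intro L2_norm_minus_projection_le[where b = "\<lambda>b. b"]) blast+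
  \<comment> \<open>Coefficients on \<open>F n\<close> have been subtracted. Any other
    \<open>b\<close> could be added to \<open>F n\<close>, and the enlarged sum would still be at
    most \<open>Sup S\<close>, which exceeds \<open>q (F n)\<close> by less than
    \<open>1 / Suc n\<close>.\<close>
  have g_inner: "(cmod (L2_inner M (g n) b))\<^sup>2 \<le> 1 / Suc n" if b: "b \<in> eigen_basis" for n b
  proof -
    have b2: "b \<in> L2 M" using b B by blast
    have gb: "L2_inner M (g n) b = L2_inner M f b - L2_inner M (P n) b"
      unfolding g_def[abs_def] by (intro L2_inner_diff_left f P b2)
    show ?thesis
    proof (cases "b \<in> F n")
      case True
      have "L2_inner M (P n) b = L2_inner M f b"
        unfolding P_def[abs_def] using F F_L2 eigen_basis_orthonormal True
        by (intro L2_inner_orthonormal_sum[where b = "\<lambda>b. b"]) blast+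
      then show ?thesis using gb by simp
    next
      case False
      have "L2_inner M (P n) b = (\<Sum>b'\<in>F n. L2_inner M f b' * L2_inner M b' b)"
        unfolding P_def[abs_def] using F_L2 b2 by (subst L2_inner_sum_left) (auto simp: L2_scale L2_inner_scale_left)
      also have "\<dots> = 0"
      proof (intro sum.neutral ballI)
        fix b' assume "b' \<in> F n"
        then have "b' \<in> eigen_basis" "b' \<noteq> b" using False F(2) by auto
        then show "L2_inner M f b' * L2_inner M b' b = 0" using eigen_basis_orthonormal[OF _ b] by simp
      qed
      finally have "q (insert b (F n)) = (cmod (L2_inner M (g n) b))\<^sup>2 + q (F n)"
        using gb False F(1) by (simp add: q_def)
      moreover have "q (insert b (F n)) \<le> Sup S"
        using F(1,2)[of n] b by (intro cSup_upper bdd) (auto simp: S_def)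
      ultimately show ?thesis using F(3)[of n] by linarith
    qed
  qed
  obtain r u where r: "strict_mono (r :: nat \<Rightarrow> nat)" and u: "u \<in> L2 M"
    and lim: "(\<lambda>n. L2_norm M (\<lambda>x. Op (g (r n)) x - u x)) \<longlonglongrightarrow> 0"
    by (rule Op_compact[of g "L2_norm M f", OF g g_norm]) (rule that)
  have Og: "Op (g n) \<in> L2 M" for n by (intro Op_L2 g)
  \<comment> \<open>By self-adjointness the coefficient of \<open>Op (g n)\<close> at
    \<open>b\<close> has modulus \<open>cmod c\<close> times that of \<open>g n\<close>, and the
    latter tends to 0.\<close>
  have u_orth: "L2_inner M u b = 0" if b: "b \<in> eigen_basis" for b
  proof -
    have b2: "b \<in> L2 M" and b1: "L2_norm M b = 1" using b B eigen_basis_norm by auto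
    obtain c where c: "AE x in M. Op b x = c * b x" using Op_eigen_basis[OF b] by blast
    have "cmod (L2_inner M u b) \<le> 0"
    proof (rule LIMSEQ_le_const)
      have "(\<lambda>n. 1 / real (Suc (r n))) \<longlonglongrightarrow> 0"
        using LIMSEQ_subseq_LIMSEQ[OF LIMSEQ_inverse_real_of_nat r] by (simp add: o_def inverse_eq_divide)
      then have "(\<lambda>n. L2_norm M (\<lambda>x. Op (g (r n)) x - u x) + cmod c * sqrt (1 / Suc (r n)))
          \<longlonglongrightarrow> 0 + cmod c * sqrt 0"
        by (intro tendsto_add tendsto_mult tendsto_const lim tendsto_real_sqrt)
      then show "(\<lambda>n. L2_norm M (\<lambda>x. Op (g (r n)) x - u x) + cmod c * sqrt (1 / Suc (r n))) \<longlonglongrightarrow> 0"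
        by simp
      have "cmod (L2_inner M u b) \<le> L2_norm M (\<lambda>x. Op (g n) x - u x) + cmod c * sqrt (1 / Suc n)" for n
      proof -
        have "L2_inner M (Op (g n)) b = L2_inner M (g n) (Op b)" by (rule Op_self_adjoint[OF g b2])
        also have "\<dots> = L2_inner M (g n) (\<lambda>x. c * b x)"
          using c g b2 by (intro L2_inner_cong_AE L2_measurable Op_L2 L2_scale) auto
        finally have "cmod (L2_inner M (Op (g n)) b) = cmod c * cmod (L2_inner M (g n) b)"
          by (simp add: L2_inner_scale_right norm_mult)
        also have "\<dots> \<le> cmod c * sqrt (1 / Suc n)"
          using g_inner[OF b, of n] by (intro mult_left_mono real_le_rsqrt) auto
        finally have 1: "cmod (L2_inner M (Op (g n)) b) \<le> cmod c * sqrt (1 / Suc n)" .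
        have "cmod (L2_inner M (\<lambda>x. Op (g n) x - u x) b) \<le> L2_norm M (\<lambda>x. Op (g n) x - u x)"
          using L2_Cauchy_Schwarz[OF L2_diff[OF Og u] b2] b1 by simp
        moreover have "L2_inner M u b = L2_inner M (Op (g n)) b - L2_inner M (\<lambda>x. Op (g n) x - u x) b"
          using Og u b2 by (simp add: L2_inner_diff_left)
        ultimately show ?thesis using 1
          norm_triangle_ineq4[of "L2_inner M (Op (g n)) b" "L2_inner M (\<lambda>x. Op (g n) x - u x) b"] by simp
      qed
      then show "\<exists>N. \<forall>n\<ge>N. cmod (L2_inner M u b) \<le>
          L2_norm M (\<lambda>x. Op (g (r n)) x - u x) + cmod c * sqrt (1 / Suc (r n))" by blast
    qed
    then show ?thesis by simp
  qed
  have Ou: "L2_norm M (Op u) = 0" by (rule Op_orthogonal_complement[OF u u_orth])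
  \<comment> \<open>\<open>u\<close> is orthogonal to each \<open>Op (g n)\<close>, since
    \<open>Op\<close> can be moved onto \<open>u\<close>, where it gives 0. Being the limit of these
    functions along \<open>r\<close>, \<open>u\<close> is orthogonal to itself.\<close>
  have "(L2_norm M u)\<^sup>2 \<le> L2_norm M u * 0"
  proof (rule LIMSEQ_le_const)
    show "(\<lambda>n. L2_norm M u * L2_norm M (\<lambda>x. Op (g (r n)) x - u x)) \<longlonglongrightarrow> L2_norm M u * 0"
      by (intro tendsto_intros lim)
    have "(L2_norm M u)\<^sup>2 \<le> L2_norm M u * L2_norm M (\<lambda>x. Op (g n) x - u x)" for n
    proof -
      have "cmod (L2_inner M (Op u) (g n)) \<le> 0" using L2_Cauchy_Schwarz[OF Op_L2[OF u] g, of n] Ou by simp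
      then have "L2_inner M u (Op (g n)) = 0" using Op_self_adjoint[OF u g] by simp
      then have "L2_inner M u (\<lambda>x. Op (g n) x - u x) = - complex_of_real ((L2_norm M u)\<^sup>2)"
        using L2_inner_diff_right[OF Og u u] by (simp add: L2_inner_self)
      then have "cmod (L2_inner M u (\<lambda>x. Op (g n) x - u x)) = (L2_norm M u)\<^sup>2"
        by (simp only: norm_minus_cancel norm_of_real) simp
      then show ?thesis using L2_Cauchy_Schwarz[OF u L2_diff[OF Og u], of n] by simp
    qed
    then show "\<exists>N. \<forall>n\<ge>N. (L2_norm M u)\<^sup>2 \<le> L2_norm M u * L2_norm M (\<lambda>x. Op (g (r n)) x - u x)" by blast
  qed
  then have nu: "L2_norm M u = 0" by simp
  have "\<forall>b\<in>eigen_basis. \<exists>c. AE x in M. Op b x = c * b x" using Op_eigen_basis by metis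
  then obtain c where c: "\<And>b. b \<in> eigen_basis \<Longrightarrow> AE x in M. Op b x = c b * b x" by metis
  \<comment> \<open>The image under \<open>Op\<close> of the partial sum \<open>P n\<close>, almost
    everywhere. It lies in the span because \<open>Op\<close> scales each basis vector.\<close>
  define w where "w n x = (\<Sum>b\<in>F n. (L2_inner M f b * c b) * b x)" for n x
  have w: "w n \<in> L2_span_closure M eigen_basis" for n
    unfolding w_def[abs_def] by (intro L2_span_closure_lincomb B F)
  then have w2: "w n \<in> L2 M" for n by (auto simp: L2_span_closure_def)
  show ?thesis
  proof (rule L2_span_closure_limit[OF B Op_L2[OF f]])
    fix \<epsilon> :: real assume "\<epsilon> > 0"
    then obtain n where n: "L2_norm M (\<lambda>x. Op (g (r n)) x - u x) < \<epsilon>"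
      using LIMSEQ_D[OF lim, of \<epsilon>] by (auto simp: L2_norm_nonneg)
    have "AE x in M. \<forall>b\<in>F (r n). Op b x = c b * b x"
      using F(1,2) c by (intro AE_finite_allI) blast+
    then have "AE x in M. Op f x - w (r n) x = Op (g (r n)) x"
      using AE_space
    proof eventually_elim
      case (elim x)
      have "Op (P (r n)) x = (\<Sum>b\<in>F (r n). L2_inner M f b * Op b x)"
        unfolding P_def[abs_def] using F F_L2 elim(2) by (intro Op_lincomb) auto
      also have "\<dots> = w (r n) x" unfolding w_def using elim(1) by (intro sum.cong) auto
      finally show ?case unfolding g_def[abs_def] using elim(2) by (simp add: Op_diff f P)
    qed
    then have "L2_norm M (\<lambda>x. Op f x - w (r n) x) = L2_norm M (Op (g (r n)))"
      by (intro L2_norm_cong_AE L2_measurable L2_diff Op_L2 f g w2)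
    also have "\<dots> < \<epsilon>" using L2_norm_le_diff[OF Og u, of "r n"] nu n by simp
    finally show "\<exists>h\<in>L2_span_closure M eigen_basis. L2_norm M (\<lambda>x. Op f x - h x) < \<epsilon>"
      using w by (intro bexI[of _ "w (r n)"])
  qed
qed

end

section \<open>The kernel of the mean orbit pseudometric\<close>

lemma (in mean_equicontinuous_system) countable_dense_subset:
  obtains S where "S \<subseteq> X" "countable S" "\<And>x \<delta>. x \<in> X \<Longrightarrow> \<delta> > 0 \<Longrightarrow> \<exists>p\<in>S. dist x p < \<delta>"
proof -
  have "\<exists>C. C \<subseteq> X \<and> finite C \<and> X \<subseteq> (\<Union>c\<in>C. ball c (1 / Suc n))" for n
    using finite_net[of "1 / Suc n"] by (metis of_nat_0_less_iff zero_less_Suc zero_less_divide_1_iff)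
  then obtain C where C: "\<And>n. C n \<subseteq> X" "\<And>n. finite (C n)" "\<And>n. X \<subseteq> (\<Union>c\<in>C n. ball c (1 / Suc n))"
    by metis
  show thesis
  proof (rule that[of "\<Union>n. C n"])
    show "(\<Union>n. C n) \<subseteq> X" using C(1) by blast
    show "countable (\<Union>n. C n)" using C(2) by (intro countable_UN) (auto intro: countable_finite)
    fix x and \<delta> :: real assume x: "x \<in> X" and "\<delta> > 0"
    then obtain n where n: "1 / Suc n < \<delta>" using nat_approx_posE by blast
    obtain c where "c \<in> C n" "dist c x < 1 / Suc n" using C(3)[of n] x by auto
    then show "\<exists>p\<in>\<Union>n. C n. dist x p < \<delta>" using n by (intro bexI[of _ c]) (auto simp: dist_commute)
  qed
qed

lemma (in mean_equicontinuous_system) continuous_mean_dist: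
  assumes "p \<in> X"
  shows "continuous_on X (\<lambda>x. L x p)"
  unfolding continuous_on_iff
proof (intro ballI allI impI)
  fix x and e :: real assume x: "x \<in> X" and "e > 0"
  then obtain \<delta> where \<delta>: "\<delta> > 0" "\<And>x y. x \<in> X \<Longrightarrow> y \<in> X \<Longrightarrow> dist x y < \<delta> \<Longrightarrow> L x y < e"
    using mean_dist_small by blast
  have "\<bar>L x' p - L x p\<bar> < e" if "x' \<in> X" "dist x' x < \<delta>" for x'
    using \<delta>(2)[of x' x] mean_dist_triangle[of x' x p] mean_dist_triangle[of x x' p]
      mean_dist_commute[of x x'] that x assms by (auto simp: abs_less_iff)
  then show "\<exists>d>0. \<forall>x'\<in>X. dist x' x < d \<longrightarrow> dist (L x' p) (L x p) < e"
    using \<delta>(1) by (auto simp: dist_real_def)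
qed

locale mean_equicontinuous_ergodic = mean_equicontinuous_system X T for X :: "'a::metric_space set" and T +
  fixes \<mu> :: "'a measure"
  assumes ergodic_\<mu>: "ergodic_measure X T \<mu>"
begin

lemma regular_\<mu>: "regular_borel_prob X \<mu>"
  using ergodic_\<mu> by (simp add: ergodic_measure_def invariant_measure_def)

lemma sets_\<mu>: "sets \<mu> = sets (restrict_space borel X)"
  using regular_\<mu> by (simp add: regular_borel_prob_def)

lemma space_\<mu>: "space \<mu> = X"
  using sets_eq_imp_space_eq[OF sets_\<mu>] by (simp add: space_restrict_space)

lemma continuous_measurable:
  fixes f :: "'a \<Rightarrow> 'b::topological_space"
  assumes "continuous_on X f"
  shows "f \<in> borel_measurable \<mu>"
  using borel_measurable_continuous_on_restrict[OF assms] measurable_cong_sets[OF sets_\<mu> refl] by blast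

end

sublocale mean_equicontinuous_ergodic \<subseteq> ergodic_system \<mu> T
proof -
  interpret prob_space \<mu> using regular_\<mu> by (simp add: regular_borel_prob_def)
  show "ergodic_system \<mu> T"
    using ergodic_\<mu> by unfold_locales (auto simp: ergodic_measure_def invariant_measure_def)
qed

text \<open>A cutoff depending on \<open>L\<close> alone inherits symmetry and invariance from it.
  The linear shape makes each section change by at most \<open>L x p\<close> when \<open>x\<close>
  moves to \<open>p\<close>.\<close>

definition mean_dist_kernel :: "('a::metric_space \<Rightarrow> 'a) \<Rightarrow> real \<Rightarrow> 'a \<Rightarrow> 'a \<Rightarrow> real" where
  "mean_dist_kernel T \<epsilon> x y = max 0 (\<epsilon> - mean_dist T x y)"

context mean_equicontinuous_ergodic
begin

text \<open>Measurability is wanted for the product sigma-algebra. So \<open>L\<close> is written as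
  an infimum over a countable dense set of sums of functions of one variable each; the infimum is
  approached by points \<open>p\<close> close to \<open>x\<close>.\<close>

lemma mean_dist_measurable: "case_prod L \<in> borel_measurable (\<mu> \<Otimes>\<^sub>M \<mu>)"
proof -
  obtain S where S: "S \<subseteq> X" "countable S" "\<And>x \<delta>. x \<in> X \<Longrightarrow> \<delta> > 0 \<Longrightarrow> \<exists>p\<in>S. dist x p < \<delta>"
    using countable_dense_subset by blast
  have Lp [measurable]: "(\<lambda>x. L x p) \<in> borel_measurable \<mu>" if "p \<in> S" for p
    using that S(1) by (intro continuous_measurable continuous_mean_dist) auto
  have "(\<lambda>z. INF p\<in>S. L (fst z) p + L (snd z) p) \<in> borel_measurable (\<mu> \<Otimes>\<^sub>M \<mu>)"
    using S(2) by (intro borel_measurable_cINF_real) measurable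
  moreover have "(INF p\<in>S. L x p + L y p) = L x y" if x: "x \<in> X" and y: "y \<in> X" for x y
  proof (rule antisym)
    have ne: "S \<noteq> {}" using S(3)[OF x, of 1] by auto
    show "L x y \<le> (INF p\<in>S. L x p + L y p)"
      using S(1) x y mean_dist_triangle[of x _ y] mean_dist_commute[of y] by (intro cINF_greatest[OF ne]) auto
    have bdd: "bdd_below ((\<lambda>p. L x p + L y p) ` S)"
      using S(1) x y mean_dist_nonneg by (intro bdd_belowI2[of _ 0] add_nonneg_nonneg) auto
    show "(INF p\<in>S. L x p + L y p) \<le> L x y"
    proof (rule field_le_epsilon)
      fix e :: real assume "e > 0"
      then have "e / 2 > 0" by simp
      then obtain \<delta> where \<delta>: "\<delta> > 0" "\<And>x y. x \<in> X \<Longrightarrow> y \<in> X \<Longrightarrow> dist x y < \<delta> \<Longrightarrow> L x y < e / 2"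
        using mean_dist_small by blast
      obtain p where p: "p \<in> S" "dist x p < \<delta>" using S(3)[OF x \<delta>(1)] by blast
      then have "p \<in> X" using S(1) by blast
      then have "L x p + L y p \<le> L x y + e"
        using \<delta>(2)[OF x _ p(2)] mean_dist_triangle[OF y x] mean_dist_commute[of x y] by fastforce
      then show "(INF p\<in>S. L x p + L y p) \<le> L x y + e" by (rule cINF_lower2[OF bdd p(1)])
    qed
  qed
  ultimately show ?thesis
    by (subst measurable_cong[where g = "\<lambda>z. INF p\<in>S. L (fst z) p + L (snd z) p"])
      (auto simp: space_pair_measure space_\<mu>)
qed

text \<open>Arzela-Ascoli: a diagonal subsequence converges on a countable dense set, and
  equicontinuity in terms of \<open>L\<close> carries the convergence to all of
  \<open>X\<close>.\<close>

lemma compact_invariant_kernel: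
  assumes \<epsilon>: "\<epsilon> > 0"
  shows "compact_invariant_kernel \<mu> T (mean_dist_kernel T \<epsilon>) \<epsilon>"
proof -
  interpret I: invariant_kernel \<mu> T "mean_dist_kernel T \<epsilon>" \<epsilon>
  proof unfold_locales
    show "(\<lambda>(x, y). mean_dist_kernel T \<epsilon> x y) \<in> borel_measurable (\<mu> \<Otimes>\<^sub>M \<mu>)"
    proof -
      note [measurable] = mean_dist_measurable
      have "(\<lambda>z. max 0 (\<epsilon> - case_prod L z)) \<in> borel_measurable (\<mu> \<Otimes>\<^sub>M \<mu>)" by measurable
      then show ?thesis by (simp add: mean_dist_kernel_def case_prod_unfold)
    qed
    show "\<bar>mean_dist_kernel T \<epsilon> x y\<bar> \<le> \<epsilon>" if "x \<in> space \<mu>" "y \<in> space \<mu>" for x y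
      using that \<epsilon> mean_dist_nonneg[of x y] by (auto simp: mean_dist_kernel_def space_\<mu>)
    show "mean_dist_kernel T \<epsilon> x y = mean_dist_kernel T \<epsilon> y x" for x y
      by (simp add: mean_dist_kernel_def mean_dist_commute[of x])
    show "mean_dist_kernel T \<epsilon> (T x) (T y) = mean_dist_kernel T \<epsilon> x y" if "x \<in> space \<mu>" "y \<in> space \<mu>" for x y
      using that by (simp add: mean_dist_kernel_def mean_dist_invariant space_\<mu>)
  qed
  show ?thesis
  proof (unfold_locales)
    fix f :: "nat \<Rightarrow> 'a \<Rightarrow> complex" and R assume f: "\<And>n. f n \<in> L2 \<mu>" and R: "\<And>n. L2_norm \<mu> (f n) \<le> R"
    have R0: "R \<ge> 0" using R[of 0] L2_norm_nonneg[of \<mu> "f 0"] by linarith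
    obtain S where S: "S \<subseteq> X" "countable S" "\<And>x \<delta>. x \<in> X \<Longrightarrow> \<delta> > 0 \<Longrightarrow> \<exists>p\<in>S. dist x p < \<delta>"
      using countable_dense_subset by blast
    have "norm (I.Op (f n) x) \<le> \<epsilon> * R" if "x \<in> S" for n x
    proof (rule order_trans)
      show "norm (I.Op (f n) x) \<le> \<epsilon> * L2_norm \<mu> (f n)"
        using S(1) that by (intro I.cmod_Op_le f) (auto simp: space_\<mu>)
      show "\<epsilon> * L2_norm \<mu> (f n) \<le> \<epsilon> * R" using R \<epsilon> by simp
    qed
    then obtain r where r: "strict_mono (r :: nat \<Rightarrow> nat)" "\<And>x. x \<in> S \<Longrightarrow> \<exists>l. (\<lambda>n. I.Op (f (r n)) x) \<longlonglongrightarrow> l"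
      using function_convergent_subsequence[OF S(2), of "\<lambda>n. I.Op (f n)" "\<epsilon> * R"] by blast
    have equi: "cmod (I.Op (f n) x - I.Op (f n) p) \<le> L x p * R" if x: "x \<in> X" and p: "p \<in> X" for n x p
    proof -
      let ?k = "mean_dist_kernel T \<epsilon>"
      have kx: "(\<lambda>y. complex_of_real (?k x y)) \<in> L2 \<mu>" and kp: "(\<lambda>y. complex_of_real (?k p y)) \<in> L2 \<mu>"
        using I.kernel_section_L2 x p by (auto simp: space_\<mu>)
      have "I.Op (f n) x - I.Op (f n) p = L2_inner \<mu> (f n) (\<lambda>y. complex_of_real (?k x y) - complex_of_real (?k p y))"
        unfolding I.Op_eq_inner by (rule L2_inner_diff_right[OF kx kp f, symmetric])
      then have "cmod (I.Op (f n) x - I.Op (f n) p) \<le>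
          L2_norm \<mu> (f n) * L2_norm \<mu> (\<lambda>y. complex_of_real (?k x y) - complex_of_real (?k p y))"
        using L2_Cauchy_Schwarz[OF f L2_diff[OF kx kp]] by simp
      also have "L2_norm \<mu> (\<lambda>y. complex_of_real (?k x y) - complex_of_real (?k p y)) \<le> L x p"
      proof (rule L2_norm_le_bound)
        show "(\<lambda>y. complex_of_real (?k x y) - complex_of_real (?k p y)) \<in> borel_measurable \<mu>"
          by (rule L2_measurable[OF L2_diff[OF kx kp]])
        have "\<bar>?k x y - ?k p y\<bar> \<le> L x p" if "y \<in> X" for y
          using mean_dist_triangle[of x p y] mean_dist_triangle[of p x y] mean_dist_commute[of p x]
            mean_dist_nonneg[of x p] x p that by (auto simp: mean_dist_kernel_def abs_le_iff max_def)
        then show "AE y in \<mu>. cmod (complex_of_real (?k x y) - complex_of_real (?k p y)) \<le> L x p"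
          by (intro AE_I2) (simp add: space_\<mu> flip: of_real_diff)
      qed (simp add: mean_dist_nonneg x p)
      then have "L2_norm \<mu> (f n) * L2_norm \<mu> (\<lambda>y. complex_of_real (?k x y) - complex_of_real (?k p y)) \<le> R * L x p"
        using R R0 by (intro mult_mono) (auto simp: L2_norm_nonneg)
      finally show ?thesis by (simp add: mult.commute)
    qed
    have "convergent (\<lambda>n. I.Op (f (r n)) x)" if "x \<in> space \<mu>" for x
    proof (rule Cauchy_convergent, rule CauchyI)
      have x: "x \<in> X" using that by (simp add: space_\<mu>)
      fix e :: real assume "e > 0"
      \<comment> \<open>Three terms of size \<open>e / 3\<close> are planned. The bound
        \<open>L x p * R\<close> supplies two of them, and \<open>R + 1\<close> keeps the quotient
        defined for \<open>R = 0\<close>.\<close>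
      then have "e / (3 * (R + 1)) > 0" using R0 by simp
      then obtain \<delta> where \<delta>: "\<delta> > 0" "\<And>x y. x \<in> X \<Longrightarrow> y \<in> X \<Longrightarrow> dist x y < \<delta> \<Longrightarrow> L x y < e / (3 * (R + 1))"
        using mean_dist_small by blast
      obtain p where p: "p \<in> S" "dist x p < \<delta>" using S(3)[OF x \<delta>(1)] by blast
      then have pX: "p \<in> X" using S(1) by blast
      have "L x p * R \<le> e / (3 * (R + 1)) * R"
        using \<delta>(2)[OF x pX p(2)] R0 by (intro mult_right_mono) auto
      also have "\<dots> < e / 3" using R0 \<open>e > 0\<close> by (simp add: field_simps)
      finally have small: "cmod (I.Op (f n) x - I.Op (f n) p) < e / 3" for n
        using equi[OF x pX, of n] by linarith
      have "Cauchy (\<lambda>n. I.Op (f (r n)) p)" using r(2)[OF p(1)] LIMSEQ_imp_Cauchy by blast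
      then obtain N where N: "\<And>m n. m \<ge> N \<Longrightarrow> n \<ge> N \<Longrightarrow> norm (I.Op (f (r m)) p - I.Op (f (r n)) p) < e / 3"
        using \<open>e > 0\<close> CauchyD[of "\<lambda>n. I.Op (f (r n)) p" "e / 3"] by auto
      have "norm (I.Op (f (r m)) x - I.Op (f (r n)) x) < e" if "m \<ge> N" "n \<ge> N" for m n
      proof -
        define a b c d where "a = I.Op (f (r m)) x" and "b = I.Op (f (r m)) p"
          and "c = I.Op (f (r n)) p" and "d = I.Op (f (r n)) x"
        have "norm (a - b) < e / 3" "norm (b - c) < e / 3" "norm (d - c) < e / 3"
          using small N[OF that] by (auto simp: a_def b_def c_def d_def)
        moreover have "norm (a - d) \<le> norm (a - b) + norm (b - c) + norm (d - c)"
          using norm_triangle_ineq[of "a - b" "b - c"] norm_triangle_ineq4[of "a - c" "d - c"] by simp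
        ultimately show ?thesis unfolding a_def d_def by linarith
      qed
      then show "\<exists>N. \<forall>m\<ge>N. \<forall>n\<ge>N. norm (I.Op (f (r m)) x - I.Op (f (r n)) x) < e" by blast
    qed
    then show "\<exists>r. strict_mono r \<and> (\<forall>x\<in>space \<mu>. convergent (\<lambda>n. I.Op (f (r n)) x))" using r(1) by blast
  qed
qed

text \<open>The integral is \<open>Op\<close> applied to the constant 1, hence invariant and by
  ergodicity constant. It is positive because some small ball has positive measure and the kernel is
  at least \<open>\<epsilon> / 2\<close> on pairs from it.\<close>

lemma kernel_integral_const:
  assumes \<epsilon>: "\<epsilon> > 0"
  obtains c :: real where "c > 0" "AE x in \<mu>. (\<integral>y. mean_dist_kernel T \<epsilon> x y \<partial>\<mu>) = c"
proof -
  interpret I: compact_invariant_kernel \<mu> T "mean_dist_kernel T \<epsilon>" \<epsilon>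
    by (rule compact_invariant_kernel[OF \<epsilon>])
  let ?k = "mean_dist_kernel T \<epsilon>"
  have one: "(\<lambda>x. 1) \<in> L2 \<mu>" by (intro L2_bounded[of _ 1]) auto
  have Op1: "I.Op (\<lambda>x. 1) x = complex_of_real (\<integral>y. ?k x y \<partial>\<mu>)" for x
    by (simp add: I.Op_def)
  obtain a where a: "AE x in \<mu>. I.Op (\<lambda>x. 1) x = a"
  proof (rule invariant_AE_const)
    show "I.Op (\<lambda>x. 1) \<in> borel_measurable \<mu>" by (rule L2_measurable[OF I.Op_L2[OF one]])
    show "AE x in \<mu>. I.Op (\<lambda>x. 1) (T x) = I.Op (\<lambda>x. 1) x"
      using I.Op_T[OF one] by (intro AE_I2) simp
  qed (rule that)
  define c where "c = Re a"
  have c: "AE x in \<mu>. (\<integral>y. ?k x y \<partial>\<mu>) = c"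
    using a by eventually_elim (auto simp: Op1 c_def)
  have "\<epsilon> / 2 > 0" using \<epsilon> by simp
  then obtain \<delta> where \<delta>: "\<delta> > 0" "\<And>x y. x \<in> X \<Longrightarrow> y \<in> X \<Longrightarrow> dist x y < \<delta> \<Longrightarrow> L x y < \<epsilon> / 2"
    using mean_dist_small by blast
  have "\<delta> / 2 > 0" using \<delta> by simp
  then obtain C where C: "C \<subseteq> X" "finite C" "X \<subseteq> (\<Union>c\<in>C. ball c (\<delta> / 2))"
    using finite_net by blast
  have ball_sets: "X \<inter> ball p (\<delta> / 2) \<in> sets \<mu>" for p
    unfolding sets_\<mu> sets_restrict_space by (rule imageI) simp
  have "\<exists>p\<in>C. prob (X \<inter> ball p (\<delta> / 2)) \<noteq> 0"
  proof (rule ccontr)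
    assume "\<not> ?thesis"
    then have "X \<inter> ball p (\<delta> / 2) \<in> null_sets \<mu>" if "p \<in> C" for p
      using that ball_sets[of p] by (auto simp: null_sets_def emeasure_eq_measure)
    then have "(\<Union>p\<in>C. X \<inter> ball p (\<delta> / 2)) \<in> null_sets \<mu>" using C(2) by (intro null_sets.finite_UN) auto
    moreover have "(\<Union>p\<in>C. X \<inter> ball p (\<delta> / 2)) = space \<mu>" using C(3) by (auto simp: space_\<mu>)
    ultimately show False using emeasure_space_1 by (simp add: null_sets_def)
  qed
  then obtain p where p: "prob (X \<inter> ball p (\<delta> / 2)) \<noteq> 0" by blast
  define Q where "Q = X \<inter> ball p (\<delta> / 2)"
  have Q: "Q \<in> sets \<mu>" "prob Q > 0" using ball_sets p by (auto simp: Q_def zero_less_measure_iff)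
  \<comment> \<open>The value \<open>c\<close> is attained only almost everywhere, so the point in
    the ball must be chosen where it is attained.\<close>
  have "\<exists>x\<in>Q. (\<integral>y. ?k x y \<partial>\<mu>) = c"
  proof (rule ccontr)
    assume "\<not> ?thesis"
    with c have "AE x in \<mu>. x \<notin> Q" by (auto elim!: eventually_mono)
    then have "Q \<in> null_sets \<mu>" using Q(1) AE_iff_null_sets by blast
    then show False using Q(2) by (simp add: null_sets_def emeasure_eq_measure)
  qed
  then obtain x where x: "x \<in> Q" "(\<integral>y. ?k x y \<partial>\<mu>) = c" by blast
  have xX: "x \<in> X" using x by (simp add: Q_def)
  have "(\<integral>y. \<epsilon> / 2 * indicator Q y \<partial>\<mu>) \<le> (\<integral>y. ?k x y \<partial>\<mu>)"
  proof (rule integral_mono)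
    show "integrable \<mu> (\<lambda>y. \<epsilon> / 2 * indicator Q y)" using Q(1) by (simp add: emeasure_eq_measure)
    show "integrable \<mu> (?k x)"
      using I.k_measurable'[of x] I.k_bound[of x] xX by (intro integrable_const_bound[of _ \<epsilon>] AE_I2) (auto simp: space_\<mu>)
    fix y
    have "\<epsilon> / 2 \<le> ?k x y" if "y \<in> Q"
    proof -
      have "dist x y < \<delta>" using that x(1) dist_triangle_half_r[of p x \<delta> y] by (auto simp: Q_def)
      moreover have "y \<in> X" using that by (simp add: Q_def)
      ultimately have "L x y < \<epsilon> / 2" using \<delta>(2)[OF xX] by blast
      then show ?thesis by (simp add: mean_dist_kernel_def max_def)
    qed
    then show "\<epsilon> / 2 * indicator Q y \<le> ?k x y"
      by (cases "y \<in> Q") (auto simp: mean_dist_kernel_def)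
  qed
  then have "c \<ge> \<epsilon> / 2 * prob Q" using x(2) Q(1) by (simp add: sets.Int_space_eq2)
  then have "c > 0" using \<epsilon> Q(2) mult_pos_pos[of "\<epsilon> / 2" "prob Q"] by linarith
  then show thesis using that c by blast
qed

end

section \<open>Discrete spectrum\<close>

context mean_equicontinuous_ergodic
begin

text \<open>The kernel and the product measure are invariant, so \<open>\<bar>f x - f y\<bar>\<close> may be replaced by its
  orbit average, which is small wherever the kernel does not vanish.\<close>

lemma kernel_oscillation_le:
  fixes f :: "'a \<Rightarrow> complex"
  assumes \<epsilon>: "\<epsilon> > 0" and f: "f \<in> borel_measurable \<mu>"
    and lip: "\<And>x y. x \<in> X \<Longrightarrow> y \<in> X \<Longrightarrow> cmod (f y - f x) \<le> C * dist x y" and C: "C \<ge> 0"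
    and c: "AE x in \<mu>. (\<integral>y. mean_dist_kernel T \<epsilon> x y \<partial>\<mu>) = c"
  shows "(\<integral>x. (\<integral>y. mean_dist_kernel T \<epsilon> x y * cmod (f y - f x) \<partial>\<mu>) \<partial>\<mu>) \<le> 3 * \<epsilon> * C * c"
proof -
  interpret I: compact_invariant_kernel \<mu> T "mean_dist_kernel T \<epsilon>" \<epsilon>
    by (rule compact_invariant_kernel[OF \<epsilon>])
  interpret P: pair_prob_space \<mu> \<mu> ..
  let ?k = "mean_dist_kernel T \<epsilon>"
  define N where "N = \<mu> \<Otimes>\<^sub>M \<mu>"
  interpret N: prob_space N unfolding N_def by (rule P.prob_space_axioms)
  have space_N: "space N = X \<times> X" by (simp add: N_def space_pair_measure space_\<mu>)
  have k_meas: "case_prod ?k \<in> borel_measurable N" unfolding N_def by (rule I.k_measurable)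
  have T_meas: "(T ^^ i) \<in> measurable \<mu> \<mu>" for i by (rule measurable_compose_n[OF T_measurable])
  define G where "G i z = (case z of (x, y) \<Rightarrow> ?k x y * cmod (f ((T ^^ i) y) - f ((T ^^ i) x)))" for i z
  have G_meas: "G i \<in> borel_measurable N" for i
  proof -
    note [measurable] = k_meas f T_meas[of i]
    have [measurable]: "fst \<in> measurable N \<mu>" "snd \<in> measurable N \<mu>" unfolding N_def by auto
    have "(\<lambda>z. case_prod ?k z * cmod (f ((T ^^ i) (snd z)) - f ((T ^^ i) (fst z)))) \<in> borel_measurable N"
      by measurable
    then show ?thesis by (simp add: G_def[abs_def] case_prod_unfold)
  qed
  have k_nonneg: "0 \<le> ?k x y" for x y by (simp add: mean_dist_kernel_def)
  have k_le: "?k x y \<le> \<epsilon>" if "x \<in> X" "y \<in> X" for x y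
    using I.k_bound[of x y] that by (simp add: space_\<mu>)
  have lip': "cmod (f y - f x) \<le> C * diam_bound" if "x \<in> X" "y \<in> X" for x y
    using lip[OF that] mult_left_mono[OF dist_le_diam_bound[OF that] C] by linarith
  have G_bound: "norm (G i z) \<le> \<epsilon> * (C * diam_bound)" if z: "z \<in> space N" for i z
  proof -
    obtain x y where xy: "z = (x, y)" "x \<in> X" "y \<in> X" using z space_N by auto
    have "?k x y * cmod (f ((T ^^ i) y) - f ((T ^^ i) x)) \<le> \<epsilon> * (C * diam_bound)"
      using xy \<epsilon> by (intro mult_mono k_le lip' funpow_closed) auto
    then show ?thesis using xy(1) k_nonneg by (simp add: G_def abs_mult)
  qed
  have G_int: "integrable N (G i)" for i
    using G_bound by (intro N.integrable_const_bound[OF _ G_meas] AE_I2)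
  have k_int: "integrable N (case_prod ?k)"
    using k_le k_nonneg by (intro N.integrable_const_bound[OF _ k_meas, of \<epsilon>] AE_I2) (auto simp: space_N)
  have iter: "(\<integral>x. (\<integral>y. H (x, y) \<partial>\<mu>) \<partial>\<mu>) = (\<integral>z. H z \<partial>N)" if "integrable N H" for H :: "'a \<times> 'a \<Rightarrow> real"
    using P.integral_fst'[of H] that unfolding N_def .
  \<comment> \<open>Invariance of the product measure is used one variable at a time, through the
    iterated integral.\<close>
  have step: "(\<integral>z. G (Suc i) z \<partial>N) = (\<integral>z. G i z \<partial>N)" for i
  proof -
    define g where "g x = (\<integral>y. G i (x, y) \<partial>\<mu>)" for x
    have sec: "(\<lambda>y. G i (x, y)) \<in> borel_measurable \<mu>" if "x \<in> space \<mu>" for x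
      using measurable_compose[OF measurable_Pair1'[OF that, of \<mu>]] G_meas[of i] by (simp add: N_def)
    have g_meas: "g \<in> borel_measurable \<mu>"
      unfolding g_def[abs_def] using G_meas[of i]
      by (intro borel_measurable_lebesgue_integral) (simp add: N_def)
    have "(\<integral>z. G i z \<partial>N) = (\<integral>x. g x \<partial>\<mu>)" unfolding g_def by (rule iter[OF G_int, symmetric])
    also have "\<dots> = (\<integral>x. g (T x) \<partial>\<mu>)" by (rule integral_T[OF g_meas, symmetric])
    also have "\<dots> = (\<integral>x. (\<integral>y. G (Suc i) (x, y) \<partial>\<mu>) \<partial>\<mu>)"
    proof (rule Bochner_Integration.integral_cong[OF refl])
      fix x assume x: "x \<in> space \<mu>"
      have "g (T x) = (\<integral>y. G i (T x, T y) \<partial>\<mu>)"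
        unfolding g_def by (rule integral_T[OF sec[OF T_space[OF x]], symmetric])
      also have "\<dots> = (\<integral>y. G (Suc i) (x, y) \<partial>\<mu>)"
        using x by (intro Bochner_Integration.integral_cong refl) (simp add: G_def I.k_invariant funpow_swap1)
      finally show "g (T x) = (\<integral>y. G (Suc i) (x, y) \<partial>\<mu>)" .
    qed
    also have "\<dots> = (\<integral>z. G (Suc i) z \<partial>N)" by (rule iter[OF G_int])
    finally show ?thesis by simp
  qed
  have G_eq: "(\<integral>z. G i z \<partial>N) = (\<integral>z. G 0 z \<partial>N)" for i by (induction i) (simp_all add: step)
  obtain n0 where n0: "\<And>x y n. x \<in> X \<Longrightarrow> y \<in> X \<Longrightarrow> L x y \<le> \<epsilon> \<Longrightarrow> n0 \<le> n \<Longrightarrow> orbit_dist T n x y \<le> 3 * \<epsilon> * real n"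
    using uniform_mean_dist[OF \<epsilon>] by blast
  \<comment> \<open>The successor ensures that \<open>n\<close> is positive and can be cancelled at
    the end.\<close>
  define n where "n = Suc n0"
  have "real n * (\<integral>z. G 0 z \<partial>N) = (\<Sum>i<n. (\<integral>z. G 0 z \<partial>N))" by simp
  also have "\<dots> = (\<Sum>i<n. (\<integral>z. G i z \<partial>N))" by (intro sum.cong refl G_eq[symmetric])
  also have "\<dots> = (\<integral>z. (\<Sum>i<n. G i z) \<partial>N)" by (rule Bochner_Integration.integral_sum[symmetric]) (rule G_int)
  also have "\<dots> \<le> (\<integral>z. (3 * \<epsilon> * C * real n) * case_prod ?k z \<partial>N)"
  proof (rule integral_mono)
    show "integrable N (\<lambda>z. \<Sum>i<n. G i z)" by (intro Bochner_Integration.integrable_sum G_int)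
    show "integrable N (\<lambda>z. (3 * \<epsilon> * C * real n) * case_prod ?k z)" by (intro integrable_mult_right k_int)
    fix z assume "z \<in> space N"
    then obtain x y where xy: "z = (x, y)" "x \<in> X" "y \<in> X" using space_N by auto
    have "(\<Sum>i<n. G i z) = ?k x y * (\<Sum>i<n. cmod (f ((T ^^ i) y) - f ((T ^^ i) x)))"
      by (simp add: G_def xy sum_distrib_left)
    also have "\<dots> \<le> ?k x y * (3 * \<epsilon> * C * real n)"
    proof (cases "L x y \<le> \<epsilon>")
      case True
      have "(\<Sum>i<n. cmod (f ((T ^^ i) y) - f ((T ^^ i) x))) \<le> C * orbit_dist T n x y"
        unfolding orbit_dist_def sum_distrib_left using xy by (intro sum_mono lip funpow_closed)
      also have "\<dots> \<le> C * (3 * \<epsilon> * real n)" using xy True C by (intro mult_left_mono n0) (auto simp: n_def)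
      finally show ?thesis using k_nonneg[of x y] by (intro mult_left_mono) (auto simp: mult_ac)
    qed (simp add: mean_dist_kernel_def)
    finally show "(\<Sum>i<n. G i z) \<le> (3 * \<epsilon> * C * real n) * case_prod ?k z" using xy by (simp add: mult_ac)
  qed
  also have "\<dots> = 3 * \<epsilon> * C * real n * (\<integral>z. case_prod ?k z \<partial>N)" by simp
  also have "(\<integral>z. case_prod ?k z \<partial>N) = c"
  proof -
    have "(\<integral>z. case_prod ?k z \<partial>N) = (\<integral>x. (\<integral>y. ?k x y \<partial>\<mu>) \<partial>\<mu>)" using iter[OF k_int] by simp
    also have "\<dots> = (\<integral>x. c \<partial>\<mu>)"
    proof (rule integral_cong_AE)
      show "(\<lambda>x. \<integral>y. ?k x y \<partial>\<mu>) \<in> borel_measurable \<mu>"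
        using k_meas unfolding N_def by (rule borel_measurable_lebesgue_integral)
    qed (use c in auto)
    finally show ?thesis by (simp add: prob_space)
  qed
  finally have "real n * (\<integral>z. G 0 z \<partial>N) \<le> real n * (3 * \<epsilon> * C * c)" by (simp add: mult_ac)
  then have "(\<integral>z. G 0 z \<partial>N) \<le> 3 * \<epsilon> * C * c" by (simp add: n_def)
  then show ?thesis using iter[OF G_int, of 0] by (simp add: G_def)
qed

text \<open>The approximant is \<open>Op f / c\<close>, a kernel average of \<open>f\<close>. Its
  error at \<open>x\<close> is at most \<open>w x / c\<close>, where \<open>w\<close> averages the
  oscillation of \<open>f\<close>. The sup bound of \<open>w\<close> and the bound of its integral
  each carry a factor \<open>c\<close>, so \<open>c\<close> disappears and the squared error is of
  order \<open>\<epsilon>\<close>.\<close>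

lemma Lipschitz_in_span_closure:
  fixes f :: "'a \<Rightarrow> complex"
  assumes f: "f \<in> borel_measurable \<mu>" and C: "C \<ge> 0"
    and lip: "\<And>x y. x \<in> X \<Longrightarrow> y \<in> X \<Longrightarrow> cmod (f y - f x) \<le> C * dist x y"
  shows "f \<in> L2_span_closure \<mu> eigen_basis"
proof -
  obtain x0 where x0: "x0 \<in> X" using not_empty space_\<mu> by auto
  have "cmod (f x) \<le> cmod (f x0) + C * diam_bound" if "x \<in> X" for x
    using lip[OF x0 that] mult_left_mono[OF dist_le_diam_bound[OF x0 that] C] norm_triangle_sub[of "f x" "f x0"] by linarith
  then have f2: "f \<in> L2 \<mu>" by (intro L2_bounded[OF f, of "cmod (f x0) + C * diam_bound"] AE_I2) (simp add: space_\<mu>)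
  have lip': "cmod (f y - f x) \<le> C * diam_bound" if "x \<in> X" "y \<in> X" for x y
    using lip[OF that] mult_left_mono[OF dist_le_diam_bound[OF that] C] by linarith
  have approx: "\<exists>g\<in>L2_span_closure \<mu> eigen_basis. (L2_norm \<mu> (\<lambda>x. f x - g x))\<^sup>2 \<le> 3 * \<epsilon> * C * (C * diam_bound)"
    if \<epsilon>: "\<epsilon> > 0" for \<epsilon>
  proof -
    interpret I: compact_invariant_kernel \<mu> T "mean_dist_kernel T \<epsilon>" \<epsilon>
      by (rule compact_invariant_kernel[OF \<epsilon>])
    let ?k = "mean_dist_kernel T \<epsilon>"
    obtain c where c: "c > 0" "AE x in \<mu>. (\<integral>y. ?k x y \<partial>\<mu>) = c" using kernel_integral_const[OF \<epsilon>] by blast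
    define g where "g x = complex_of_real (1 / c) * I.Op f x" for x
    define w where "w x = (\<integral>y. ?k x y * cmod (f y - f x) \<partial>\<mu>)" for x
    have g: "g \<in> L2_span_closure \<mu> eigen_basis"
      unfolding g_def[abs_def] by (intro L2_span_closure_scale eigen_basis_L2 I.Op_in_span_closure f2)
    then have g2: "g \<in> L2 \<mu>" by (simp add: L2_span_closure_def)
    have k_nonneg: "0 \<le> ?k x y" for x y by (simp add: mean_dist_kernel_def)
    have k_int: "integrable \<mu> (?k x)" if "x \<in> space \<mu>" for x
      using I.k_measurable'[OF that] I.k_bound[OF that] by (intro integrable_const_bound[of _ \<epsilon>] AE_I2) auto
    have w_meas: "w \<in> borel_measurable \<mu>"
    proof -
      note [measurable] = I.k_measurable f
      have "(\<lambda>z. case_prod ?k z * cmod (f (snd z) - f (fst z))) \<in> borel_measurable (\<mu> \<Otimes>\<^sub>M \<mu>)" by measurable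
      then have "(\<lambda>(x, y). ?k x y * cmod (f y - f x)) \<in> borel_measurable (\<mu> \<Otimes>\<^sub>M \<mu>)" by (simp add: case_prod_unfold)
      then show ?thesis unfolding w_def[abs_def] by (rule borel_measurable_lebesgue_integral)
    qed
    have w_nonneg: "0 \<le> w x" for x unfolding w_def using k_nonneg by (intro integral_nonneg_AE AE_I2) simp
    have w_bound: "AE x in \<mu>. w x \<le> C * diam_bound * c"
      using c(2) AE_space
    proof eventually_elim
      case (elim x)
      have "w x \<le> (\<integral>y. (C * diam_bound) * ?k x y \<partial>\<mu>)" unfolding w_def
      proof (rule integral_mono')
        show "integrable \<mu> (\<lambda>y. (C * diam_bound) * ?k x y)" using k_int[OF elim(2)] by simp
        show "?k x y * cmod (f y - f x) \<le> (C * diam_bound) * ?k x y" if "y \<in> space \<mu>" for y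
          using mult_left_mono[OF lip'[of x y] k_nonneg[of x y]] that elim(2) by (simp add: space_\<mu> mult.commute)
        show "0 \<le> (C * diam_bound) * ?k x y" for y using C diam_bound_pos k_nonneg by simp
      qed
      then show ?case using elim(1) by simp
    qed
    \<comment> \<open>Of the two factors \<open>w x / c\<close>, one is bounded by
      \<open>C * diam_bound\<close> and the other is kept for integration.\<close>
    have diff: "AE x in \<mu>. (cmod (f x - g x))\<^sup>2 \<le> C * diam_bound / c * w x"
      using c(2) w_bound AE_space
    proof eventually_elim
      case (elim x)
      note x = elim(3)
      have int1: "integrable \<mu> (\<lambda>y. complex_of_real (?k x y) * f y)"
        using L2_integrable_mult[OF f2 I.kernel_section_L2[OF x]] by (simp add: mult.commute)
      have int2: "integrable \<mu> (\<lambda>y. complex_of_real (?k x y) * f x)" using k_int[OF x] by simp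
      have "complex_of_real c * f x = (\<integral>y. complex_of_real (?k x y) * f x \<partial>\<mu>)" using elim(1) by simp
      then have "I.Op f x - complex_of_real c * f x = (\<integral>y. complex_of_real (?k x y) * (f y - f x) \<partial>\<mu>)"
        unfolding I.Op_def using int1 int2 by (simp add: right_diff_distrib)
      then have "cmod (I.Op f x - complex_of_real c * f x) \<le> (\<integral>y. cmod (complex_of_real (?k x y) * (f y - f x)) \<partial>\<mu>)"
        by (simp only: integral_norm_bound)
      also have "\<dots> = w x" using k_nonneg by (simp add: w_def norm_mult)
      finally have "cmod (I.Op f x - complex_of_real c * f x) \<le> w x" .
      moreover have "f x - g x = - (I.Op f x - complex_of_real c * f x) / complex_of_real c"
        using c(1) by (simp add: g_def field_simps)
      ultimately have "cmod (f x - g x) \<le> w x / c" using c(1) by (simp add: norm_divide norm_minus_commute divide_right_mono)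
      then have "(cmod (f x - g x))\<^sup>2 \<le> (w x / c) * (w x / c)"
        unfolding power2_eq_square by (intro mult_mono) (use w_nonneg[of x] c(1) in auto)
      also have "\<dots> \<le> (C * diam_bound) * (w x / c)"
        using elim(2) c(1) w_nonneg[of x] by (intro mult_right_mono) (auto simp: field_simps)
      finally show ?case by simp
    qed
    have w_int: "integrable \<mu> w"
      using w_bound w_nonneg by (intro integrable_const_bound[OF _ w_meas, of "C * diam_bound * c"]) (auto elim: eventually_mono)
    have "(L2_norm \<mu> (\<lambda>x. f x - g x))\<^sup>2 \<le> (\<integral>x. C * diam_bound / c * w x \<partial>\<mu>)"
      unfolding L2_norm_power2 using L2_integrable[OF L2_diff[OF f2 g2]] w_int diff by (intro integral_mono_AE) auto
    also have "\<dots> = C * diam_bound / c * (\<integral>x. w x \<partial>\<mu>)" by simp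
    also have "\<dots> \<le> C * diam_bound / c * (3 * \<epsilon> * C * c)"
      unfolding w_def using kernel_oscillation_le[OF \<epsilon> f lip C c(2)] C diam_bound_pos c(1) by (intro mult_left_mono) auto
    also have "\<dots> = 3 * \<epsilon> * C * (C * diam_bound)" using c(1) by simp
    finally show ?thesis using g by blast
  qed
  show ?thesis
  proof (rule L2_span_closure_limit[OF eigen_basis_L2 f2])
    fix e :: real assume e: "e > 0"
    \<comment> \<open>This makes the error bound smaller than \<open>e\<^sup>2\<close>; the summand
      1 covers \<open>C = 0\<close>.\<close>
    define \<epsilon> where "\<epsilon> = e\<^sup>2 / (3 * C * (C * diam_bound) + 1)"
    have pos: "3 * C * (C * diam_bound) + 1 > 0" using C diam_bound_pos by (simp add: add_nonneg_pos)
    have \<epsilon>: "\<epsilon> > 0" using e pos by (simp add: \<epsilon>_def)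
    then obtain g where g: "g \<in> L2_span_closure \<mu> eigen_basis" "(L2_norm \<mu> (\<lambda>x. f x - g x))\<^sup>2 \<le> 3 * \<epsilon> * C * (C * diam_bound)"
      using approx by blast
    have "3 * \<epsilon> * C * (C * diam_bound) < \<epsilon> * (3 * C * (C * diam_bound) + 1)" using \<epsilon> by (simp add: algebra_simps)
    also have "\<dots> = e\<^sup>2" using pos by (simp add: \<epsilon>_def)
    finally have "(L2_norm \<mu> (\<lambda>x. f x - g x))\<^sup>2 < e\<^sup>2" using g(2) by linarith
    then have "L2_norm \<mu> (\<lambda>x. f x - g x) < e" using e by (intro power2_less_imp_less[of _ e]) auto
    then show "\<exists>g\<in>L2_span_closure \<mu> eigen_basis. L2_norm \<mu> (\<lambda>x. f x - g x) < e" using g(1) by blast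
  qed
qed

section \<open>From Lipschitz functions to all square-integrable functions\<close>

lemma span_closure_limit:
  assumes "\<And>n. f n \<in> L2_span_closure \<mu> eigen_basis" "g \<in> L2 \<mu>" "(\<lambda>n. L2_norm \<mu> (\<lambda>x. f n x - g x)) \<longlonglongrightarrow> 0"
  shows "g \<in> L2_span_closure \<mu> eigen_basis"
proof (rule L2_span_closure_limit[OF eigen_basis_L2 assms(2)])
  fix e :: real assume "e > 0"
  then obtain n where "L2_norm \<mu> (\<lambda>x. f n x - g x) < e"
    using LIMSEQ_D[OF assms(3), of e] by (auto simp: L2_norm_nonneg)
  then show "\<exists>h\<in>L2_span_closure \<mu> eigen_basis. L2_norm \<mu> (\<lambda>x. g x - h x) < e"
    using assms(1)[of n] by (intro bexI[of _ "f n"]) (simp add: L2_norm_minus_commute[of \<mu> g])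
qed

lemma indicator_compact_in_span_closure:
  assumes Q: "compact Q" "Q \<subseteq> X"
  shows "(\<lambda>x. indicator Q x :: complex) \<in> L2_span_closure \<mu> eigen_basis"
\<comment> \<open>\<open>infdist\<close> to the empty set is 0 by convention, so the functions below
  would be constantly 1 in that case.\<close>
proof (cases "Q = {}")
  case True
  then show ?thesis using L2_span_closure_lincomb[OF eigen_basis_L2, of "{}"] by simp
next
  case False
  \<comment> \<open>Lipschitz with constant \<open>n\<close>, equal to 1 on \<open>Q\<close> and 0
    at distance \<open>1 / n\<close> or more, so the limit is the indicator of the closed set
    \<open>Q\<close>.\<close>
  define \<phi> where "\<phi> n x = complex_of_real (max 0 (1 - real n * infdist x Q))" for n :: nat and x
  have closed: "closed Q" using Q(1) by (rule compact_imp_closed)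
  have cont: "continuous_on X (\<phi> n)" for n unfolding \<phi>_def[abs_def] by (intro continuous_intros)
  have meas: "\<phi> n \<in> borel_measurable \<mu>" for n by (rule continuous_measurable[OF cont])
  have \<phi>_in: "\<phi> n \<in> L2_span_closure \<mu> eigen_basis" for n
  proof (rule Lipschitz_in_span_closure[OF meas, of "real n"])
    fix x y
    have "\<bar>real n * infdist x Q - real n * infdist y Q\<bar> \<le> real n * dist x y"
      using mult_left_mono[OF infdist_triangle_abs[of x Q y], of "real n"] by (simp add: abs_mult flip: right_diff_distrib)
    then have "\<bar>max 0 (1 - real n * infdist y Q) - max 0 (1 - real n * infdist x Q)\<bar> \<le> real n * dist x y"
      by linarith
    then show "cmod (\<phi> n y - \<phi> n x) \<le> real n * dist x y"
      unfolding \<phi>_def of_real_diff[symmetric] norm_of_real .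
  qed simp
  have ind: "(\<lambda>x. indicator Q x :: complex) \<in> borel_measurable \<mu>"
    using closed Q(2) by (intro borel_measurable_indicator) (auto simp: sets_\<mu> sets_restrict_space intro!: image_eqI[of _ _ Q])
  have lim: "(\<lambda>n. \<phi> n x) \<longlonglongrightarrow> indicator Q x" for x
  proof (cases "x \<in> Q")
    case True
    then show ?thesis by (simp add: \<phi>_def)
  next
    case notin: False
    then have pos: "infdist x Q > 0" by (rule infdist_pos_not_in_closed[OF closed False])
    obtain n where n: "real n > 1 / infdist x Q" using reals_Archimedean2 by blast
    have "\<phi> m x = 0" if "m \<ge> n" for m
    proof -
      have "real m > 1 / infdist x Q" using n that by linarith
      then have "1 - real m * infdist x Q \<le> 0" using pos by (simp add: field_simps)
      then show ?thesis by (simp add: \<phi>_def)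
    qed
    then have "\<forall>\<^sub>F m in sequentially. \<phi> m x = indicator Q x"
      using notin by (auto intro: eventually_sequentiallyI[of n])
    then show ?thesis by (rule tendsto_eventually)
  qed
  have bd: "AE x in \<mu>. cmod (\<phi> n x) \<le> 1" for n
    by (intro AE_I2) (auto simp: \<phi>_def infdist_nonneg)
  have lim_AE: "AE x in \<mu>. (\<lambda>n. \<phi> n x) \<longlonglongrightarrow> indicator Q x" using lim by (rule AE_I2)
  note dct = L2_dominated_convergence[where w = "\<lambda>_. 1", OF meas ind _ _ bd lim_AE]
  show ?thesis by (rule span_closure_limit[OF \<phi>_in dct]) auto
qed

text \<open>Inner regularity reduces to compact sets: the squared distance of two nested indicators
  is the measure of the difference.\<close>

lemma indicator_in_span_closure:
  assumes A: "A \<in> sets \<mu>"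
  shows "(\<lambda>x. indicator A x :: complex) \<in> L2_span_closure \<mu> eigen_basis"
proof (rule L2_span_closure_limit[OF eigen_basis_L2])
  have L2_ind: "(\<lambda>x. indicator A x :: complex) \<in> L2 \<mu>" if "A \<in> sets \<mu>" for A
    using that by (intro L2_bounded[of _ 1] AE_I2) (auto simp: indicator_def)
  then show "(\<lambda>x. indicator A x :: complex) \<in> L2 \<mu>" using A .
  fix e :: real assume e: "e > 0"
  have "\<exists>Q. compact Q \<and> Q \<subseteq> A \<and> prob A - e\<^sup>2 < prob Q"
  \<comment> \<open>For a null set \<open>ennreal (prob A - e\<^sup>2)\<close> is truncated to 0 and
    the strict inequality used below would fail; the empty set then serves.\<close>
  proof (cases "prob A = 0")
    case True
    then show ?thesis using e by (intro exI[of _ "{}"]) simp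
  next
    case False
    then have "ennreal (prob A - e\<^sup>2) < emeasure \<mu> A"
      using e by (simp add: emeasure_eq_measure ennreal_lessI zero_less_measure_iff)
    also have "emeasure \<mu> A = (SUP Q\<in>{Q. compact Q \<and> Q \<subseteq> A}. emeasure \<mu> Q)"
      using regular_\<mu> A by (simp add: regular_borel_prob_def)
    finally obtain Q where Q: "compact Q" "Q \<subseteq> A" "ennreal (prob A - e\<^sup>2) < emeasure \<mu> Q"
      by (auto simp: less_SUP_iff)
    moreover have "prob A - e\<^sup>2 < prob Q"
    proof (rule ccontr)
      assume "\<not> prob A - e\<^sup>2 < prob Q"
      then have "emeasure \<mu> Q \<le> ennreal (prob A - e\<^sup>2)" by (simp add: emeasure_eq_measure ennreal_leI)
      with Q(3) show False by (simp add: not_le[symmetric])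
    qed
    ultimately show ?thesis by blast
  qed
  then obtain Q where Q: "compact Q" "Q \<subseteq> A" "prob A - e\<^sup>2 < prob Q" by blast
  have QX: "Q \<subseteq> X" using Q(2) sets.sets_into_space[OF A] space_\<mu> by blast
  have Qs: "Q \<in> sets \<mu>"
    using QX compact_imp_closed[OF Q(1)] by (auto simp: sets_\<mu> sets_restrict_space intro!: image_eqI[of _ _ Q])
  have "(cmod (indicator A x - indicator Q x))\<^sup>2 = indicator (A - Q) x" for x
    using Q(2) by (auto simp: indicator_def)
  then have "(L2_norm \<mu> (\<lambda>x. indicator A x - indicator Q x))\<^sup>2 = prob (A - Q)"
    using A Qs unfolding L2_norm_power2 by (simp add: sets.Int_space_eq2)
  also have "\<dots> = prob A - prob Q" by (rule finite_measure_Diff[OF A Qs Q(2)])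
  also have "\<dots> < e\<^sup>2" using Q(3) by linarith
  finally have "L2_norm \<mu> (\<lambda>x. indicator A x - indicator Q x) < e" using e by (intro power2_less_imp_less[of _ e]) auto
  then show "\<exists>g\<in>L2_span_closure \<mu> eigen_basis. L2_norm \<mu> (\<lambda>x. indicator A x - g x) < e"
    using indicator_compact_in_span_closure[OF Q(1) QX] by (rule bexI)
qed

lemma simple_in_span_closure:
  fixes s :: "'a \<Rightarrow> complex"
  assumes s: "simple_function \<mu> s"
  shows "s \<in> L2_span_closure \<mu> eigen_basis"
proof -
  define R where "R = s ` space \<mu>"
  have fin: "finite R" using s by (simp add: R_def simple_function_def)
  have sets: "s -` {a} \<inter> space \<mu> \<in> sets \<mu>" for a using simple_functionD(2)[OF s] .
  have sum: "(\<lambda>x. \<Sum>a\<in>F. a * indicator (s -` {a} \<inter> space \<mu>) x) \<in> L2_span_closure \<mu> eigen_basis" if "finite F" for F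
    using that
  proof (induction F)
    case empty
    then show ?case using L2_span_closure_lincomb[OF eigen_basis_L2, of "{}"] by simp
  next
    case (insert a F)
    have "(\<lambda>x. a * indicator (s -` {a} \<inter> space \<mu>) x + (\<Sum>a\<in>F. a * indicator (s -` {a} \<inter> space \<mu>) x))
        \<in> L2_span_closure \<mu> eigen_basis"
      by (intro L2_span_closure_add L2_span_closure_scale eigen_basis_L2 indicator_in_span_closure sets insert.IH)
    then show ?case by (simp only: sum.insert[OF insert.hyps])
  qed
  have "(\<Sum>a\<in>R. a * indicator (s -` {a} \<inter> space \<mu>) x) = s x" if "x \<in> space \<mu>" for x
  proof -
    have "(\<Sum>a\<in>R. a * indicator (s -` {a} \<inter> space \<mu>) x) = (\<Sum>a\<in>R. if a = s x then a else 0)"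
      using that by (intro sum.cong) (auto simp: indicator_def)
    then show ?thesis using fin that by (simp add: R_def)
  qed
  then have AE: "AE x in \<mu>. (\<Sum>a\<in>R. a * indicator (s -` {a} \<inter> space \<mu>) x) = s x" by (intro AE_I2)
  have "s \<in> L2 \<mu>"
  proof (rule L2_bounded[of _ "Max (cmod ` R)"])
    show "s \<in> borel_measurable \<mu>" by (rule borel_measurable_simple_function[OF s])
    show "AE x in \<mu>. cmod (s x) \<le> Max (cmod ` R)" using fin by (intro AE_I2 Max_ge) (auto simp: R_def)
  qed
  from L2_span_closure_cong_AE[OF eigen_basis_L2 sum[OF fin] this AE] show ?thesis .
qed

text \<open>Simple functions dominated by \<open>2 * cmod (f x)\<close> converge to \<open>f\<close>
  pointwise, hence in norm, and the closed span contains all of them.\<close>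

lemma L2_in_span_closure:
  assumes f: "f \<in> L2 \<mu>"
  shows "f \<in> L2_span_closure \<mu> eigen_basis"
proof -
  obtain s where s: "\<And>i. simple_function \<mu> (s i)" "\<And>x. x \<in> space \<mu> \<Longrightarrow> (\<lambda>i. s i x) \<longlonglongrightarrow> f x"
    "\<And>i x. x \<in> space \<mu> \<Longrightarrow> dist (s i x) 0 \<le> 2 * dist (f x) 0"
    using borel_measurable_implies_sequence_metric[OF L2_measurable[OF f], of 0] by blast
  note [measurable] = L2_measurable[OF f]
  have "(\<lambda>n. L2_norm \<mu> (\<lambda>x. s n x - f x)) \<longlonglongrightarrow> 0"
  proof (rule L2_dominated_convergence(2)[where w = "\<lambda>x. 2 * cmod (f x)"])
    show "s n \<in> borel_measurable \<mu>" for n by (rule borel_measurable_simple_function[OF s(1)])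
    show "integrable \<mu> (\<lambda>x. (2 * cmod (f x))\<^sup>2)" using L2_integrable[OF f] by (simp add: power_mult_distrib)
  qed (use s in \<open>auto intro!: AE_I2\<close>)
  from span_closure_limit[OF simple_in_span_closure[OF s(1)] f this] show ?thesis .
qed

theorem discrete_spectrum: "discrete_spectrum T \<mu>"
  unfolding discrete_spectrum_def
proof (rule exI[of _ eigen_basis], intro conjI ballI)
  show "orthonormal_basis_L2 \<mu> eigen_basis"
    unfolding orthonormal_basis_L2_def
    using eigen_basis_L2 eigen_basis_orthonormal L2_in_span_closure by (auto simp: L2_span_closure_def)
  fix b assume "b \<in> eigen_basis"
  then show "\<exists>\<zeta>. eigenfunction T \<mu> \<zeta> b" by (auto elim: eigen_basisE)
qed

end

theorem theorem3p8:
  fixes X :: "'a::metric_space set" and T :: "'a \<Rightarrow> 'a"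
  assumes "dynamical_system X T"
    and "mean_equicontinuous X T"
  shows "(\<forall>\<mu>. ergodic_measure X T \<mu> \<longrightarrow> discrete_spectrum T \<mu>) \<and> topological_entropy X T = 0"
proof -
  interpret mean_equicontinuous_system X T by unfold_locales (rule assms)+
  have "discrete_spectrum T \<mu>" if "ergodic_measure X T \<mu>" for \<mu>
  proof -
    interpret mean_equicontinuous_ergodic X T \<mu> by unfold_locales (rule that)
    show ?thesis by (rule discrete_spectrum)
  qed
  then show ?thesis using topological_entropy_eq_0 by blast
qed

end
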